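(* Let $m\ge0$, $\mu,\kappa>0$, $a=\sqrt{\kappa/\mu}$. Let $F\in C^1(\mathbb{R})$ satisfy $F(y)\to-\infty$ as $y\to+\infty$ and $F(y)\to+\infty$ as $y\to-\infty$; if $m>0$, assume in addition condition (F2) or condition (F3) stated in the context. Let $p\in C^1(\mathbb{R})$, $\omega>0$ and $p_0\in\mathbb{R}$ be such that $F(p_0)=0$, $p(z+\omega)=p(z)$ for $z>0$, and $p(z)=p_0$ for $z\le0$. Let $u\in\mathcal{E}$ be the solution of $$(\mu+m\delta(x))\ddot u(x,t)=\kappa u''(x,t)+\delta(x)F(u(x,t)),\quad t>0,\ x\in\mathbb{R},\qquad u(x,t)|_{t\le0}=p(x+at),\quad x\in\mathbb{R}$$ (with $\dot y(0)=0$ for $y(t)=u(0,t)$ if $m>0$). Then $u$ either is time-periodic with period $\omega/a$ for $|x|\le at$, or converges, in the sense of (c), to a function $u_p$ as below. Precisely, there exist a point $q_0\in\mathbb{R}$, depending on $p_0$, and a function $u_p\in\mathcal{E}$ such that: (a) $u_p$ is a solution of the same equation for $t>0$ under the condition $u_p(x,t)|_{t\le0}=q(x+at)$, where $q(x)=q_0$ for $x\le0$ and $q(x)=q_0+p(x)-p_0$ for $x>0$; (b) $u_p(x,t+\omega/a)=u_p(x,t)$ for all $(x,t)\in\mathbb{R}^2$ with $|t|>|x|/a$; (c) for every $R>0$, $$\int_{|x|<R}\left(|\dot u(x,t)-\dot u_p(x,t)|^2+|u'(x,t)-u_p'(x,t)|^2\right)dx+\max_{|x|<R}|u(x,t)-u_p(x,t)|\to0\quad\text{as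 }t\to\infty.$$ Moreover, one can take $q_0=\bar p_0$, where $\bar p_0=\lim_{n\to\infty}T^np_0$ if $m=0$ and $(\bar p_0,\bar y_1)=\lim_{n\to\infty}T^n(p_0,0)$ if $m>0$, and, for $t>0$, $$u_p(x,t)=y_p(t-x/a)-p(at-x)+p(x+at)\ \ (x>0),\qquad u_p(x,t)=y_p(t+x/a)\ \ (x<0),$$ with the map $T$ and the function $y_p$ defined in the context.
   Context: Notation: $\dot u=\partial u/\partial t$, $u'=\partial u/\partial x$; $\delta$ is the Dirac delta. Class $\mathcal{E}$: $u\in\mathcal{E}$ iff $u\in C(\mathbb{R}^2)$ and $\dot u,u'\in L^2_{\rm loc}(\mathbb{R}^2)$ (distributional derivatives). Meaning of the equation for $t>0$: it is equivalent to $\mu\ddot u=\kappa u''$ for $t>0$, $x\neq0$ (in the sense of distributions), together with $m\ddot y(t)=F(y(t))+\kappa[u'(0+,t)-u'(0-,t)]$ for $t>0$, where $y(t)=u(0,t)$. Writing the d'Alembert decomposition $u(x,t)=f_\pm(x-at)+g_\pm(x+at)$ for $\pm x>0$, with $f_\pm,g_\pm$ continuous with derivatives in $L^2_{\rm loc}$, one puts $u'(0\pm,t):=f_\pm'(-at)+g_\pm'(at)$; $\ddot y$ is a distributional derivative. Equation for $y$ for $t>0$: $\dot y=\frac{a}{2\kappa}F(y)+a\,p'(at)$ if $m=0$; $m\ddot y=F(y)-\frac{2\kappa}{a}\dot y+2\kappa p'(at)$ if $m>0$. $T$ is the associated Poincaré map: it sends the initial value at $t=0$ ($y(0)\in\mathbb{R}$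 if $m=0$; $(y(0),\dot y(0))\in\mathbb{R}^2$ if $m>0$) to the value of the solution (of $y$, respectively $(y,\dot y)$) at $t=\omega/a$. The function $y_p$ is the $\omega/a$-periodic solution for $t>0$ with initial value $\bar p_0$ (if $m=0$) or initial data $(\bar p_0,\bar y_1)$ (if $m>0$), extended by $y_p(t)\equiv\bar p_0$ for $t<0$. Conditions used when $m>0$. Put $c=1/m$, $k=2\kappa/(am)=2\sqrt{\kappa\mu}/m$, and consider the system $$\dot y=v,\qquad\dot v=cF(y)-kv+ka\,p'(at).\qquad( * )$$ Condition (F2): for all $y_1\ne y_2$ in $\mathbb{R}$, $$\frac{k^2}{2}-1\le -c\,\frac{F(y_2)-F(y_1)}{y_2-y_1}\le1,\qquad\text{and}\quad 1<\frac{k^2}{2}\le2 .$$ Condition (F3): here $M,N>0$ are constants, independent of the parameters $k$ and $c$, such that every solution $(y(t),v(t))$ of $( * )$ satisfies $|y(t)|\le M$, $|v(t)|\le N$ for all sufficiently large $t$. The condition is: $F\in C^2(\mathbb{R})$; $F'(y)<0$ for $|y|\le M$; there exists $\beta>0$ such that $F(y)\,\mathrm{sgn}\,y\le-\beta$ for $|y|\ge M$; and $$k>\frac12\,N\max_{|y|\le M}\frac{|F''(y)|}{|F'(y)|}.$$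
   Formalization: In (b), periodicity is stated for t>|x|/a, and for t<0 only when t+ω/a<-|x|/a; as printed (all |t|>|x|/a) it fails at x=0, -ω/a<t<0, where u_p(0,t)=q_0 but u_p(0,t+ω/a)=y_p(t+ω/a), for nonconstant p. *)

theory Defs
  imports "HOL-Analysis.Analysis"
begin

section \<open>Distributional derivatives\<close>

definition dir_deriv :: "'a::euclidean_space \<Rightarrow> ('a \<Rightarrow> real) \<Rightarrow> 'a \<Rightarrow> real" where
  "dir_deriv v f = (\<lambda>z. frechet_derivative f (at z) v)"

coinductive smooth_fun :: "('a::euclidean_space \<Rightarrow> real) \<Rightarrow> bool" where
  "\<lbrakk>f differentiable_on UNIV; \<And>v. smooth_fun (dir_deriv v f)\<rbrakk> \<Longrightarrow> smooth_fun f"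

definition test_fun :: "'a::euclidean_space set \<Rightarrow> ('a \<Rightarrow> real) \<Rightarrow> bool" where
  "test_fun U \<phi> \<longleftrightarrow> smooth_fun \<phi> \<and> compact (closure {z. \<phi> z \<noteq> 0}) \<and> closure {z. \<phi> z \<noteq> 0} \<subseteq> U"

text \<open>Elements of \<open>L\<^sup>2\<^sub>l\<^sub>o\<^sub>c\<close> are given by Borel representatives.\<close>

definition L2_loc :: "('a::euclidean_space \<Rightarrow> real) \<Rightarrow> bool" where
  "L2_loc g \<longleftrightarrow> g \<in> borel_measurable borel \<and>
     (\<forall>K. compact K \<longrightarrow> set_integrable lborel K (\<lambda>z. (g z)\<^sup>2))"

text \<open>\<open>g\<close> is the distributional derivative of \<open>f\<close> in direction \<open>v\<close> on the whole space.
  Used only for continuous \<open>f\<close> and \<open>g\<close> in \<open>L\<^sup>2\<^sub>l\<^sub>o\<^sub>c\<close>, so that both integrands are integrable.\<close>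

definition weak_deriv :: "'a::euclidean_space \<Rightarrow> ('a \<Rightarrow> real) \<Rightarrow> ('a \<Rightarrow> real) \<Rightarrow> bool" where
  "weak_deriv v f g \<longleftrightarrow>
     (\<forall>\<phi>. test_fun UNIV \<phi> \<longrightarrow>
        (\<integral>z. f z * dir_deriv v \<phi> z \<partial>lborel) = - (\<integral>z. g z * \<phi> z \<partial>lborel))"

definition L2_weak_deriv :: "'a::euclidean_space \<Rightarrow> ('a \<Rightarrow> real) \<Rightarrow> ('a \<Rightarrow> real) \<Rightarrow> bool" where
  "L2_weak_deriv v f g \<longleftrightarrow> L2_loc g \<and> weak_deriv v f g"

text \<open>Points of the plane are pairs \<open>(x, t)\<close>: \<open>(1, 0)\<close> is the direction of \<open>\<partial>/\<partial>x\<close> and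
  \<open>(0, 1)\<close> that of \<open>\<partial>/\<partial>t\<close>.\<close>

definition class_E :: "(real \<times> real \<Rightarrow> real) set" where
  "class_E = {u. continuous_on UNIV u \<and>
     (\<exists>ut. L2_weak_deriv (0, 1) u ut) \<and> (\<exists>ux. L2_weak_deriv (1, 0) u ux)}"


section \<open>The string equation\<close>

text \<open>The equation \<open>(\<mu> + m \<delta>(x)) u\<^sub>t\<^sub>t = \<kappa> u\<^sub>x\<^sub>x + \<delta>(x) F(u)\<close> for \<open>t > 0\<close>: the wave equation holds in the
  sense of distributions for \<open>t > 0\<close>, \<open>x \<noteq> 0\<close>, and \<open>m y'' = F(y) + \<kappa> [u\<^sub>x(0+,t) - u\<^sub>x(0-,t)]\<close> holds
  in the sense of distributions for \<open>t > 0\<close>, where \<open>u\<^sub>x(0\<plusminus>,t)\<close> is computed from the d'Alembert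
  decompositions in \<open>x > 0\<close> and \<open>x < 0\<close>.  These decompositions are required for all times.  For the
  problems considered here, where \<open>u\<close> is a travelling wave for \<open>t \<le> 0\<close>, the part \<open>t < 0\<close> adds
  nothing, and at \<open>t = 0\<close> it says that \<open>u\<^sub>t\<close> does not jump for \<open>x \<noteq> 0\<close>, i.e. that the data given for
  \<open>t \<le> 0\<close> also prescribe the initial velocity; membership in \<open>class_E\<close> alone would permit a jump.\<close>

definition string_solution ::
    "real \<Rightarrow> real \<Rightarrow> real \<Rightarrow> (real \<Rightarrow> real) \<Rightarrow> (real \<times> real \<Rightarrow> real) \<Rightarrow> bool" where
  "string_solution m \<mu> \<kappa> F u \<longleftrightarrow> (let a = sqrt (\<kappa> / \<mu>) in
     u \<in> class_E \<and>
     (\<forall>\<phi>. test_fun {(x, t). x \<noteq> 0 \<and> t > 0} \<phi> \<longrightarrow>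
        \<mu> * (\<integral>z. u z * dir_deriv (0, 1) (dir_deriv (0, 1) \<phi>) z \<partial>lborel) =
        \<kappa> * (\<integral>z. u z * dir_deriv (1, 0) (dir_deriv (1, 0) \<phi>) z \<partial>lborel)) \<and>
     (\<exists>fp gp fm gm fp' gp' fm' gm'.
        continuous_on UNIV fp \<and> continuous_on UNIV gp \<and>
        continuous_on UNIV fm \<and> continuous_on UNIV gm \<and>
        L2_weak_deriv 1 fp fp' \<and> L2_weak_deriv 1 gp gp' \<and>
        L2_weak_deriv 1 fm fm' \<and> L2_weak_deriv 1 gm gm' \<and>
        (\<forall>x t. x > 0 \<longrightarrow> u (x, t) = fp (x - a * t) + gp (x + a * t)) \<and>
        (\<forall>x t. x < 0 \<longrightarrow> u (x, t) = fm (x - a * t) + gm (x + a * t)) \<and>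
        (\<forall>\<phi>. test_fun {0<..} \<phi> \<longrightarrow>
           m * (\<integral>t. u (0, t) * dir_deriv 1 (dir_deriv 1 \<phi>) t \<partial>lborel) =
           (\<integral>t. (F (u (0, t)) +
                 \<kappa> * ((fp' (- a * t) + gp' (a * t)) - (fm' (- a * t) + gm' (a * t)))) * \<phi> t \<partial>lborel))))"


section \<open>The equation for \<open>y\<close> and its Poincare map\<close>

definition ode_solution_on ::
    "real set \<Rightarrow> (real \<Rightarrow> 'a::real_normed_vector \<Rightarrow> 'a) \<Rightarrow> (real \<Rightarrow> 'a) \<Rightarrow> bool" where
  "ode_solution_on I X Y \<longleftrightarrow> (\<forall>t\<in>I. (Y has_vector_derivative X t (Y t)) (at t within I))"

definition poincare_map :: "(real \<Rightarrow> 'a::real_normed_vector \<Rightarrow> 'a) \<Rightarrow> real \<Rightarrow> 'a \<Rightarrow> 'a" where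
  "poincare_map X \<tau> z = (THE w. \<exists>Y. ode_solution_on {0..\<tau>} X Y \<and> Y 0 = z \<and> Y \<tau> = w)"

definition massless_field ::
    "real \<Rightarrow> real \<Rightarrow> (real \<Rightarrow> real) \<Rightarrow> (real \<Rightarrow> real) \<Rightarrow> real \<Rightarrow> real \<Rightarrow> real" where
  "massless_field \<kappa> a F p t y = a / (2 * \<kappa>) * F y + a * deriv p (a * t)"

text \<open>The equation \<open>m y'' = F(y) - (2\<kappa>/a) y' + 2\<kappa> p'(at)\<close> divided by \<open>m\<close>, as a first-order system
  with \<open>c = 1/m\<close> and \<open>k = 2\<kappa>/(am)\<close>.\<close>

definition massive_field ::
    "real \<Rightarrow> real \<Rightarrow> real \<Rightarrow> (real \<Rightarrow> real) \<Rightarrow> (real \<Rightarrow> real) \<Rightarrow> real \<Rightarrow> real \<times> real \<Rightarrow> real \<times> real" where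
  "massive_field m \<kappa> a F p t = (\<lambda>(y, v). let c = 1 / m; k = 2 * \<kappa> / (a * m) in
     (v, c * F y - k * v + k * a * deriv p (a * t)))"

definition cond_F2 :: "real \<Rightarrow> real \<Rightarrow> real \<Rightarrow> (real \<Rightarrow> real) \<Rightarrow> bool" where
  "cond_F2 m \<kappa> a F \<longleftrightarrow> (let c = 1 / m; k = 2 * \<kappa> / (a * m) in
     (\<forall>y1 y2. y1 \<noteq> y2 \<longrightarrow>
        k\<^sup>2 / 2 - 1 \<le> - c * ((F y2 - F y1) / (y2 - y1)) \<and>
        - c * ((F y2 - F y1) / (y2 - y1)) \<le> 1) \<and>
     1 < k\<^sup>2 / 2 \<and> k\<^sup>2 / 2 \<le> 2)"

text \<open>\<open>M\<close> and \<open>N\<close> are asked to bound the solutions of the system with the given \<open>c\<close>, \<open>k\<close>; constants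
  that do so uniformly in \<open>c\<close> and \<open>k\<close> are a special case.  The supremum is a maximum, since the
  quotient is continuous on \<open>[-M, M]\<close>.\<close>

definition cond_F3 ::
    "real \<Rightarrow> real \<Rightarrow> real \<Rightarrow> (real \<Rightarrow> real) \<Rightarrow> (real \<Rightarrow> real) \<Rightarrow> bool" where
  "cond_F3 m \<kappa> a F p \<longleftrightarrow> (let k = 2 * \<kappa> / (a * m) in
     \<exists>M>0. \<exists>N>0.
       (\<forall>y v. ode_solution_on {0..} (massive_field m \<kappa> a F p) (\<lambda>t. (y t, v t)) \<longrightarrow>
          (\<forall>\<^sub>F t in at_top. \<bar>y t\<bar> \<le> M \<and> \<bar>v t\<bar> \<le> N)) \<and>
       F C1_differentiable_on UNIV \<and> deriv F C1_differentiable_on UNIV \<and>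
       (\<forall>y. \<bar>y\<bar> \<le> M \<longrightarrow> deriv F y < 0) \<and>
       (\<exists>\<beta>>0. \<forall>y. \<bar>y\<bar> \<ge> M \<longrightarrow> F y * sgn y \<le> - \<beta>) \<and>
       k > 1 / 2 * N * (SUP y\<in>{- M..M}. \<bar>deriv (deriv F) y\<bar> / \<bar>deriv F y\<bar>))"


section \<open>Local energy convergence\<close>

text \<open>For a solution, the distributional derivatives \<open>u\<^sub>t\<close>, \<open>u\<^sub>x\<close> have representatives that depend
  continuously on \<open>t > 0\<close> as \<open>L\<^sup>2\<^sub>l\<^sub>o\<^sub>c\<close> functions of \<open>x\<close>.  This determines \<open>u\<^sub>t(\<cdot>,t)\<close> and \<open>u\<^sub>x(\<cdot>,t)\<close> as
  \<open>L\<^sup>2\<^sub>l\<^sub>o\<^sub>c\<close> functions for every single \<open>t > 0\<close>.\<close>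

definition time_continuous_deriv ::
    "real \<times> real \<Rightarrow> (real \<times> real \<Rightarrow> real) \<Rightarrow> (real \<times> real \<Rightarrow> real) \<Rightarrow> bool" where
  "time_continuous_deriv v u D \<longleftrightarrow> L2_weak_deriv v u D \<and>
     (\<forall>R>0. \<forall>t>0.
        set_integrable lborel {-R<..<R} (\<lambda>x. (D (x, t))\<^sup>2) \<and>
        ((\<lambda>s. LINT x:{-R<..<R}|lborel. (D (x, s) - D (x, t))\<^sup>2) \<longlongrightarrow> 0) (at t))"

definition local_energy_convergent ::
    "(real \<times> real \<Rightarrow> real) \<Rightarrow> (real \<times> real \<Rightarrow> real) \<Rightarrow> bool" where
  "local_energy_convergent u w \<longleftrightarrow> (\<exists>ut ux wt wx.
     time_continuous_deriv (0, 1) u ut \<and> time_continuous_deriv (1, 0) u ux \<and>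
     time_continuous_deriv (0, 1) w wt \<and> time_continuous_deriv (1, 0) w wx \<and>
     (\<forall>R>0. ((\<lambda>t.
        (LINT x:{-R<..<R}|lborel. \<bar>ut (x, t) - wt (x, t)\<bar>\<^sup>2 + \<bar>ux (x, t) - wx (x, t)\<bar>\<^sup>2)
        + (SUP x\<in>{-R<..<R}. \<bar>u (x, t) - w (x, t)\<bar>)) \<longlongrightarrow> 0) at_top))"

end

theory Submission
  imports Defs
begin

text \<open>
  For \<open>t \<le> 0\<close> the string carries a travelling wave, so its d'Alembert decomposition is determined by the
  motion \<open>y(t) = u(0, t)\<close> of the origin: \<open>u(x, t) = y(t - |x|/a)\<close>, plus \<open>p(at + x) - p(at - x)\<close> if
  \<open>x > 0\<close>.  By the lemma of du Bois-Reymond, the jump condition turns into a classical periodic ODE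
  for \<open>y\<close>, and every statement about \<open>u\<close> becomes one about \<open>y\<close>.

  Along any bounded solution \<open>Y\<close> for which \<open>Y(n\<tau>)\<close> converges, where \<open>\<tau> = \<omega>/a\<close>, the translates \<open>Y(t + n\<tau>)\<close>
  converge uniformly by Gronwall's inequality.  Their limit is a \<open>\<tau>\<close>-periodic solution attracting \<open>Y\<close>, so that no
  existence theorem for ODEs is needed.  If \<open>m = 0\<close>, solutions of the scalar equation do not cross, so
  \<open>Y(n\<tau>)\<close> is monotone.  If \<open>m > 0\<close>, let \<open>d\<close>, \<open>e = d'\<close> be the differences of two solutions and
  \<open>\<Delta> = - c (F(y1) - F(y2))\<close>, so that \<open>e' = - \<Delta> - k e\<close>.  Then \<open>e\<^sup>2 + k d e + k\<^sup>2/2 d\<^sup>2\<close> under (F2), and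
  \<open>e\<^sup>2 + l d e + l k/2 d\<^sup>2 + d \<Delta>\<close> with \<open>N max |F''|/|F'| < l < 2k\<close> under (F3), is a Lyapunov function
  that decays exponentially; comparing \<open>Y\<close> with \<open>Y(t + \<tau>)\<close> shows that \<open>Y(n\<tau>)\<close> is Cauchy.
\<close>

subsection \<open>Smooth functions\<close>

lemma dir_deriv_eq: "(f has_derivative f') (at z) \<Longrightarrow> dir_deriv v f z = f' v"
  by (simp add: dir_deriv_def frechet_derivative_at[symmetric])

lemma dir_deriv_real:
  "(f has_real_derivative D) (at x) \<Longrightarrow> dir_deriv v f x = v * D"
  by (drule has_field_derivative_imp_has_derivative, drule dir_deriv_eq[where v=v]) simp

lemma smooth_fun_has_derivative:
  assumes "smooth_fun f" shows "(f has_derivative (\<lambda>v. dir_deriv v f z)) (at z)"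
proof -
  have "f differentiable_on UNIV" using assms by cases
  then have "f differentiable at z" by (simp add: differentiable_on_def)
  then show ?thesis unfolding dir_deriv_def using frechet_derivative_works by blast
qed

lemma smooth_fun_dir_deriv: "smooth_fun f \<Longrightarrow> smooth_fun (dir_deriv v f)"
  by (erule smooth_fun.cases) blast

lemma smooth_fun_continuous: "smooth_fun f \<Longrightarrow> continuous_on A f"
  by (meson smooth_fun_has_derivative has_derivative_continuous continuous_at_imp_continuous_on)

lemma smooth_fun_has_real_derivative:
  fixes f :: "real \<Rightarrow> real"
  assumes "smooth_fun f" shows "(f has_real_derivative dir_deriv 1 f x) (at x)"
proof -
  have *: "(f has_derivative (\<lambda>v. dir_deriv v f x)) (at x)" by (rule smooth_fun_has_derivative[OF assms])
  have "dir_deriv v f x = dir_deriv 1 f x * v" for v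
    using linear_scale[OF has_derivative_linear[OF *], of v 1] by simp
  then have "(\<lambda>v. dir_deriv v f x) = (*) (dir_deriv 1 f x)" by (rule ext)
  then show ?thesis unfolding has_field_derivative_def by (rule subst) (rule *)
qed

text \<open>If the derivatives of the generators stay in the generated algebra, then that algebra is a
  coinduction invariant for \<open>smooth_fun\<close>.\<close>

inductive gen_alg :: "('a \<Rightarrow> real) set \<Rightarrow> ('a \<Rightarrow> real) \<Rightarrow> bool" for G where
  gen: "g \<in> G \<Longrightarrow> gen_alg G g"
| const: "gen_alg G (\<lambda>_. c)"
| add: "gen_alg G f \<Longrightarrow> gen_alg G g \<Longrightarrow> gen_alg G (\<lambda>z. f z + g z)"
| mult: "gen_alg G f \<Longrightarrow> gen_alg G g \<Longrightarrow> gen_alg G (\<lambda>z. f z * g z)"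

lemma DERIV_differentiable: "(f has_real_derivative D) (at x) \<Longrightarrow> f differentiable (at x)"
  unfolding has_field_derivative_def by (rule differentiableI)

lemma gen_alg_dir_deriv:
  assumes "gen_alg G f"
    and G: "\<And>g v. g \<in> G \<Longrightarrow> g differentiable_on UNIV \<and> gen_alg G (dir_deriv v g)"
  shows "f differentiable_on UNIV \<and> (\<forall>v. gen_alg G (dir_deriv v f))"
  using assms(1)
proof induction
  case (gen g)
  then show ?case using G by blast
next
  case (const c)
  have "dir_deriv v (\<lambda>_. c) = (\<lambda>_. 0)" for v :: 'a
    by (rule ext, subst dir_deriv_eq[OF has_derivative_const]) simp
  then show ?case by (simp add: gen_alg.const)
next
  case (add f g)
  have d: "(f has_derivative (\<lambda>v. dir_deriv v f z)) (at z)" "(g has_derivative (\<lambda>v. dir_deriv v g z)) (at z)" for z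
    using add.IH by (auto simp: dir_deriv_def differentiable_on_def frechet_derivative_works[symmetric])
  have "dir_deriv v (\<lambda>z. f z + g z) = (\<lambda>z. dir_deriv v f z + dir_deriv v g z)" for v
    by (rule ext, subst dir_deriv_eq[OF has_derivative_add[OF d]]) simp
  with add show ?case by (auto intro!: gen_alg.add)
next
  case (mult f g)
  have d: "(f has_derivative (\<lambda>v. dir_deriv v f z)) (at z)" "(g has_derivative (\<lambda>v. dir_deriv v g z)) (at z)" for z
    using mult.IH by (auto simp: dir_deriv_def differentiable_on_def frechet_derivative_works[symmetric])
  have "dir_deriv v (\<lambda>z. f z * g z) = (\<lambda>z. f z * dir_deriv v g z + dir_deriv v f z * g z)" for v
    by (rule ext, subst dir_deriv_eq[OF has_derivative_mult[OF d]]) simp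
  with mult show ?case by (auto intro!: gen_alg.add gen_alg.mult)
qed

lemma gen_alg_smooth:
  assumes "gen_alg G f"
    and "\<And>g v. g \<in> G \<Longrightarrow> g differentiable_on UNIV \<and> gen_alg G (dir_deriv v g)"
  shows "smooth_fun f"
  using assms(1)
proof (coinduction arbitrary: f)
  case smooth_fun
  with gen_alg_dir_deriv[OF smooth_fun assms(2)] show ?case by blast
qed

lemma gen_alg_smooth_gens:
  assumes "gen_alg {g. smooth_fun g} f" shows "smooth_fun f"
  using assms
proof (rule gen_alg_smooth)
  fix g :: "'a \<Rightarrow> real" and v assume "g \<in> {g. smooth_fun g}"
  then have "smooth_fun g" by simp
  then show "g differentiable_on UNIV \<and> gen_alg {g. smooth_fun g} (dir_deriv v g)"
    by cases (auto intro: gen_alg.gen)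
qed

lemma smooth_fun_const: "smooth_fun (\<lambda>_. c)"
  by (rule gen_alg_smooth_gens) (rule gen_alg.const)

lemma smooth_fun_add: "smooth_fun f \<Longrightarrow> smooth_fun g \<Longrightarrow> smooth_fun (\<lambda>z. f z + g z)"
  by (rule gen_alg_smooth_gens) (auto intro: gen_alg.intros)

lemma smooth_fun_mult: "smooth_fun f \<Longrightarrow> smooth_fun g \<Longrightarrow> smooth_fun (\<lambda>z. f z * g z)"
  by (rule gen_alg_smooth_gens) (auto intro: gen_alg.intros)

lemma smooth_fun_cmult: "smooth_fun f \<Longrightarrow> smooth_fun (\<lambda>z. c * f z)"
  by (intro smooth_fun_mult smooth_fun_const)

lemma dir_deriv_affine_arg:
  fixes f :: "real \<Rightarrow> real"
  assumes "smooth_fun f"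
  shows "dir_deriv v (\<lambda>s. f (c * s + d)) = (\<lambda>s. c * dir_deriv v f (c * s + d))"
proof
  fix s
  have "((\<lambda>s. f (c * s + d)) has_real_derivative dir_deriv 1 f (c * s + d) * c) (at s)"
    by (rule DERIV_chain'[where f="\<lambda>s. c * s + d", unfolded o_def])
      (auto intro!: derivative_eq_intros smooth_fun_has_real_derivative[OF assms])
  note this[THEN dir_deriv_real, of v]
  moreover have "dir_deriv v f (c * s + d) = v * dir_deriv 1 f (c * s + d)"
    by (rule dir_deriv_real[OF smooth_fun_has_real_derivative[OF assms]])
  ultimately show "dir_deriv v (\<lambda>s. f (c * s + d)) s = c * dir_deriv v f (c * s + d)" by simp
qed

lemma smooth_fun_affine_arg:
  fixes f :: "real \<Rightarrow> real"
  assumes "smooth_fun f" shows "smooth_fun (\<lambda>s. f (c * s + d))"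
proof -
  have "smooth_fun (\<lambda>s. b * f (c * s + d))" for b using assms
  proof (coinduction arbitrary: f b)
    case smooth_fun
    have "((\<lambda>s. c * s + d) has_real_derivative c) (at s)" for s
      by (auto intro!: derivative_eq_intros)
    note DERIV_chain2[OF smooth_fun_has_real_derivative[OF smooth_fun] this]
    from DERIV_cmult[OF this, of b] have "((\<lambda>s. b * f (c * s + d)) has_real_derivative b * (dir_deriv 1 f (c * s + d) * c)) (at s)" for s .
    note D = this
    have "dir_deriv v (\<lambda>s. b * f (c * s + d)) = (\<lambda>s. (b * c) * dir_deriv v f (c * s + d))" for v
      by (rule ext, subst dir_deriv_real[OF D], subst dir_deriv_real[OF smooth_fun_has_real_derivative[OF smooth_fun]]) simp
    moreover have "(\<lambda>s. b * f (c * s + d)) differentiable_on UNIV"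
      using DERIV_differentiable[OF D] by (simp only: differentiable_on_def) blast
    ultimately show ?case using smooth_fun_dir_deriv[OF smooth_fun]
      by fast
  qed
  from this[of 1] show ?thesis by simp
qed

subsection \<open>Bump functions\<close>

definition flat :: "nat \<Rightarrow> real \<Rightarrow> real" where
  "flat n x = (if x > 0 then (1 / x) ^ n * exp (- (1 / x)) else 0)"

lemma flat_tendsto_0: "(flat n \<longlongrightarrow> 0) (at_right 0)"
proof -
  have "((\<lambda>x::real. (1 / x) ^ n / exp (1 / x)) \<longlongrightarrow> 0) (at_right 0)"
    by (rule filterlim_compose[OF tendsto_power_div_exp_0])
      (simp add: divide_inverse filterlim_inverse_at_top_right)
  then show ?thesis
    by (rule Lim_transform_eventually)
      (rule eventually_mono[OF eventually_at_right_less[of 0]], simp add: flat_def exp_minus field_simps)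
qed

lemma flat_deriv: "(flat n has_real_derivative (flat (n + 2) x - n * flat (n + 1) x)) (at x)"
proof -
  consider "x > 0" | "x < 0" | "x = 0" by linarith
  then show ?thesis
  proof cases
    case 1
    have y: "((\<lambda>x. 1 / x) has_real_derivative - ((1 / x)^2)) (at x)"
      using 1 by (auto intro!: derivative_eq_intros simp: power2_eq_square)
    have "n * (1 / x)^(n - 1) * ((1 / x)^2) = n * (1 / x)^(n + 1)"
      by (cases n) (simp_all add: power2_eq_square)
    then have "((\<lambda>x. (1 / x) ^ n * exp (- (1 / x))) has_real_derivative (flat (n + 2) x - n * flat (n + 1) x)) (at x)"
      using 1 by (auto intro!: DERIV_cong[OF DERIV_mult[OF DERIV_power[OF y] DERIV_exp[THEN DERIV_chain2, OF DERIV_minus[OF y]]]]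
        simp del: power_one_over simp: flat_def algebra_simps power2_eq_square)
    then show ?thesis
      by (rule has_field_derivative_transform_within_open[where S="{0<..}"]) (use 1 in \<open>auto simp: flat_def\<close>)
  next
    case 2
    have "((\<lambda>x. 0) has_real_derivative 0) (at x)" by simp
    then show ?thesis
      by (rule has_field_derivative_transform_within_open[where S="{..<0}", THEN DERIV_cong])
        (use 2 in \<open>auto simp: flat_def\<close>)
  next
    case 3
    have "((\<lambda>h. flat n h / h) \<longlongrightarrow> 0) (at_right 0)"
      by (rule Lim_transform_eventually[OF flat_tendsto_0[of "Suc n"]])
        (rule eventually_mono[OF eventually_at_right_less[of 0]], simp add: flat_def)
    moreover have "((\<lambda>h. flat n h / h) \<longlongrightarrow> 0) (at_left 0)"
      by (rule Lim_transform_eventually[OF tendsto_const])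
        (auto simp: flat_def eventually_at_filter)
    ultimately have "((\<lambda>h. flat n h / h) \<longlongrightarrow> 0) (at 0)" by (simp add: filterlim_split_at_real)
    then show ?thesis using 3 by (simp add: DERIV_def flat_def)
  qed
qed

lemma flat_smooth: "smooth_fun (flat n)"
proof (rule gen_alg_smooth)
  show "gen_alg (range flat) (flat n)" by (auto intro: gen_alg.gen)
next
  fix g :: "real \<Rightarrow> real" and v assume "g \<in> range flat"
  then obtain k where g: "g = flat k" by auto
  have "dir_deriv v (flat k) = (\<lambda>x. v * (flat (k + 2) x + (- real k) * flat (k + 1) x))"
    by (rule ext, subst dir_deriv_real[OF flat_deriv]) simp
  moreover have "gen_alg (range flat) (\<lambda>x. v * (flat (k + 2) x + (- real k) * flat (k + 1) x))"
    by (intro gen_alg.mult gen_alg.add gen_alg.const) (auto intro: gen_alg.gen)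
  ultimately show "g differentiable_on UNIV \<and> gen_alg (range flat) (dir_deriv v g)"
    using flat_deriv by (auto simp: g differentiable_on_def intro: DERIV_differentiable)
qed

lemma exists_bump:
  fixes \<alpha> \<beta> :: real
  assumes "\<alpha> < \<beta>"
  obtains \<phi> where "smooth_fun \<phi>" "\<And>x. \<phi> x \<ge> 0" "\<And>x. \<phi> x > 0 \<longleftrightarrow> \<alpha> < x \<and> x < \<beta>"
    "closure {x. \<phi> x \<noteq> 0} = {\<alpha>..\<beta>}"
proof
  let ?\<phi> = "\<lambda>x. flat 0 (1 * x + - \<alpha>) * flat 0 ((-1) * x + \<beta>)"
  show "smooth_fun ?\<phi>" by (intro smooth_fun_mult smooth_fun_affine_arg flat_smooth)
  show "?\<phi> x \<ge> 0" for x by (simp add: flat_def)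
  show *: "?\<phi> x > 0 \<longleftrightarrow> \<alpha> < x \<and> x < \<beta>" for x by (simp add: flat_def)
  have "{x. ?\<phi> x \<noteq> 0} = {\<alpha><..<\<beta>}" by (auto simp: flat_def)
  then show "closure {x. ?\<phi> x \<noteq> 0} = {\<alpha>..\<beta>}" using assms by simp
qed

subsection \<open>Test functions\<close>

lemma test_fun_smooth: "test_fun U \<phi> \<Longrightarrow> smooth_fun \<phi>"
  by (simp add: test_fun_def)

lemma test_funI:
  assumes "smooth_fun \<phi>" "compact K" "K \<subseteq> U" "\<And>z. z \<notin> K \<Longrightarrow> \<phi> z = 0"
  shows "test_fun U \<phi>"
proof -
  have "closure {z. \<phi> z \<noteq> 0} \<subseteq> K"
    using assms by (intro closure_minimal) (auto intro: compact_imp_closed)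
  moreover from this have "K \<inter> closure {z. \<phi> z \<noteq> 0} = closure {z. \<phi> z \<noteq> 0}" by blast
  moreover have "compact (K \<inter> closure {z. \<phi> z \<noteq> 0})"
    using assms(2) by (rule compact_Int_closed) (rule closed_closure)
  ultimately show ?thesis using assms(1,3) unfolding test_fun_def by simp
qed

lemma test_funE:
  assumes "test_fun U \<phi>"
  obtains K where "compact K" "K \<subseteq> U" "\<And>z. z \<notin> K \<Longrightarrow> \<phi> z = 0" "\<And>v z. z \<notin> K \<Longrightarrow> dir_deriv v \<phi> z = 0"
proof -
  define K where "K = closure {z. \<phi> z \<noteq> 0}"
  have K: "compact K" "K \<subseteq> U" using assms unfolding test_fun_def K_def by blast+
  have 0: "\<phi> z = 0" if "z \<notin> K" for z
  proof (rule ccontr)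
    assume "\<phi> z \<noteq> 0"
    then have "z \<in> closure {z. \<phi> z \<noteq> 0}" by (intro subsetD[OF closure_subset] CollectI)
    with that show False unfolding K_def by contradiction
  qed
  have "dir_deriv v \<phi> z = 0" if "z \<notin> K" for z v
  proof -
    have "(\<phi> has_derivative (\<lambda>_. 0)) (at z)"
    proof (rule has_derivative_transform_within_open)
      show "((\<lambda>_. 0) has_derivative (\<lambda>_. 0)) (at z)" by simp
      show "open (- K)" using K(1) by (simp add: compact_imp_closed open_Compl)
      show "z \<in> - K" using that by simp
      show "0 = \<phi> x" if "x \<in> - K" for x using 0[of x] that by simp
    qed
    then show ?thesis by (rule dir_deriv_eq)
  qed
  with K 0 that show thesis by blast
qed

lemma test_fun_dir_deriv: "test_fun U \<phi> \<Longrightarrow> test_fun U (dir_deriv v \<phi>)"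
  by (rule test_funE, assumption, rule test_funI) (blast intro: smooth_fun_dir_deriv test_fun_smooth)+

lemma test_fun_mono: "test_fun U \<phi> \<Longrightarrow> U \<subseteq> V \<Longrightarrow> test_fun V \<phi>"
  by (auto simp: test_fun_def)

lemma test_fun_add:
  assumes "test_fun U \<phi>" "test_fun U \<psi>" shows "test_fun U (\<lambda>z. \<phi> z + \<psi> z)"
proof -
  obtain K where K: "compact K" "K \<subseteq> U" "\<And>z. z \<notin> K \<Longrightarrow> \<phi> z = 0" using test_funE[OF assms(1)] by metis
  obtain L where L: "compact L" "L \<subseteq> U" "\<And>z. z \<notin> L \<Longrightarrow> \<psi> z = 0" using test_funE[OF assms(2)] by metis
  show ?thesis
    by (rule test_funI[where K="K \<union> L"])
      (use K L assms in \<open>auto intro: smooth_fun_add test_fun_smooth\<close>)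
qed

lemma test_fun_cmult:
  assumes "test_fun U \<phi>" shows "test_fun U (\<lambda>z. c * \<phi> z)"
proof -
  obtain K where K: "compact K" "K \<subseteq> U" "\<And>z. z \<notin> K \<Longrightarrow> \<phi> z = 0" using test_funE[OF assms(1)] by metis
  show ?thesis
    by (rule test_funI[where K=K]) (use K assms in \<open>auto intro: smooth_fun_cmult test_fun_smooth\<close>)
qed

lemma test_fun_scale:
  fixes \<phi> :: "real \<Rightarrow> real"
  assumes "test_fun UNIV \<phi>" "c \<noteq> 0" shows "test_fun UNIV (\<lambda>s. \<phi> (s / c))"
proof -
  obtain K where K: "compact K" "\<And>z. z \<notin> K \<Longrightarrow> \<phi> z = 0" using test_funE[OF assms(1)] by metis
  show ?thesis
  proof (rule test_funI[where K="(\<lambda>s. c *\<^sub>R s) ` K"])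
    show "smooth_fun (\<lambda>s. \<phi> (s / c))"
      using smooth_fun_affine_arg[OF test_fun_smooth[OF assms(1)], of "1 / c" 0] by simp
    show "compact ((\<lambda>s. c *\<^sub>R s) ` K)" by (rule compact_scaling[OF K(1)])
    show "\<phi> (z / c) = 0" if "z \<notin> (\<lambda>s. c *\<^sub>R s) ` K" for z
    proof (rule K(2))
      show "z / c \<notin> K" using that assms(2) by (auto simp: image_iff dest!: bspec[where x="z / c"])
    qed
  qed simp
qed

subsection \<open>Locally bounded Borel functions\<close>

definition loc_bdd :: "('a::euclidean_space \<Rightarrow> real) \<Rightarrow> bool" where
  "loc_bdd g \<longleftrightarrow> g \<in> borel_measurable borel \<and> (\<forall>K. compact K \<longrightarrow> (\<exists>B. \<forall>z\<in>K. \<bar>g z\<bar> \<le> B))"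

lemma loc_bdd_measurable: "loc_bdd g \<Longrightarrow> g \<in> borel_measurable borel"
  by (simp add: loc_bdd_def)

lemma loc_bdd_bound:
  assumes "loc_bdd g" "compact K" obtains B where "B \<ge> 0" "\<And>z. z \<in> K \<Longrightarrow> \<bar>g z\<bar> \<le> B"
proof -
  obtain B where "\<forall>z\<in>K. \<bar>g z\<bar> \<le> B" using assms unfolding loc_bdd_def by blast
  then show thesis by (intro that[of "max B 0"]) auto
qed

lemma loc_bdd_continuous: "continuous_on UNIV g \<Longrightarrow> loc_bdd g"
  unfolding loc_bdd_def
proof (intro conjI allI impI borel_measurable_continuous_onI)
  fix K :: "'a set" assume "continuous_on UNIV g" "compact K"
  then have "compact (g ` K)" by (intro compact_continuous_image) (auto intro: continuous_on_subset)
  then show "\<exists>B. \<forall>z\<in>K. \<bar>g z\<bar> \<le> B" by (auto dest!: compact_imp_bounded simp: bounded_iff)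
qed

lemma loc_bdd_add:
  assumes "loc_bdd f" "loc_bdd g" shows "loc_bdd (\<lambda>z. f z + g z)"
  unfolding loc_bdd_def
proof (intro conjI allI impI)
  show "(\<lambda>z. f z + g z) \<in> borel_measurable borel" using assms by (auto simp: loc_bdd_def)
  fix K :: "'a set" assume K: "compact K"
  obtain B C where "\<And>z. z \<in> K \<Longrightarrow> \<bar>f z\<bar> \<le> B" "\<And>z. z \<in> K \<Longrightarrow> \<bar>g z\<bar> \<le> C"
    using loc_bdd_bound[OF assms(1) K] loc_bdd_bound[OF assms(2) K] by metis
  then show "\<exists>B. \<forall>z\<in>K. \<bar>f z + g z\<bar> \<le> B"
    by (intro exI[of _ "B + C"]) (auto intro: order.trans[OF abs_triangle_ineq] add_mono)
qed

lemma loc_bdd_mult: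
  assumes "loc_bdd f" "loc_bdd g" shows "loc_bdd (\<lambda>z. f z * g z)"
  unfolding loc_bdd_def
proof (intro conjI allI impI)
  show "(\<lambda>z. f z * g z) \<in> borel_measurable borel" using assms by (auto simp: loc_bdd_def)
  fix K :: "'a set" assume K: "compact K"
  obtain B C where "\<And>z. z \<in> K \<Longrightarrow> \<bar>f z\<bar> \<le> B" "\<And>z. z \<in> K \<Longrightarrow> \<bar>g z\<bar> \<le> C" "B \<ge> 0"
    using loc_bdd_bound[OF assms(1) K] loc_bdd_bound[OF assms(2) K] by metis
  then show "\<exists>B. \<forall>z\<in>K. \<bar>f z * g z\<bar> \<le> B"
    by (intro exI[of _ "B * C"]) (auto simp: abs_mult intro!: mult_mono)
qed

lemma loc_bdd_const: "loc_bdd (\<lambda>_. c)"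
  by (rule loc_bdd_continuous) simp

lemma loc_bdd_indicator: "A \<in> sets borel \<Longrightarrow> loc_bdd (indicator A)"
  unfolding loc_bdd_def by (auto intro!: exI[of _ 1] simp: indicator_def)

lemma loc_bdd_If:
  assumes "loc_bdd f" "loc_bdd g" "Measurable.pred borel P" shows "loc_bdd (\<lambda>z. if P z then f z else g z)"
  unfolding loc_bdd_def
proof (intro conjI allI impI)
  have "f \<in> borel_measurable borel" "g \<in> borel_measurable borel" using assms by (auto simp: loc_bdd_def)
  with assms(3) show "(\<lambda>z. if P z then f z else g z) \<in> borel_measurable borel" by measurable
  fix K :: "'a set" assume K: "compact K"
  obtain B C where "\<And>z. z \<in> K \<Longrightarrow> \<bar>f z\<bar> \<le> B" "\<And>z. z \<in> K \<Longrightarrow> \<bar>g z\<bar> \<le> C"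
    using loc_bdd_bound[OF assms(1) K] loc_bdd_bound[OF assms(2) K] by metis
  then show "\<exists>B. \<forall>z\<in>K. \<bar>if P z then f z else g z\<bar> \<le> B"
    by (intro exI[of _ "max B C"]) (auto simp: le_max_iff_disj)
qed

lemma loc_bdd_compose:
  assumes "loc_bdd g" "continuous_on UNIV f" shows "loc_bdd (\<lambda>z. g (f z))"
  unfolding loc_bdd_def
proof (intro conjI allI impI)
  show "(\<lambda>z. g (f z)) \<in> borel_measurable borel"
    by (rule measurable_compose[OF borel_measurable_continuous_onI[OF assms(2)] loc_bdd_measurable[OF assms(1)]])
  fix K :: "'b set" assume K: "compact K"
  have "compact (f ` K)" using K assms(2) by (intro compact_continuous_image) (auto intro: continuous_on_subset)
  then show "\<exists>B. \<forall>z\<in>K. \<bar>g (f z)\<bar> \<le> B" using loc_bdd_bound[OF assms(1)] by (metis imageI)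
qed

lemma loc_bdd_test_fun: "test_fun U \<phi> \<Longrightarrow> loc_bdd \<phi>"
  by (intro loc_bdd_continuous smooth_fun_continuous test_fun_smooth)

lemma loc_bdd_dir_deriv: "test_fun U \<phi> \<Longrightarrow> loc_bdd (dir_deriv v \<phi>)"
  by (intro loc_bdd_continuous smooth_fun_continuous smooth_fun_dir_deriv test_fun_smooth)

lemma integrable_indicator_compact: "compact K \<Longrightarrow> integrable lborel (\<lambda>z. B * indicator K z :: real)"
  using emeasure_bounded_finite[OF compact_imp_bounded, of K]
  by (intro integrable_mult_right integrable_real_indicator) (simp_all add: borel_compact)

lemma integrable_loc_bdd:
  assumes "loc_bdd h" "compact K" "\<And>z. z \<notin> K \<Longrightarrow> h z = 0"
  shows "integrable lborel h"
proof -
  obtain B where B: "B \<ge> 0" "\<And>z. z \<in> K \<Longrightarrow> \<bar>h z\<bar> \<le> B" using loc_bdd_bound[OF assms(1,2)] by metis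
  have "AE z in lborel. norm (h z) \<le> norm (B * indicator K z)"
    using B assms(3) by (intro AE_I2) (auto simp: indicator_def)
  then show ?thesis
    by (rule Bochner_Integration.integrable_bound[OF integrable_indicator_compact[OF assms(2)], rotated])
      (use assms(1) in \<open>auto simp: loc_bdd_def\<close>)
qed

lemma integrable_mult_test_fun:
  assumes "loc_bdd g" "test_fun U \<phi>" shows "integrable lborel (\<lambda>z. g z * \<phi> z)"
proof -
  obtain K where K: "compact K" "\<And>z. z \<notin> K \<Longrightarrow> \<phi> z = 0" using test_funE[OF assms(2)] by metis
  show ?thesis
    by (rule integrable_loc_bdd[OF loc_bdd_mult[OF assms(1) loc_bdd_test_fun[OF assms(2)]] K(1)]) (simp add: K(2))
qed

lemma loc_bdd_imp_L2_loc:
  assumes "loc_bdd g" shows "L2_loc g"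
  unfolding L2_loc_def
proof (intro conjI allI impI)
  show "g \<in> borel_measurable borel" by (rule loc_bdd_measurable[OF assms])
  fix K :: "'a set" assume K: "compact K"
  have "loc_bdd (\<lambda>z. indicator K z * (g z)\<^sup>2)"
    unfolding power2_eq_square
    by (intro loc_bdd_mult assms loc_bdd_indicator borel_compact K)
  then have "integrable lborel (\<lambda>z. indicator K z * (g z)\<^sup>2)"
    by (rule integrable_loc_bdd[OF _ K]) auto
  then show "set_integrable lborel K (\<lambda>z. (g z)\<^sup>2)" by (simp add: set_integrable_def)
qed

lemma integrable_L2_loc_mult_test_fun:
  assumes "L2_loc g" "test_fun U \<phi>" shows "integrable lborel (\<lambda>z. g z * \<phi> z)"
proof -
  obtain K where K: "compact K" "\<And>z. z \<notin> K \<Longrightarrow> \<phi> z = 0" using test_funE[OF assms(2)] by metis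
  obtain B where B: "B \<ge> 0" "\<And>z. z \<in> K \<Longrightarrow> \<bar>\<phi> z\<bar> \<le> B"
    using loc_bdd_bound[OF loc_bdd_test_fun[OF assms(2)] K(1)] by metis
  let ?h = "\<lambda>z. B * (indicator K z *\<^sub>R (g z)\<^sup>2) + B * indicator K z"
  have "integrable lborel (\<lambda>z. indicator K z *\<^sub>R (g z)\<^sup>2)"
    using assms(1) K(1) unfolding L2_loc_def set_integrable_def by blast
  then have "integrable lborel ?h"
    by (intro Bochner_Integration.integrable_add integrable_mult_right integrable_indicator_compact K)
  moreover have "(\<lambda>z. g z * \<phi> z) \<in> borel_measurable lborel"
    using assms(1) loc_bdd_measurable[OF loc_bdd_test_fun[OF assms(2)]]
    by (auto simp: L2_loc_def intro!: borel_measurable_times)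
  moreover have "norm (g z * \<phi> z) \<le> norm (?h z)" for z
  proof (cases "z \<in> K")
    case True
    have "0 \<le> (\<bar>g z\<bar> - 1)\<^sup>2" by simp
    then have "2 * \<bar>g z\<bar> \<le> (g z)\<^sup>2 + 1" by (simp add: power2_diff)
    then have "\<bar>g z\<bar> \<le> (g z)\<^sup>2 + 1" by linarith
    then have "\<bar>g z\<bar> * \<bar>\<phi> z\<bar> \<le> ((g z)\<^sup>2 + 1) * B" using B(2)[OF True] by (intro mult_mono) auto
    moreover have "?h z = ((g z)\<^sup>2 + 1) * B" using True by (simp add: algebra_simps)
    moreover have "0 \<le> ((g z)\<^sup>2 + 1) * B" using B(1) by simp
    ultimately show ?thesis by (simp only: real_norm_def abs_mult[of "g z" "\<phi> z"] abs_of_nonneg)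
  qed (simp add: K)
  ultimately show ?thesis
    by (rule Bochner_Integration.integrable_bound[OF _ _ AE_I2])
qed

subsection \<open>Integration by parts\<close>

lemma lborel_integral_deriv_eq_0:
  fixes f f' :: "real \<Rightarrow> real"
  assumes f: "continuous_on UNIV f" "finite S" "\<And>t. t \<notin> S \<Longrightarrow> (f has_real_derivative f' t) (at t)"
    and f': "loc_bdd f'" and K: "compact K" "\<And>t. t \<notin> K \<Longrightarrow> f t = 0" "\<And>t. t \<notin> K \<Longrightarrow> f' t = 0"
  shows "(LBINT t. f' t) = 0"
proof -
  obtain b where b: "b > 0" "\<forall>t\<in>K. norm t \<le> b"
    using compact_imp_bounded[OF K(1)] unfolding bounded_pos by blast
  define B where "B = b + 1"
  have B: "\<bar>t\<bar> < B" if "t \<in> K" for t using b that by (force simp: B_def)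
  have "B > 0" using b by (simp add: B_def)
  have "(f' has_integral f B - f (- B)) {- B..B}"
    by (rule fundamental_theorem_of_calculus_strong[OF f(2)])
      (use \<open>B > 0\<close> f in \<open>auto simp: has_real_derivative_iff_has_vector_derivative[symmetric]
          intro: has_field_derivative_at_within continuous_on_subset\<close>)
  moreover have "B \<notin> K" "- B \<notin> K" using B(1) by (force)+
  ultimately have "(f' has_integral 0) {- B..B}" using K by simp
  then have "(f' has_integral 0) UNIV"
    by (rule has_integral_on_superset) (use B K in \<open>force+\<close>)
  moreover have "(f' has_integral (LBINT t. f' t)) UNIV"
    by (rule has_integral_integral_lborel[OF integrable_loc_bdd[OF f' K(1,3)]])
  ultimately show ?thesis using has_integral_unique by blast
qed

lemma integral_by_parts_compact_support:
  fixes w D \<psi> \<psi>' :: "real \<Rightarrow> real"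
  assumes w: "continuous_on UNIV w" "finite S" "\<And>t. t \<notin> S \<Longrightarrow> (w has_real_derivative D t) (at t)" "loc_bdd D"
    and \<psi>: "\<And>t. (\<psi> has_real_derivative \<psi>' t) (at t)" "continuous_on UNIV \<psi>'"
    and K: "compact K" "\<And>t. t \<notin> K \<Longrightarrow> \<psi> t = 0" "\<And>t. t \<notin> K \<Longrightarrow> \<psi>' t = 0"
  shows "(LBINT t. w t * \<psi>' t) = - (LBINT t. D t * \<psi> t)"
proof -
  have c: "continuous_on UNIV \<psi>" using \<psi>(1) by (meson DERIV_isCont continuous_at_imp_continuous_on)
  have lb: "loc_bdd (\<lambda>t. w t * \<psi>' t)" "loc_bdd (\<lambda>t. D t * \<psi> t)"
    by (intro loc_bdd_mult loc_bdd_continuous w \<psi> c)+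
  have "(LBINT t. w t * \<psi>' t + D t * \<psi> t) = 0"
    by (rule lborel_integral_deriv_eq_0[where f="\<lambda>t. w t * \<psi> t" and S=S and K=K])
      (use w \<psi> c K lb in \<open>auto intro!: continuous_intros derivative_eq_intros loc_bdd_add\<close>)
  moreover have "integrable lborel (\<lambda>t. w t * \<psi>' t)" "integrable lborel (\<lambda>t. D t * \<psi> t)"
    by (rule integrable_loc_bdd[OF _ K(1)]; use K lb in simp)+
  ultimately show ?thesis by simp
qed

lemma L2_weak_deriv_1I:
  fixes w D :: "real \<Rightarrow> real"
  assumes w: "continuous_on UNIV w" "finite S" "\<And>t. t \<notin> S \<Longrightarrow> (w has_real_derivative D t) (at t)" "loc_bdd D"
  shows "L2_weak_deriv 1 w D"
  unfolding L2_weak_deriv_def weak_deriv_def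
proof (intro conjI allI impI loc_bdd_imp_L2_loc w)
  fix \<phi> :: "real \<Rightarrow> real" assume \<phi>: "test_fun UNIV \<phi>"
  obtain K where K: "compact K" "\<And>z. z \<notin> K \<Longrightarrow> \<phi> z = 0" "\<And>v z. z \<notin> K \<Longrightarrow> dir_deriv v \<phi> z = 0"
    using test_funE[OF \<phi>] by metis
  show "(LBINT z. w z * dir_deriv 1 \<phi> z) = - (LBINT z. D z * \<phi> z)"
    by (rule integral_by_parts_compact_support[OF w _ _ K])
      (use test_fun_smooth[OF \<phi>] in \<open>auto intro: smooth_fun_has_real_derivative smooth_fun_continuous smooth_fun_dir_deriv\<close>)
qed

subsection \<open>The lemma of du Bois-Reymond on the half-line\<close>

lemma test_fun_half_lineE:
  assumes "test_fun {0<..} \<phi>"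
  obtains \<alpha> \<beta> :: real where "0 < \<alpha>" "\<alpha> < \<beta>" "\<And>x. x \<le> \<alpha> \<or> \<beta> \<le> x \<Longrightarrow> \<phi> x = 0"
proof -
  obtain K where K: "compact K" "K \<subseteq> {0<..}" "\<And>z. z \<notin> K \<Longrightarrow> \<phi> z = 0" using test_funE[OF assms] by metis
  show thesis
  proof (cases "K = {}")
    case True
    then show thesis using K(3) by (intro that[of 1 2]) auto
  next
    case False
    obtain l where l: "l \<in> K" "\<forall>y\<in>K. l \<le> y" using compact_attains_inf[OF K(1) False] by blast
    obtain b where b: "b \<in> K" "\<forall>y\<in>K. y \<le> b" using compact_attains_sup[OF K(1) False] by blast
    have "l > 0" "l \<le> b" using l b K(2) by auto
    show thesis
    proof (rule that[of "l / 2" "b + 1"])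
      show "\<phi> x = 0" if "x \<le> l / 2 \<or> b + 1 \<le> x" for x
        by (rule K(3)) (use l b that \<open>l > 0\<close> in force)
    qed (use \<open>l > 0\<close> \<open>l \<le> b\<close> in auto)
  qed
qed

lemma test_fun_primitive:
  fixes \<phi> :: "real \<Rightarrow> real"
  assumes \<phi>: "test_fun {0<..} \<phi>" and int: "(LBINT t. \<phi> t) = 0"
  obtains \<psi> where "test_fun {0<..} \<psi>" "dir_deriv 1 \<psi> = \<phi>"
proof -
  obtain \<alpha> \<beta> where ab: "0 < \<alpha>" "\<alpha> < \<beta>" "\<And>x. x \<le> \<alpha> \<or> \<beta> \<le> x \<Longrightarrow> \<phi> x = 0"
    using test_fun_half_lineE[OF \<phi>] by metis
  have cont: "continuous_on UNIV \<phi>" by (rule smooth_fun_continuous[OF test_fun_smooth[OF \<phi>]])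
  then have "isCont \<phi> x" for x by (simp add: continuous_on_eq_continuous_at)
  then obtain P where P: "\<And>x. (P has_vector_derivative \<phi> x) (at x)"
    using einterval_antiderivative[of "-\<infinity>" "\<infinity>" \<phi>] by auto
  define \<psi> where "\<psi> x = P x - P \<alpha>" for x
  have D: "(\<psi> has_real_derivative \<phi> x) (at x)" for x
    using P[of x] unfolding \<psi>_def has_real_derivative_iff_has_vector_derivative
    by (auto intro!: derivative_eq_intros)
  have FTC: "(\<phi> has_integral (\<psi> y - \<psi> x)) {x..y}" if "x \<le> y" for x y
    by (rule fundamental_theorem_of_calculus[OF that])
      (auto simp: has_real_derivative_iff_has_vector_derivative[symmetric] intro: has_field_derivative_at_within D)
  have left: "\<psi> x = 0" if "x \<le> \<alpha>" for x
  proof -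
    have "(\<phi> has_integral 0) {x..\<alpha>}" by (rule has_integral_is_0) (use ab in auto)
    with FTC[OF that] have "\<psi> \<alpha> - \<psi> x = 0" by (rule has_integral_unique)
    then show ?thesis by (simp add: \<psi>_def)
  qed
  have right: "\<psi> x = 0" if "\<beta> \<le> x" for x
  proof -
    have "(\<phi> has_integral (\<psi> x - \<psi> \<alpha>)) {\<alpha>..x}" using FTC ab that by simp
    then have "(\<phi> has_integral (\<psi> x - \<psi> \<alpha>)) UNIV"
      by (rule has_integral_on_superset) (use ab that in auto)
    moreover have "(\<phi> has_integral 0) UNIV"
      using has_integral_integral_lborel[of \<phi>] int
        integrable_mult_test_fun[OF loc_bdd_const[of 1] \<phi>] by simp
    ultimately have "\<psi> x - \<psi> \<alpha> = 0" by (rule has_integral_unique)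
    then show ?thesis by (simp add: \<psi>_def)
  qed
  have dd: "dir_deriv v \<psi> = (\<lambda>x. v * \<phi> x)" for v by (rule ext) (rule dir_deriv_real[OF D])
  have "smooth_fun \<psi>"
  proof (rule smooth_fun.intros)
    show "\<psi> differentiable_on UNIV" using DERIV_differentiable[OF D] by (simp add: differentiable_on_def)
    show "smooth_fun (dir_deriv v \<psi>)" for v
      unfolding dd by (rule smooth_fun_cmult[OF test_fun_smooth[OF \<phi>]])
  qed
  then have "test_fun {0<..} \<psi>"
    by (rule test_funI[of _ "{\<alpha>..\<beta>}"]) (use ab left right in \<open>auto simp: not_le\<close>)
  then show thesis by (rule that) (simp add: dd)
qed

lemma lborel_integral_nonneg_eq_0:
  fixes f :: "real \<Rightarrow> real"
  assumes "continuous_on UNIV f" "\<And>x. 0 \<le> f x" "\<alpha> < \<beta>" "\<And>x. x \<notin> {\<alpha>..\<beta>} \<Longrightarrow> f x = 0"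
    and "(LBINT t. f t) = 0"
  shows "f x = 0"
proof (cases "x \<in> {\<alpha>..\<beta>}")
  case True
  have "integrable lborel f"
    by (rule integrable_loc_bdd[OF loc_bdd_continuous[OF assms(1)], of "{\<alpha>..\<beta>}"]) (use assms(4) in auto)
  from has_integral_integral_lborel[OF this] have "(f has_integral 0) UNIV" by (simp add: assms(5))
  moreover have "(\<lambda>x. if x \<in> {\<alpha>..\<beta>} then f x else 0) = f" using assms(4) by auto
  ultimately have "(f has_integral 0) {\<alpha>..\<beta>}" using has_integral_restrict_UNIV[of "{\<alpha>..\<beta>}" f 0] by simp
  moreover have "continuous_on {\<alpha>..\<beta>} f" using assms(1) continuous_on_subset by blast
  ultimately show ?thesis
    using has_integral_0_cbox_imp_0[of \<alpha> \<beta> f x] assms(2,3) True by simp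
qed (use assms(4) in auto)

lemma exists_unit_test_fun:
  obtains \<rho> :: "real \<Rightarrow> real" where "test_fun {0<..} \<rho>" "(LBINT t. \<rho> t) = 1"
proof -
  obtain \<phi> :: "real \<Rightarrow> real" where \<phi>: "smooth_fun \<phi>" "\<And>x. \<phi> x \<ge> 0" "\<And>x. \<phi> x > 0 \<longleftrightarrow> 1 < x \<and> x < 2"
    "closure {x. \<phi> x \<noteq> 0} = {1..2}" by (rule exists_bump[of 1 2]) auto
  have t: "test_fun {0<..} \<phi>" unfolding test_fun_def using \<phi> by auto
  let ?I = "LBINT t. \<phi> t"
  have z: "\<phi> x = 0" if "x \<notin> {1..2}" for x
    using \<phi>(2)[of x] \<phi>(3)[of x] that by (simp add: order_le_less) linarith
  have "?I \<noteq> 0"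
  proof
    assume "?I = 0"
    have "\<phi> (3/2) = 0"
      by (rule lborel_integral_nonneg_eq_0[of \<phi> 1 2, OF smooth_fun_continuous[OF \<phi>(1)] \<phi>(2) _ z \<open>?I = 0\<close>]) simp_all
    then show False using \<phi>(3)[of "3/2"] by simp
  qed
  then show thesis
    by (intro that[of "\<lambda>x. (1 / ?I) * \<phi> x"] test_fun_cmult t) simp
qed

lemma du_Bois_Reymond_0_nonneg:
  fixes h :: "real \<Rightarrow> real"
  assumes h: "continuous_on UNIV h" and 0: "\<And>\<phi>. test_fun {0<..} \<phi> \<Longrightarrow> (LBINT t. h t * \<phi> t) = 0"
    and t: "t > 0"
  shows "h t \<le> 0"
proof (rule ccontr)
  assume "\<not> h t \<le> 0"
  then have "h t > 0" by simp
  have "open {s. h s > 0}" using h by (intro open_Collect_less) auto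
  then obtain e where e: "e > 0" "ball t e \<subseteq> {s. h s > 0}"
    using \<open>h t > 0\<close> by (metis mem_Collect_eq open_contains_ball)
  define d where "d = min e t / 2"
  have d: "d > 0" "d < e" "d < t" using e t by (auto simp: d_def min_def)
  obtain \<phi> :: "real \<Rightarrow> real" where \<phi>: "smooth_fun \<phi>" "\<And>x. \<phi> x \<ge> 0" "\<And>x. \<phi> x > 0 \<longleftrightarrow> t - d < x \<and> x < t + d"
    "closure {x. \<phi> x \<noteq> 0} = {t - d..t + d}" by (rule exists_bump[of "t - d" "t + d"]) (use d in auto)
  have tf: "test_fun {0<..} \<phi>" unfolding test_fun_def using \<phi> d by auto
  have z: "\<phi> x = 0" if "x \<notin> {t - d..t + d}" for x
    using \<phi>(2)[of x] \<phi>(3)[of x] that by (simp add: order_le_less) linarith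
  have pos: "h x > 0" if "x \<in> {t - d..t + d}" for x
  proof -
    have "x \<in> ball t e" using that d by (simp add: dist_real_def) linarith
    then show ?thesis using e(2) by blast
  qed
  have "h t * \<phi> t = 0"
  proof (rule lborel_integral_nonneg_eq_0[where f="\<lambda>t. h t * \<phi> t" and \<alpha>="t - d" and \<beta>="t + d"])
    show "continuous_on UNIV (\<lambda>t. h t * \<phi> t)" by (intro continuous_intros h smooth_fun_continuous \<phi>)
    show "0 \<le> h x * \<phi> x" for x
    proof (cases "x \<in> {t - d..t + d}")
      case True
      then show ?thesis using pos[OF True] \<phi>(2)[of x] by simp
    next
      case False
      then show ?thesis using z[OF False] by simp
    qed
    show "h x * \<phi> x = 0" if "x \<notin> {t - d..t + d}" for x using z[OF that] by simp
    show "(LBINT t. h t * \<phi> t) = 0" by (rule 0[OF tf])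
  qed (use d in simp)
  moreover have "\<phi> t > 0" using \<phi>(3) d by simp
  ultimately show False using \<open>h t > 0\<close> by simp
qed

lemma du_Bois_Reymond_0:
  fixes h :: "real \<Rightarrow> real"
  assumes h: "continuous_on UNIV h" and 0: "\<And>\<phi>. test_fun {0<..} \<phi> \<Longrightarrow> (LBINT t. h t * \<phi> t) = 0"
    and t: "t > 0"
  shows "h t = 0"
proof -
  have "h t \<le> 0" by (rule du_Bois_Reymond_0_nonneg[OF h 0 t])
  moreover have "- h t \<le> 0"
    by (rule du_Bois_Reymond_0_nonneg[of "\<lambda>t. - h t"]) (simp_all add: 0 t h continuous_on_minus)
  ultimately show ?thesis by simp
qed

lemma test_fun_integrable: "test_fun U \<phi> \<Longrightarrow> integrable lborel \<phi>"
  using integrable_mult_test_fun[OF loc_bdd_const[of 1], of U \<phi>] by simp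

lemma test_fun_minus_mean:
  fixes \<phi> \<rho> :: "real \<Rightarrow> real"
  assumes "test_fun {0<..} \<phi>" "test_fun {0<..} \<rho>" "(LBINT t. \<rho> t) = 1"
  obtains \<psi> where "test_fun {0<..} \<psi>" "dir_deriv 1 \<psi> = (\<lambda>t. \<phi> t + (- (LBINT t. \<phi> t)) * \<rho> t)"
proof -
  let ?f = "\<lambda>t. \<phi> t + (- (LBINT t. \<phi> t)) * \<rho> t"
  have "test_fun {0<..} ?f" by (intro test_fun_add test_fun_cmult assms)
  moreover have "(LBINT t. ?f t) = 0"
    using test_fun_integrable[OF assms(1)] test_fun_integrable[OF assms(2)] assms(3) by simp
  ultimately show thesis using test_fun_primitive that by blast
qed

lemma du_Bois_Reymond_1:
  fixes h :: "real \<Rightarrow> real"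
  assumes h: "continuous_on UNIV h" and 1: "\<And>\<phi>. test_fun {0<..} \<phi> \<Longrightarrow> (LBINT t. h t * dir_deriv 1 \<phi> t) = 0"
  obtains c :: real where "\<And>t. t > 0 \<Longrightarrow> h t = c"
proof -
  obtain \<rho> :: "real \<Rightarrow> real" where \<rho>: "test_fun {0<..} \<rho>" "(LBINT t. \<rho> t) = 1" by (rule exists_unit_test_fun)
  define c where "c = (LBINT t. h t * \<rho> t)"
  note lb = loc_bdd_continuous[OF h]
  have "h t + - c = 0" if "t > 0" for t
  proof (rule du_Bois_Reymond_0[where h="\<lambda>t. h t + - c"])
    show "continuous_on UNIV (\<lambda>t. h t + - c)" by (intro continuous_intros h)
    fix \<phi> :: "real \<Rightarrow> real" assume \<phi>: "test_fun {0<..} \<phi>"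
    let ?s = "LBINT t. \<phi> t"
    obtain \<psi> where \<psi>: "test_fun {0<..} \<psi>" "dir_deriv 1 \<psi> = (\<lambda>t. \<phi> t + (- ?s) * \<rho> t)"
      by (rule test_fun_minus_mean[OF \<phi> \<rho>])
    note i = integrable_mult_test_fun[OF lb \<phi>] integrable_mult_test_fun[OF lb \<rho>(1)] test_fun_integrable[OF \<phi>]
    have "0 = (LBINT t. h t * \<phi> t + (- ?s) * (h t * \<rho> t))"
      using 1[OF \<psi>(1)] by (simp add: \<psi>(2) algebra_simps)
    also have "\<dots> = (LBINT t. h t * \<phi> t) + (- ?s) * c"
      using i by (simp add: c_def)
    also have "\<dots> = (LBINT t. h t * \<phi> t + (- c) * \<phi> t)"
      using i by simp
    finally show "(LBINT t. (h t + - c) * \<phi> t) = 0" by (simp add: algebra_simps)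
  qed (rule that)
  then show thesis using that[of c] by simp
qed

lemma dir_deriv_add_cmult:
  assumes "smooth_fun f" "smooth_fun g"
  shows "dir_deriv v (\<lambda>z. f z + c * g z) = (\<lambda>z. dir_deriv v f z + c * dir_deriv v g z)"
proof
  fix z
  have "((\<lambda>z. f z + c * g z) has_derivative (\<lambda>v. dir_deriv v f z + c * dir_deriv v g z)) (at z)"
    by (intro has_derivative_add has_derivative_mult_right smooth_fun_has_derivative assms)
  then show "dir_deriv v (\<lambda>z. f z + c * g z) z = dir_deriv v f z + c * dir_deriv v g z"
    by (rule dir_deriv_eq)
qed

lemma du_Bois_Reymond_2:
  fixes h :: "real \<Rightarrow> real"
  assumes h: "continuous_on UNIV h"
    and 2: "\<And>\<phi>. test_fun {0<..} \<phi> \<Longrightarrow> (LBINT t. h t * dir_deriv 1 (dir_deriv 1 \<phi>) t) = 0"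
  obtains b c :: real where "\<And>t. t > 0 \<Longrightarrow> h t = b + c * t"
proof -
  obtain \<rho> :: "real \<Rightarrow> real" where \<rho>: "test_fun {0<..} \<rho>" "(LBINT t. \<rho> t) = 1" by (rule exists_unit_test_fun)
  define c where "c = (LBINT t. h t * dir_deriv 1 \<rho> t)"
  note lb = loc_bdd_continuous[OF h]
  have 1: "(LBINT t. (h t + c * t) * dir_deriv 1 \<phi> t) = 0" if \<phi>: "test_fun {0<..} \<phi>" for \<phi>
  proof -
    let ?s = "LBINT t. \<phi> t"
    obtain \<psi> where \<psi>: "test_fun {0<..} \<psi>" "dir_deriv 1 \<psi> = (\<lambda>t. \<phi> t + (- ?s) * \<rho> t)"
      by (rule test_fun_minus_mean[OF \<phi> \<rho>])
    have "loc_bdd (\<lambda>t::real. t)" by (rule loc_bdd_continuous) (rule continuous_on_id)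
    note i = integrable_mult_test_fun[OF lb test_fun_dir_deriv[OF \<phi>], of 1]
      integrable_mult_test_fun[OF lb test_fun_dir_deriv[OF \<rho>(1)], of 1]
      integrable_mult_test_fun[OF this test_fun_dir_deriv[OF \<phi>], of 1]
    have "L2_weak_deriv 1 (\<lambda>t. t) (\<lambda>_. 1)"
      by (rule L2_weak_deriv_1I[where S="{}"]) (auto intro: loc_bdd_const continuous_on_id)
    then have s: "(LBINT t. t * dir_deriv 1 \<phi> t) = - ?s"
      using test_fun_mono[OF \<phi>, of UNIV] by (simp add: L2_weak_deriv_def weak_deriv_def)
    have "0 = (LBINT t. h t * dir_deriv 1 \<phi> t + (- ?s) * (h t * dir_deriv 1 \<rho> t))"
      using 2[OF \<psi>(1)] dir_deriv_add_cmult[OF test_fun_smooth[OF \<phi>] test_fun_smooth[OF \<rho>(1)], of 1 "- ?s"]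
      by (simp add: \<psi>(2) algebra_simps)
    also have "\<dots> = (LBINT t. h t * dir_deriv 1 \<phi> t) + c * (LBINT t. t * dir_deriv 1 \<phi> t)"
      using i by (simp add: c_def s)
    also have "\<dots> = (LBINT t. h t * dir_deriv 1 \<phi> t + c * (t * dir_deriv 1 \<phi> t))"
      using i by simp
    finally show ?thesis by (simp add: algebra_simps)
  qed
  have "continuous_on UNIV (\<lambda>t. h t + c * t)" by (intro continuous_intros h)
  from du_Bois_Reymond_1[OF this 1] obtain b where b: "\<And>t. t > 0 \<Longrightarrow> h t + c * t = b" by blast
  show thesis
  proof (rule that)
    show "h t = b + (- c) * t" if "t > 0" for t using b[OF that] by simp
  qed
qed

subsection \<open>Integration in the plane\<close>

lemma lborel_integral_pair_fst:
  fixes h :: "real \<times> real \<Rightarrow> real"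
  assumes "integrable lborel h"
  shows "(LBINT z. h z) = (LBINT x. (LBINT t. h (x, t)))"
  using lborel_pair.integral_fst'[of h] assms by (simp add: lborel_prod)

lemma lborel_integral_pair_snd:
  fixes h :: "real \<times> real \<Rightarrow> real"
  assumes "integrable lborel h"
  shows "(LBINT z. h z) = (LBINT t. (LBINT x. h (x, t)))"
  using lborel_pair.integral_snd[of "\<lambda>x y. h (x, y)"] assms by (simp add: lborel_prod)

lemma smooth_fun_has_real_derivative_along:
  assumes "smooth_fun \<phi>" "(\<gamma> has_vector_derivative v) (at r)"
  shows "((\<lambda>r. \<phi> (\<gamma> r)) has_real_derivative dir_deriv v \<phi> (\<gamma> r)) (at r)"
proof -
  have D: "(\<phi> has_derivative (\<lambda>v. dir_deriv v \<phi> (\<gamma> r))) (at (\<gamma> r))" by (rule smooth_fun_has_derivative[OF assms(1)])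
  have "((\<lambda>r. \<phi> (\<gamma> r)) has_derivative (\<lambda>h. dir_deriv (h *\<^sub>R v) \<phi> (\<gamma> r))) (at r)"
    by (rule has_derivative_compose[OF assms(2)[unfolded has_vector_derivative_def] D])
  moreover have "(\<lambda>h. dir_deriv (h *\<^sub>R v) \<phi> (\<gamma> r)) = (*) (dir_deriv v \<phi> (\<gamma> r))"
    using linear_scale[OF has_derivative_linear[OF D]] by (intro ext) simp
  ultimately show ?thesis by (simp add: has_field_derivative_def)
qed

lemma has_vector_derivative_Pair_lines:
  "((\<lambda>t. (x, t)) has_vector_derivative (0, 1)) (at t)"
  "((\<lambda>x. (x, t)) has_vector_derivative (1, 0)) (at x)"
  "((\<lambda>t. (s + c * t, t)) has_vector_derivative (c, 1)) (at t)" for x t s c :: real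
  by (auto simp: has_vector_derivative_def intro!: derivative_eq_intros)

lemma L2_weak_deriv_timeI:
  fixes w D :: "real \<times> real \<Rightarrow> real"
  assumes w: "continuous_on UNIV w" and D: "loc_bdd D"
    and S: "\<And>x. finite (S x)" "\<And>x t. t \<notin> S x \<Longrightarrow> ((\<lambda>t. w (x, t)) has_real_derivative D (x, t)) (at t)"
  shows "L2_weak_deriv (0, 1) w D"
  unfolding L2_weak_deriv_def weak_deriv_def
proof (intro conjI allI impI loc_bdd_imp_L2_loc D)
  fix \<phi> :: "real \<times> real \<Rightarrow> real" assume \<phi>: "test_fun UNIV \<phi>"
  obtain K where K: "compact K" "\<And>z. z \<notin> K \<Longrightarrow> \<phi> z = 0" "\<And>v z. z \<notin> K \<Longrightarrow> dir_deriv v \<phi> z = 0"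
    using test_funE[OF \<phi>] by metis
  have slice: "continuous_on UNIV (\<lambda>t. (x, t))" for x :: real by (intro continuous_intros)
  have "(LBINT t. w (x, t) * dir_deriv (0, 1) \<phi> (x, t)) = - (LBINT t. D (x, t) * \<phi> (x, t))" for x
  proof (rule integral_by_parts_compact_support[where S="S x" and K="snd ` K"])
    show "continuous_on UNIV (\<lambda>t. w (x, t))"
      by (rule continuous_on_compose2[OF w slice]) simp
    show "loc_bdd (\<lambda>t. D (x, t))" by (rule loc_bdd_compose[OF D slice])
    show "continuous_on UNIV (\<lambda>t. dir_deriv (0, 1) \<phi> (x, t))"
      by (rule continuous_on_compose2[OF smooth_fun_continuous[OF smooth_fun_dir_deriv[OF test_fun_smooth[OF \<phi>]], of UNIV] slice]) simp
    show "((\<lambda>t. \<phi> (x, t)) has_real_derivative dir_deriv (0, 1) \<phi> (x, t)) (at t)" for t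
      by (intro smooth_fun_has_real_derivative_along test_fun_smooth[OF \<phi>] has_vector_derivative_Pair_lines)
    show "compact (snd ` K)" by (intro compact_continuous_image K continuous_intros)
    show "\<phi> (x, t) = 0" "dir_deriv (0, 1) \<phi> (x, t) = 0" if "t \<notin> snd ` K" for t
      using that K(2,3)[of "(x, t)"] by force+
  qed (use S in auto)
  then show "(LBINT z. w z * dir_deriv (0, 1) \<phi> z) = - (LBINT z. D z * \<phi> z)"
    using lborel_integral_pair_fst[OF integrable_mult_test_fun[OF loc_bdd_continuous[OF w] test_fun_dir_deriv[OF \<phi>]]]
      lborel_integral_pair_fst[OF integrable_mult_test_fun[OF D \<phi>]] by simp
qed

lemma L2_weak_deriv_spaceI:
  fixes w D :: "real \<times> real \<Rightarrow> real"
  assumes w: "continuous_on UNIV w" and D: "loc_bdd D"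
    and S: "\<And>t. finite (S t)" "\<And>x t. x \<notin> S t \<Longrightarrow> ((\<lambda>x. w (x, t)) has_real_derivative D (x, t)) (at x)"
  shows "L2_weak_deriv (1, 0) w D"
  unfolding L2_weak_deriv_def weak_deriv_def
proof (intro conjI allI impI loc_bdd_imp_L2_loc D)
  fix \<phi> :: "real \<times> real \<Rightarrow> real" assume \<phi>: "test_fun UNIV \<phi>"
  obtain K where K: "compact K" "\<And>z. z \<notin> K \<Longrightarrow> \<phi> z = 0" "\<And>v z. z \<notin> K \<Longrightarrow> dir_deriv v \<phi> z = 0"
    using test_funE[OF \<phi>] by metis
  have slice: "continuous_on UNIV (\<lambda>x. (x, t))" for t :: real by (intro continuous_intros)
  have "(LBINT x. w (x, t) * dir_deriv (1, 0) \<phi> (x, t)) = - (LBINT x. D (x, t) * \<phi> (x, t))" for t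
  proof (rule integral_by_parts_compact_support[where S="S t" and K="fst ` K"])
    show "continuous_on UNIV (\<lambda>x. w (x, t))"
      by (rule continuous_on_compose2[OF w slice]) simp
    show "loc_bdd (\<lambda>x. D (x, t))" by (rule loc_bdd_compose[OF D slice])
    show "continuous_on UNIV (\<lambda>x. dir_deriv (1, 0) \<phi> (x, t))"
      by (rule continuous_on_compose2[OF smooth_fun_continuous[OF smooth_fun_dir_deriv[OF test_fun_smooth[OF \<phi>]], of UNIV] slice]) simp
    show "((\<lambda>x. \<phi> (x, t)) has_real_derivative dir_deriv (1, 0) \<phi> (x, t)) (at x)" for x
      by (intro smooth_fun_has_real_derivative_along test_fun_smooth[OF \<phi>] has_vector_derivative_Pair_lines)
    show "compact (fst ` K)" by (intro compact_continuous_image K continuous_intros)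
    show "\<phi> (x, t) = 0" "dir_deriv (1, 0) \<phi> (x, t) = 0" if "x \<notin> fst ` K" for x
      using that K(2,3)[of "(x, t)"] by force+
  qed (use S in auto)
  then show "(LBINT z. w z * dir_deriv (1, 0) \<phi> z) = - (LBINT z. D z * \<phi> z)"
    using lborel_integral_pair_snd[OF integrable_mult_test_fun[OF loc_bdd_continuous[OF w] test_fun_dir_deriv[OF \<phi>]]]
      lborel_integral_pair_snd[OF integrable_mult_test_fun[OF D \<phi>]] by simp
qed

lemma lborel_integral_along_characteristics:
  fixes g :: "real \<times> real \<Rightarrow> real" and h :: "real \<Rightarrow> real"
  assumes g: "loc_bdd g" "compact K" "\<And>z. z \<notin> K \<Longrightarrow> g z = 0" and h: "loc_bdd h"
  shows "(LBINT z. h (fst z - c * snd z) * g z) = (LBINT s. h s * (LBINT t. g (s + c * t, t)))"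
proof -
  have lb1: "loc_bdd (\<lambda>z::real \<times> real. h (fst z - c * snd z) * g z)"
    by (intro loc_bdd_mult g loc_bdd_compose[OF h] continuous_intros)
  have i1: "integrable lborel (\<lambda>z. h (fst z - c * snd z) * g z)"
    by (rule integrable_loc_bdd[OF lb1 g(2)]) (simp add: g(3))
  have "continuous_on UNIV (\<lambda>z::real \<times> real. (fst z + c * snd z, snd z))" by (intro continuous_intros)
  note lbg = loc_bdd_compose[OF g(1) this]
  have lb2: "loc_bdd (\<lambda>z::real \<times> real. h (fst z) * g (fst z + c * snd z, snd z))"
    by (intro loc_bdd_mult lbg loc_bdd_compose[OF h] continuous_intros)
  have i2: "integrable lborel (\<lambda>z. h (fst z) * g (fst z + c * snd z, snd z))"
  proof (rule integrable_loc_bdd[OF lb2, of "(\<lambda>z. (fst z - c * snd z, snd z)) ` K"])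
    show "compact ((\<lambda>z. (fst z - c * snd z, snd z)) ` K)"
      by (intro compact_continuous_image g continuous_intros)
    fix z assume z: "z \<notin> (\<lambda>z. (fst z - c * snd z, snd z)) ` K"
    have "(fst z + c * snd z, snd z) \<notin> K"
    proof
      assume "(fst z + c * snd z, snd z) \<in> K"
      then have "(\<lambda>z. (fst z - c * snd z, snd z)) (fst z + c * snd z, snd z) \<in> (\<lambda>z. (fst z - c * snd z, snd z)) ` K"
        by (rule imageI)
      with z show False by simp
    qed
    then show "h (fst z) * g (fst z + c * snd z, snd z) = 0" by (simp add: g(3))
  qed
  have "(LBINT z. h (fst z - c * snd z) * g z) = (LBINT t. (LBINT x. h (x - c * t) * g (x, t)))"
    by (subst lborel_integral_pair_snd[OF i1]) simp
  also have "\<dots> = (LBINT t. (LBINT s. h s * g (s + c * t, t)))"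
  proof (rule Bochner_Integration.integral_cong[OF refl])
    fix t
    show "(LBINT x. h (x - c * t) * g (x, t)) = (LBINT s. h s * g (s + c * t, t))"
      using lborel_integral_real_affine[of 1 "\<lambda>x. h (x - c * t) * g (x, t)" "c * t"] by (simp add: add.commute)
  qed
  also have "\<dots> = (LBINT z. h (fst z) * g (fst z + c * snd z, snd z))"
    by (subst lborel_integral_pair_snd[OF i2]) simp
  also have "\<dots> = (LBINT s. (LBINT t. h s * g (s + c * t, t)))"
    by (subst lborel_integral_pair_fst[OF i2]) simp
  finally show ?thesis by simp
qed

lemma travelling_wave_annihilates:
  fixes \<phi> :: "real \<times> real \<Rightarrow> real" and h :: "real \<Rightarrow> real"
  assumes \<phi>: "test_fun {(x, t). x \<noteq> 0 \<and> t > 0} \<phi>" and h: "loc_bdd h"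
    and A: "open A" "closure A \<subseteq> insert 0 A"
  shows "(LBINT z. h (fst z - c * snd z) * (indicator A (fst z) * dir_deriv (c, 1) \<phi> z)) = 0"
proof -
  obtain K where K: "compact K" "K \<subseteq> {(x, t). x \<noteq> 0 \<and> t > 0}" "\<And>z. z \<notin> K \<Longrightarrow> \<phi> z = 0"
      "\<And>v z. z \<notin> K \<Longrightarrow> dir_deriv v \<phi> z = 0"
    using test_funE[OF \<phi>] by metis
  define C where "C = K \<inter> fst -` A"
  have "C = K \<inter> fst -` closure A" using K(2) A(2) closure_subset[of A] by (auto simp: C_def)
  moreover have "closed ((fst :: real \<times> real \<Rightarrow> real) -` closure A)"
    by (intro closed_vimage closed_closure continuous_intros)
  ultimately have C: "compact C" using compact_Int_closed[OF K(1)] by simp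
  define g where "g z = indicator A (fst z) * dir_deriv (c, 1) \<phi> z" for z
  have gC: "g z = 0" if "z \<notin> C" for z
    using that K(4)[of z] by (cases "z \<in> K") (auto simp: g_def C_def indicator_def)
  have "continuous_on UNIV (fst :: real \<times> real \<Rightarrow> real)" by (intro continuous_intros)
  note loc_bdd_compose[OF loc_bdd_indicator[of A] this]
  with A(1) have lbg: "loc_bdd g"
    unfolding g_def by (intro loc_bdd_mult loc_bdd_dir_deriv[OF \<phi>]) auto
  define \<psi> where "\<psi> z = indicator A (fst z) * \<phi> z" for z
  have \<psi>C: "\<psi> z = 0" if "z \<notin> C" for z
    using that K(3)[of z] by (cases "z \<in> K") (auto simp: \<psi>_def C_def indicator_def)
  have int0: "(LBINT t. g (s + c * t, t)) = 0" for s
  proof -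
    have line: "continuous_on UNIV (\<lambda>t. (s + c * t, t))" by (intro continuous_intros)
    have D: "((\<lambda>t. \<psi> (s + c * t, t)) has_real_derivative g (s + c * t, t)) (at t)" for t
    proof (cases "s + c * t \<in> A")
      case True
      have "((\<lambda>t. \<phi> (s + c * t, t)) has_real_derivative g (s + c * t, t)) (at t)"
        using smooth_fun_has_real_derivative_along[OF test_fun_smooth[OF \<phi>] has_vector_derivative_Pair_lines(3), of s c t] True
        by (simp add: g_def)
      moreover have "open ((\<lambda>t. s + c * t) -` A)"
        by (rule continuous_open_vimage[OF A(1)]) (auto intro: continuous_intros)
      ultimately show ?thesis
        by (rule has_field_derivative_transform_within_open) (use True in \<open>auto simp: \<psi>_def\<close>)
    next
      case False
      have "((\<lambda>t. 0) has_real_derivative g (s + c * t, t)) (at t)"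
        using False by (simp add: g_def)
      moreover have "open ((\<lambda>t. (s + c * t, t)) -` (- C))"
        by (intro open_vimage open_Compl compact_imp_closed C line)
      ultimately show ?thesis
        by (rule has_field_derivative_transform_within_open)
          (use False in \<open>auto simp: \<psi>C C_def\<close>)
    qed
    show ?thesis
    proof (rule lborel_integral_deriv_eq_0[where S="{}" and K="snd ` C"])
      show "continuous_on UNIV (\<lambda>t. \<psi> (s + c * t, t))"
        using D by (meson DERIV_isCont continuous_at_imp_continuous_on)
      show "loc_bdd (\<lambda>t. g (s + c * t, t))" by (rule loc_bdd_compose[OF lbg line])
      show "compact (snd ` C)" by (intro compact_continuous_image C continuous_intros)
      show "\<psi> (s + c * t, t) = 0" "g (s + c * t, t) = 0" if "t \<notin> snd ` C" for t
        using that \<psi>C[of "(s + c * t, t)"] gC[of "(s + c * t, t)"] by force+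
    qed (use D in auto)
  qed
  have "(LBINT z. h (fst z - c * snd z) * g z) = 0"
    by (subst lborel_integral_along_characteristics[where K=C]) (simp_all add: lbg C gC h int0)
  then show ?thesis by (simp add: g_def)
qed

subsection \<open>Periodic ordinary differential equations\<close>

lemma differential_inequality:
  fixes E E' :: "real \<Rightarrow> real"
  assumes "a \<le> b" and E: "\<And>t. t \<in> {a..b} \<Longrightarrow> (E has_real_derivative E' t) (at t within {a..b})"
    and le: "\<And>t. t \<in> {a..b} \<Longrightarrow> E' t \<le> c * E t"
  shows "E b \<le> E a * exp (c * (b - a))"
proof -
  have "exp (- c * b) * E b \<le> exp (- c * a) * E a"
  proof (rule DERIV_nonpos_imp_decreasing_open[OF assms(1)])
    show "continuous_on {a..b} (\<lambda>t. exp (- c * t) * E t)"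
      using E by (intro continuous_intros) (meson DERIV_continuous continuous_on_eq_continuous_within)
    fix t assume t: "a < t" "t < b"
    then have "(E has_real_derivative E' t) (at t)" using E[of t] by (simp add: at_within_Icc_at)
    then have "((\<lambda>t. exp (- c * t) * E t) has_real_derivative exp (- c * t) * (E' t - c * E t)) (at t)"
      by (auto intro!: derivative_eq_intros simp: algebra_simps)
    moreover have "exp (- c * t) * (E' t - c * E t) \<le> 0"
      using le[of t] t by (intro mult_nonneg_nonpos) auto
    ultimately show "\<exists>y. ((\<lambda>t. exp (- c * t) * E t) has_real_derivative y) (at t) \<and> y \<le> 0" by blast
  qed
  then have "exp (c * b) * (exp (- c * b) * E b) \<le> exp (c * b) * (exp (- c * a) * E a)"
    by (intro mult_left_mono) auto
  moreover have "exp (c * b) * (exp (- c * b) * E b) = E b"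
    by (simp add: exp_minus)
  moreover have "exp (c * b) * (exp (- c * a) * E a) = E a * exp (c * (b - a))"
    by (simp add: exp_minus exp_diff right_diff_distrib field_simps)
  ultimately show ?thesis by (simp only:)
qed

definition lipschitz_on_bounded :: "(real \<Rightarrow> 'a::real_normed_vector \<Rightarrow> 'a) \<Rightarrow> bool" where
  "lipschitz_on_bounded X \<longleftrightarrow>
     (\<forall>B. bounded B \<longrightarrow> (\<exists>L\<ge>0. \<forall>t\<ge>0. \<forall>z\<in>B. \<forall>w\<in>B. norm (X t z - X t w) \<le> L * norm (z - w)))"

lemma lipschitz_on_boundedE:
  assumes "lipschitz_on_bounded X" "bounded B"
  obtains L where "L \<ge> 0" "\<And>t z w. t \<ge> 0 \<Longrightarrow> z \<in> B \<Longrightarrow> w \<in> B \<Longrightarrow> norm (X t z - X t w) \<le> L * norm (z - w)"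
  using assms unfolding lipschitz_on_bounded_def by metis

lemma ode_solution_on_subset: "ode_solution_on I X Y \<Longrightarrow> J \<subseteq> I \<Longrightarrow> ode_solution_on J X Y"
  unfolding ode_solution_on_def by (meson has_vector_derivative_within_subset subsetD)

lemma ode_solution_on_continuous: "ode_solution_on I X Y \<Longrightarrow> continuous_on I Y"
  unfolding ode_solution_on_def continuous_on_eq_continuous_within
  by (auto intro: has_vector_derivative_continuous)

lemma ode_gronwall:
  fixes X :: "real \<Rightarrow> 'a::real_inner \<Rightarrow> 'a"
  assumes Y: "ode_solution_on {0..T} X Y" and Z: "ode_solution_on {0..T} X Z" and "0 \<le> T"
    and L: "\<And>t. t \<in> {0..T} \<Longrightarrow> norm (X t (Y t) - X t (Z t)) \<le> L * norm (Y t - Z t)"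
  shows "norm (Y T - Z T) \<le> norm (Y 0 - Z 0) * exp (L * T)"
proof -
  let ?E = "\<lambda>t. (Y t - Z t) \<bullet> (Y t - Z t)"
  have "?E T \<le> ?E 0 * exp ((2 * L) * (T - 0))"
  proof (rule differential_inequality[OF \<open>0 \<le> T\<close>])
    fix t assume t: "t \<in> {0..T}"
    let ?D = "X t (Y t) - X t (Z t)"
    have "((\<lambda>t. Y t - Z t) has_vector_derivative ?D) (at t within {0..T})"
      using Y Z t unfolding ode_solution_on_def by (intro has_vector_derivative_diff) auto
    then have "((\<lambda>t. Y t - Z t) has_derivative (\<lambda>h. h *\<^sub>R ?D)) (at t within {0..T})"
      by (simp add: has_vector_derivative_def)
    from has_derivative_inner[OF this this]
    show "(?E has_real_derivative 2 * ((Y t - Z t) \<bullet> ?D)) (at t within {0..T})"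
      unfolding has_field_derivative_def
      by (rule has_derivative_eq_rhs) (auto simp: inner_commute algebra_simps)
    have "(Y t - Z t) \<bullet> ?D \<le> norm (Y t - Z t) * norm ?D" by (rule norm_cauchy_schwarz)
    also have "\<dots> \<le> norm (Y t - Z t) * (L * norm (Y t - Z t))" by (intro mult_left_mono L t) simp
    also have "\<dots> = L * ?E t" by (simp add: power2_norm_eq_inner[symmetric] power2_eq_square)
    finally show "2 * ((Y t - Z t) \<bullet> ?D) \<le> 2 * L * ?E t" by simp
  qed
  then have "(norm (Y T - Z T))\<^sup>2 \<le> (norm (Y 0 - Z 0) * exp (L * T))\<^sup>2"
    by (simp add: power2_norm_eq_inner[symmetric] power_mult_distrib exp_double[symmetric] mult_ac)
  then show ?thesis by (rule power2_le_imp_le) simp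
qed

lemma ode_lipschitz_gronwall:
  fixes X :: "real \<Rightarrow> 'a::real_inner \<Rightarrow> 'a"
  assumes X: "lipschitz_on_bounded X" and B: "bounded B"
  obtains L where "\<And>T Y Z. 0 \<le> T \<Longrightarrow> ode_solution_on {0..T} X Y \<Longrightarrow> ode_solution_on {0..T} X Z \<Longrightarrow>
    Y ` {0..T} \<subseteq> B \<Longrightarrow> Z ` {0..T} \<subseteq> B \<Longrightarrow> norm (Y T - Z T) \<le> norm (Y 0 - Z 0) * exp (L * T)" "L \<ge> 0"
proof -
  obtain L where L: "L \<ge> 0" "\<And>t z w. t \<ge> 0 \<Longrightarrow> z \<in> B \<Longrightarrow> w \<in> B \<Longrightarrow> norm (X t z - X t w) \<le> L * norm (z - w)"
    using lipschitz_on_boundedE[OF X B] by metis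
  show thesis
    by (rule that[OF ode_gronwall L(1)]) (use L(2) in \<open>auto simp: image_subset_iff\<close>)
qed

lemma ode_unique:
  fixes X :: "real \<Rightarrow> 'a::real_inner \<Rightarrow> 'a"
  assumes X: "lipschitz_on_bounded X" and Y: "ode_solution_on {0..T} X Y" and Z: "ode_solution_on {0..T} X Z"
    and "0 \<le> T" "Y 0 = Z 0"
  shows "Y T = Z T"
proof -
  have "bounded (Y ` {0..T} \<union> Z ` {0..T})"
    by (intro bounded_Un[THEN iffD2] conjI compact_imp_bounded compact_continuous_image compact_Icc
        ode_solution_on_continuous[OF Y] ode_solution_on_continuous[OF Z])
  then obtain L where "norm (Y T - Z T) \<le> norm (Y 0 - Z 0) * exp (L * T)"
    using ode_lipschitz_gronwall[OF X] Y Z \<open>0 \<le> T\<close> by (metis Un_upper1 Un_upper2)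
  then show ?thesis using \<open>Y 0 = Z 0\<close> by simp
qed

lemma poincare_map_eq:
  fixes X :: "real \<Rightarrow> 'a::real_inner \<Rightarrow> 'a"
  assumes "lipschitz_on_bounded X" "0 \<le> T" "ode_solution_on {0..T} X Y"
  shows "poincare_map X T (Y 0) = Y T"
  unfolding poincare_map_def
proof (rule the_equality)
  fix w assume "\<exists>Z. ode_solution_on {0..T} X Z \<and> Z 0 = Y 0 \<and> Z T = w"
  then obtain Z where Z: "ode_solution_on {0..T} X Z" "Z 0 = Y 0" "Z T = w" by blast
  then show "w = Y T" using ode_unique[OF assms(1) Z(1) assms(3,2) Z(2)] by simp
qed (use assms in blast)

lemma periodic_add_mult:
  assumes "\<And>t. t \<ge> 0 \<Longrightarrow> f (t + \<tau>) = f t" "\<tau> \<ge> 0" "t \<ge> (0::real)"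
  shows "f (t + real n * \<tau>) = f t"
proof (induction n)
  case (Suc n)
  have "t + real (Suc n) * \<tau> = (t + real n * \<tau>) + \<tau>" by (simp add: algebra_simps)
  moreover have "f ((t + real n * \<tau>) + \<tau>) = f (t + real n * \<tau>)" using assms(2,3) by (intro assms(1)) simp
  ultimately show ?case using Suc by (simp only:)
qed simp

lemma ode_solution_on_translate:
  fixes X :: "real \<Rightarrow> 'a::real_normed_vector \<Rightarrow> 'a"
  assumes Y: "ode_solution_on {0..} X Y" and "s \<ge> 0"
  shows "ode_solution_on {0..} (\<lambda>t. X (t + s)) (\<lambda>t. Y (t + s))"
  unfolding ode_solution_on_def
proof
  fix t :: real assume t: "t \<in> {0..}"
  have "(Y has_vector_derivative X (t + s) (Y (t + s))) (at (t + s) within {0..})"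
    using Y t \<open>s \<ge> 0\<close> unfolding ode_solution_on_def by auto
  then have 1: "(Y has_vector_derivative X (t + s) (Y (t + s))) (at (t + s) within (\<lambda>t. t + s) ` {0..})"
    using t \<open>s \<ge> 0\<close> by (auto intro: has_vector_derivative_within_subset)
  have 2: "((\<lambda>t. t + s) has_vector_derivative 1) (at t within {0..})"
    by (auto intro!: derivative_eq_intros)
  from vector_diff_chain_within[OF 2 1]
  show "((\<lambda>t. Y (t + s)) has_vector_derivative X (t + s) (Y (t + s))) (at t within {0..})"
    by (simp add: o_def)
qed

locale periodic_ode =
  fixes X :: "real \<Rightarrow> 'a::euclidean_space \<Rightarrow> 'a" and \<tau> :: real
  assumes X_lip: "lipschitz_on_bounded X" and \<tau>_pos: "\<tau> > 0"
    and X_periodic: "\<And>t. t \<ge> 0 \<Longrightarrow> X (t + \<tau>) = X t"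
begin

lemma shift: "ode_solution_on {0..} X Y \<Longrightarrow> ode_solution_on {0..} X (\<lambda>t. Y (t + real n * \<tau>))"
  using ode_solution_on_translate[of X Y "real n * \<tau>"] periodic_add_mult[of X \<tau>, OF X_periodic] \<tau>_pos
  by (simp add: ode_solution_on_def)

lemma poincare_iterate:
  assumes Y: "ode_solution_on {0..} X Y"
  shows "(poincare_map X \<tau> ^^ n) (Y 0) = Y (real n * \<tau>)"
proof (induction n)
  case (Suc n)
  have "ode_solution_on {0..\<tau>} X (\<lambda>t. Y (t + real n * \<tau>))"
    by (rule ode_solution_on_subset[OF shift[OF Y]]) auto
  from poincare_map_eq[OF X_lip _ this] \<tau>_pos Suc show ?case by (simp add: algebra_simps)
qed simp

lemma converges_to_periodic:
  assumes Y: "ode_solution_on {0..} X Y" and bd: "bounded (Y ` {0..})"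
    and conv: "convergent (\<lambda>n. Y (real n * \<tau>))"
  obtains Z where "ode_solution_on {0..} X Z" "\<And>t. t \<ge> 0 \<Longrightarrow> Z (t + \<tau>) = Z t"
    "(\<lambda>n. Y (real n * \<tau>)) \<longlonglongrightarrow> Z 0" "bounded (Z ` {0..})" "((\<lambda>t. Y t - Z t) \<longlongrightarrow> 0) at_top"
proof -
  let ?f = "\<lambda>n t. Y (t + real n * \<tau>)"
  define B where "B = closure (Y ` {0..})"
  have B: "bounded B" "closed B" using bounded_closure[OF bd] by (simp_all add: B_def)
  have fB: "?f n t \<in> B" if "t \<ge> 0" for n t
    unfolding B_def using that \<tau>_pos by (intro closure_subset[THEN subsetD] imageI) simp
  obtain L where L: "L \<ge> 0" "\<And>T Y Z. 0 \<le> T \<Longrightarrow> ode_solution_on {0..T} X Y \<Longrightarrow> ode_solution_on {0..T} X Z \<Longrightarrow>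
    Y ` {0..T} \<subseteq> B \<Longrightarrow> Z ` {0..T} \<subseteq> B \<Longrightarrow> norm (Y T - Z T) \<le> norm (Y 0 - Z 0) * exp (L * T)"
    using ode_lipschitz_gronwall[OF X_lip B(1)] by metis
  have near: "norm (?f n s - ?f m s) \<le> norm (?f n 0 - ?f m 0) * exp (L * \<tau>)" if "0 \<le> s" "s \<le> \<tau>" for n m s
  proof -
    have "ode_solution_on {0..s} X (?f k)" for k by (rule ode_solution_on_subset[OF shift[OF Y]]) auto
    then have "norm (?f n s - ?f m s) \<le> norm (?f n 0 - ?f m 0) * exp (L * s)"
      by (intro L(2) that) (use fB in auto)
    also have "\<dots> \<le> norm (?f n 0 - ?f m 0) * exp (L * \<tau>)"
      using that L(1) by (intro mult_left_mono) (auto intro: mult_left_mono)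
    finally show ?thesis .
  qed
  have "uniformly_Cauchy_on {0..} ?f"
  proof (rule uniformly_Cauchy_onI)
    fix e :: real assume "e > 0"
    then have "e / exp (L * \<tau>) > 0" by simp
    moreover have "Cauchy (\<lambda>n. Y (real n * \<tau>))" by (rule convergent_Cauchy[OF conv])
    ultimately obtain M where M: "\<And>m n. m \<ge> M \<Longrightarrow> n \<ge> M \<Longrightarrow>
        norm (Y (real m * \<tau>) - Y (real n * \<tau>)) < e / exp (L * \<tau>)"
      unfolding Cauchy_iff by metis
    have "dist (?f m t) (?f n t) < e" if "t \<in> {0..}" "m \<ge> M" "n \<ge> M" for t m n
    proof -
      define j where "j = nat \<lfloor>t / \<tau>\<rfloor>"
      define s where "s = t - real j * \<tau>"
      have j: "real j = of_int \<lfloor>t / \<tau>\<rfloor>" using that \<tau>_pos by (simp add: j_def)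
      have "real j \<le> t / \<tau>" "t / \<tau> < real j + 1" unfolding j by linarith+
      then have s: "0 \<le> s" "s \<le> \<tau>" using \<tau>_pos by (auto simp: s_def field_simps)
      have f: "?f k t = ?f (k + j) s" for k by (simp add: s_def algebra_simps)
      have "norm (?f m t - ?f n t) \<le> norm (?f (m + j) 0 - ?f (n + j) 0) * exp (L * \<tau>)"
        unfolding f by (rule near[OF s])
      also have "\<dots> < e / exp (L * \<tau>) * exp (L * \<tau>)"
        using M[of "m + j" "n + j"] that by (intro mult_strict_right_mono) auto
      finally show ?thesis by (simp add: dist_norm)
    qed
    then show "\<exists>M. \<forall>x\<in>{0..}. \<forall>m\<ge>M. \<forall>n\<ge>M. dist (?f m x) (?f n x) < e" by blast
  qed
  then have "uniformly_convergent_on {0..} ?f" by (rule Cauchy_uniformly_convergent)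
  then obtain Z where Z: "uniform_limit {0..} ?f Z sequentially" unfolding uniformly_convergent_on_def by blast
  have lim: "(\<lambda>n. ?f n t) \<longlonglongrightarrow> Z t" if "t \<ge> 0" for t
    using tendsto_uniform_limitI[OF Z, of t] that by simp
  have ZB: "Z t \<in> B" if "t \<ge> 0" for t
    using Lim_in_closed_set[OF B(2) _ _ lim[OF that]] fB[OF that] by simp
  obtain L' where L': "L' \<ge> 0" "\<And>t z w. t \<ge> 0 \<Longrightarrow> z \<in> B \<Longrightarrow> w \<in> B \<Longrightarrow> norm (X t z - X t w) \<le> L' * norm (z - w)"
    using lipschitz_on_boundedE[OF X_lip B(1)] by metis
  have "\<exists>g. \<forall>t\<in>{0..}. (\<lambda>n. ?f n t) \<longlonglongrightarrow> g t \<and> (g has_derivative (\<lambda>h. h *\<^sub>R X t (Z t))) (at t within {0..})"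
  proof (rule has_derivative_sequence)
    show "convex {0::real..}" by simp
    show "0 \<in> {0::real..}" by simp
    show "(?f n has_derivative (\<lambda>h. h *\<^sub>R X t (?f n t))) (at t within {0..})" if "t \<in> {0..}" for n t
      using shift[OF Y, of n] that unfolding ode_solution_on_def has_vector_derivative_def by blast
    show "(\<lambda>n. ?f n 0) \<longlonglongrightarrow> Z 0" by (rule lim) simp
    fix e :: real assume "e > 0"
    then have "e / (L' + 1) > 0" using L'(1) by simp
    from uniform_limitD[OF Z this]
    show "\<forall>\<^sub>F n in sequentially. \<forall>t\<in>{0..}. \<forall>h. norm (h *\<^sub>R X t (?f n t) - h *\<^sub>R X t (Z t)) \<le> e * norm h"
    proof (rule eventually_mono, intro ballI allI)
      fix n t and h :: real assume n: "\<forall>x\<in>{0..}. dist (?f n x) (Z x) < e / (L' + 1)" and t: "t \<in> {0::real..}"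
      have "norm (X t (?f n t) - X t (Z t)) \<le> L' * norm (?f n t - Z t)"
        using t by (intro L'(2) fB ZB) auto
      also have "\<dots> \<le> (L' + 1) * (e / (L' + 1))"
        using n t L'(1) by (intro mult_mono) (auto simp: dist_norm less_imp_le)
      also have "\<dots> = e" using L'(1) by simp
      finally have "norm h * norm (X t (?f n t) - X t (Z t)) \<le> norm h * e" by (rule mult_left_mono) simp
      then show "norm (h *\<^sub>R X t (?f n t) - h *\<^sub>R X t (Z t)) \<le> e * norm h"
        by (simp add: scaleR_diff_right[symmetric] mult.commute)
    qed
  qed
  then obtain g where g: "\<And>t. t \<ge> 0 \<Longrightarrow> (\<lambda>n. ?f n t) \<longlonglongrightarrow> g t"
    "\<And>t. t \<ge> 0 \<Longrightarrow> (g has_derivative (\<lambda>h. h *\<^sub>R X t (Z t))) (at t within {0..})" by auto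
  have gZ: "g t = Z t" if "t \<ge> 0" for t using LIMSEQ_unique[OF g(1) lim] that by blast
  show thesis
  proof (rule that)
    show "ode_solution_on {0..} X Z"
      unfolding ode_solution_on_def has_vector_derivative_def
      using g(2) gZ by (auto intro: has_derivative_transform[where f=g])
    show "Z (t + \<tau>) = Z t" if "t \<ge> 0" for t
    proof -
      have "?f n (t + \<tau>) = ?f (Suc n) t" for n by (simp add: algebra_simps)
      then have "(\<lambda>n. ?f (Suc n) t) \<longlonglongrightarrow> Z (t + \<tau>)" using lim[of "t + \<tau>"] that \<tau>_pos by simp
      moreover have "(\<lambda>n. ?f (Suc n) t) \<longlonglongrightarrow> Z t" by (rule LIMSEQ_Suc[OF lim[OF that]])
      ultimately show ?thesis by (rule LIMSEQ_unique)
    qed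
    show "(\<lambda>n. Y (real n * \<tau>)) \<longlonglongrightarrow> Z 0" using lim[of 0] by simp
    show "bounded (Z ` {0..})" by (rule bounded_subset[OF B(1)]) (use ZB in auto)
    show "((\<lambda>t. Y t - Z t) \<longlongrightarrow> 0) at_top"
    proof (rule tendstoI)
      fix e :: real assume "e > 0"
      from uniform_limitD[OF Z this] obtain n where n: "\<forall>t\<in>{0..}. dist (?f n t) (Z t) < e"
        using eventually_happens'[OF sequentially_bot] by blast
      have Zn: "Z (t + real n * \<tau>) = Z t" if "t \<ge> 0" for t
        by (rule periodic_add_mult[of Z]) (use \<open>\<And>t. t \<ge> 0 \<Longrightarrow> Z (t + \<tau>) = Z t\<close> \<tau>_pos that in auto)
      show "\<forall>\<^sub>F t in at_top. dist (Y t - Z t) 0 < e"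
      proof (rule eventually_at_top_linorderI)
        fix t assume t: "real n * \<tau> \<le> t"
        then show "dist (Y t - Z t) 0 < e"
          using n[rule_format, of "t - real n * \<tau>"] Zn[of "t - real n * \<tau>"] by (simp add: dist_norm)
      qed
    qed
  qed
qed

lemma exponentially_close_shifts:
  assumes Y: "ode_solution_on {0..} X Y" and "t0 \<ge> 0" "\<eta> > 0"
    and close: "\<And>t. t \<ge> t0 \<Longrightarrow> norm (Y (t + \<tau>) - Y t) \<le> C * exp (- \<eta> * t)"
  shows "bounded (Y ` {0..})" "convergent (\<lambda>n. Y (real n * \<tau>))"
proof -
  define r where "r = exp (- \<eta> * \<tau>)"
  have r: "0 < r" "r < 1" using \<open>\<eta> > 0\<close> \<tau>_pos by (auto simp: r_def)
  have "0 \<le> C * exp (- \<eta> * t0)" using close[of t0] norm_ge_zero order.trans by blast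
  then have C: "C \<ge> 0" by (simp add: zero_le_mult_iff)
  have step: "norm (Y (s + real (Suc i) * \<tau>) - Y (s + real i * \<tau>)) \<le> C * r ^ i" if "s \<ge> 0" "s + real i * \<tau> \<ge> t0" for s i
  proof -
    have "exp (- \<eta> * (s + real i * \<tau>)) \<le> exp (real i * (- \<eta> * \<tau>))"
      using that(1) \<open>\<eta> > 0\<close> by (simp add: algebra_simps)
    also have "\<dots> = r ^ i" by (simp only: exp_of_nat_mult r_def)
    finally have e: "exp (- \<eta> * (s + real i * \<tau>)) \<le> r ^ i" .
    have "s + real (Suc i) * \<tau> = (s + real i * \<tau>) + \<tau>" by (simp add: algebra_simps)
    then have "norm (Y (s + real (Suc i) * \<tau>) - Y (s + real i * \<tau>)) \<le> C * exp (- \<eta> * (s + real i * \<tau>))"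
      using close[OF that(2)] by (simp only:)
    also have "\<dots> \<le> C * r ^ i" by (rule mult_left_mono[OF e C])
    finally show ?thesis .
  qed
  have geo: "(\<Sum>i<n. r ^ i) \<le> 1 / (1 - r)" for n
    using sum_le_suminf[of "\<lambda>i. r ^ i" "{..<n}"] r by (simp add: summable_geometric suminf_geometric)
  have far: "norm (Y (s + real n * \<tau>) - Y s) \<le> C * (\<Sum>i<n. r ^ i)" if "s \<ge> t0" for s n
  proof (induction n)
    case (Suc n)
    have "norm (Y (s + real (Suc n) * \<tau>) - Y s) \<le>
        norm (Y (s + real (Suc n) * \<tau>) - Y (s + real n * \<tau>)) + norm (Y (s + real n * \<tau>) - Y s)"
      using norm_triangle_ineq[of "Y (s + real (Suc n) * \<tau>) - Y (s + real n * \<tau>)" "Y (s + real n * \<tau>) - Y s"] by simp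
    also have "\<dots> \<le> C * r ^ n + C * (\<Sum>i<n. r ^ i)"
      using that \<open>t0 \<ge> 0\<close> \<tau>_pos by (intro add_mono Suc step) (auto intro: add_increasing2)
    finally show ?case by (simp add: algebra_simps)
  qed simp
  have "compact (Y ` {0..t0 + \<tau>})"
    by (intro compact_continuous_image continuous_on_subset[OF ode_solution_on_continuous[OF Y]]) auto
  then have "bounded (Y ` {0..t0 + \<tau>})" by (rule compact_imp_bounded)
  then obtain b where "\<forall>x\<in>Y ` {0..t0 + \<tau>}. norm x \<le> b" unfolding bounded_iff by blast
  then have b: "norm (Y s) \<le> b" if "0 \<le> s" "s \<le> t0 + \<tau>" for s using that by simp
  have "norm (Y t) \<le> b + C * (1 / (1 - r))" if "t \<ge> 0" for t
  proof (cases "t \<le> t0 + \<tau>")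
    case True
    then show ?thesis using b[OF that True] C r by (auto intro: add_increasing2)
  next
    case False
    define n where "n = nat \<lfloor>(t - t0) / \<tau>\<rfloor>"
    have n: "real n = of_int \<lfloor>(t - t0) / \<tau>\<rfloor>" using False \<tau>_pos by (simp add: n_def)
    have "real n \<le> (t - t0) / \<tau>" "(t - t0) / \<tau> < real n + 1" unfolding n by linarith+
    then have s: "t0 \<le> t - real n * \<tau>" "t - real n * \<tau> \<le> t0 + \<tau>" using \<tau>_pos by (auto simp: field_simps)
    have "norm (Y t) \<le> norm (Y (t - real n * \<tau>)) + norm (Y t - Y (t - real n * \<tau>))"
      using norm_triangle_ineq[of "Y (t - real n * \<tau>)" "Y t - Y (t - real n * \<tau>)"] by simp
    also have "norm (Y t - Y (t - real n * \<tau>)) \<le> C * (\<Sum>i<n. r ^ i)"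
      using far[OF s(1), of n] by simp
    also have "\<dots> \<le> C * (1 / (1 - r))" using geo C by (rule mult_left_mono)
    also have "norm (Y (t - real n * \<tau>)) \<le> b" using s \<open>t0 \<ge> 0\<close> by (intro b) auto
    finally show ?thesis by simp
  qed
  then show "bounded (Y ` {0..})" unfolding bounded_iff by (intro exI[of _ "b + C * (1 / (1 - r))"]) auto
  have "summable (\<lambda>i. Y (real (Suc i) * \<tau>) - Y (real i * \<tau>))"
  proof (rule summable_comparison_test')
    show "summable (\<lambda>i. C * r ^ i)" using r by (intro summable_mult summable_geometric) simp
    fix i assume i: "i \<ge> nat \<lceil>t0 / \<tau>\<rceil>"
    then have "t0 / \<tau> \<le> real i" using real_nat_ceiling_ge[of "t0 / \<tau>"] by linarith
    then have "t0 \<le> real i * \<tau>" using \<tau>_pos by (simp add: field_simps)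
    then show "norm (Y (real (Suc i) * \<tau>) - Y (real i * \<tau>)) \<le> C * r ^ i" using step[of 0 i] by simp
  qed
  then have "convergent (\<lambda>n. \<Sum>i<n. Y (real (Suc i) * \<tau>) - Y (real i * \<tau>))" by (simp only: summable_iff_convergent)
  then have "convergent (\<lambda>n. Y (real n * \<tau>) - Y 0)"
    unfolding sum_lessThan_telescope[of "\<lambda>i. Y (real i * \<tau>)"] by simp
  then obtain l where "(\<lambda>n. Y (real n * \<tau>) - Y 0) \<longlonglongrightarrow> l" by (auto simp: convergent_def)
  from tendsto_add[OF this tendsto_const[of "Y 0"]] show "convergent (\<lambda>n. Y (real n * \<tau>))"
    by (auto simp: convergent_def)
qed

end

subsection \<open>Continuously differentiable functions of one variable\<close>

lemma C1_differentiable_on_UNIV_real: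
  fixes f :: "real \<Rightarrow> real"
  assumes "f C1_differentiable_on UNIV"
  shows "(f has_real_derivative deriv f x) (at x)" "continuous_on UNIV (deriv f)" "continuous_on A f"
proof -
  obtain D where D: "\<And>x. (f has_vector_derivative D x) (at x)" "continuous_on UNIV D"
    using assms unfolding C1_differentiable_on_def by auto
  then have D': "(f has_real_derivative D x) (at x)" for x
    by (simp add: has_real_derivative_iff_has_vector_derivative)
  then have "deriv f = D" by (intro ext DERIV_imp_deriv)
  then show d: "(f has_real_derivative deriv f x) (at x)" "continuous_on UNIV (deriv f)" using D' D(2) by auto
  show "continuous_on A f" using D' by (meson DERIV_isCont continuous_at_imp_continuous_on)
qed

lemma C1_lipschitz_on_interval:
  fixes f :: "real \<Rightarrow> real"
  assumes f: "f C1_differentiable_on UNIV"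
  obtains L where "L \<ge> 0" "\<And>x y. \<bar>x\<bar> \<le> R \<Longrightarrow> \<bar>y\<bar> \<le> R \<Longrightarrow> \<bar>f x - f y\<bar> \<le> L * \<bar>x - y\<bar>"
proof -
  have "compact (deriv f ` {-R..R})"
    by (intro compact_continuous_image continuous_on_subset[OF C1_differentiable_on_UNIV_real(2)[OF f]]) auto
  then have "bounded (deriv f ` {-R..R})" by (rule compact_imp_bounded)
  then obtain L where "\<forall>x\<in>deriv f ` {-R..R}. norm x \<le> L" unfolding bounded_iff by blast
  then have L: "\<bar>deriv f x\<bar> \<le> max L 0" if "x \<in> {-R..R}" for x using that by (auto simp: le_max_iff_disj)
  show thesis
  proof (rule that)
    fix x y assume xy: "\<bar>x\<bar> \<le> R" "\<bar>y\<bar> \<le> R"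
    have "norm (f x - f y) \<le> max L 0 * norm (x - y)"
      by (rule field_differentiable_bound[of "{-R..R}" f "deriv f"])
        (use xy L C1_differentiable_on_UNIV_real(1)[OF f] in \<open>auto intro: has_field_derivative_at_within\<close>)
    then show "\<bar>f x - f y\<bar> \<le> max L 0 * \<bar>x - y\<bar>" by simp
  qed simp
qed

locale half_line_periodic =
  fixes p :: "real \<Rightarrow> real" and \<omega> p0 :: real
  assumes p_C1: "p C1_differentiable_on UNIV" and \<omega>_pos: "\<omega> > 0"
    and p_pos: "\<And>z. z > 0 \<Longrightarrow> p (z + \<omega>) = p z" and p_const: "\<And>z. z \<le> 0 \<Longrightarrow> p z = p0"
begin

lemmas p_deriv = C1_differentiable_on_UNIV_real(1)[OF p_C1]
  and p'_cont = C1_differentiable_on_UNIV_real(2)[OF p_C1]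
  and p_cont = C1_differentiable_on_UNIV_real(3)[OF p_C1]

lemma p_periodic: assumes "z \<ge> 0" shows "p (z + \<omega>) = p z"
proof -
  have "p (z + \<omega>) - p z = 0"
    by (rule continuous_constant_on_closure[of "{0<..}" "\<lambda>z. p (z + \<omega>) - p z"])
      (use assms p_pos in \<open>auto intro!: continuous_intros continuous_on_compose2[OF p_cont[of UNIV]] p_cont\<close>)
  then show ?thesis by simp
qed

lemma p'_periodic: assumes "z \<ge> 0" shows "deriv p (z + \<omega>) = deriv p z"
proof -
  have pos: "deriv p (z + \<omega>) = deriv p z" if "z > 0" for z
  proof -
    have "((\<lambda>z. p (z + \<omega>)) has_real_derivative deriv p (z + \<omega>) * 1) (at z)"
      by (rule DERIV_chain2[OF p_deriv]) (auto intro!: derivative_eq_intros)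
    then have "((\<lambda>z. p (z + \<omega>)) has_real_derivative deriv p (z + \<omega>)) (at z)" by simp
    then have "(p has_real_derivative deriv p (z + \<omega>)) (at z)"
      by (rule has_field_derivative_transform_within_open[of _ _ _ "{0<..}"]) (use that p_pos in auto)
    then show ?thesis by (rule DERIV_unique) (rule p_deriv)
  qed
  have "deriv p (z + \<omega>) - deriv p z = 0"
    by (rule continuous_constant_on_closure[of "{0<..}" "\<lambda>z. deriv p (z + \<omega>) - deriv p z"])
      (use assms pos in \<open>auto intro!: continuous_intros continuous_on_compose2[OF p'_cont] continuous_on_subset[OF p'_cont]\<close>)
  then show ?thesis by simp
qed

lemma p'_bounded: obtains B where "B \<ge> 0" "\<And>z. z \<ge> 0 \<Longrightarrow> \<bar>deriv p z\<bar> \<le> B"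
proof -
  have "compact (deriv p ` {0..\<omega>})" by (intro compact_continuous_image continuous_on_subset[OF p'_cont]) auto
  then have "bounded (deriv p ` {0..\<omega>})" by (rule compact_imp_bounded)
  then obtain B where "\<forall>x\<in>deriv p ` {0..\<omega>}. norm x \<le> B" unfolding bounded_iff by blast
  then have B: "\<bar>deriv p z\<bar> \<le> B" if "z \<in> {0..\<omega>}" for z using that by simp
  show thesis
  proof (rule that)
    show "B \<ge> 0" using B[of 0] \<omega>_pos by simp
    fix z :: real assume z: "z \<ge> 0"
    define n where "n = nat \<lfloor>z / \<omega>\<rfloor>"
    have n: "real n = of_int \<lfloor>z / \<omega>\<rfloor>" using z \<omega>_pos by (simp add: n_def)
    have "real n \<le> z / \<omega>" "z / \<omega> < real n + 1" unfolding n by linarith+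
    then have s: "0 \<le> z - real n * \<omega>" "z - real n * \<omega> \<le> \<omega>" using \<omega>_pos by (auto simp: field_simps)
    have "deriv p ((z - real n * \<omega>) + real n * \<omega>) = deriv p (z - real n * \<omega>)"
      by (rule periodic_add_mult[of "deriv p"]) (use p'_periodic \<omega>_pos s in auto)
    then show "\<bar>deriv p z\<bar> \<le> B" using B[of "z - real n * \<omega>"] s by simp
  qed
qed

end

subsection \<open>The massless equation\<close>

lemma massless_lipschitz:
  assumes F: "F C1_differentiable_on UNIV"
  shows "lipschitz_on_bounded (massless_field \<kappa> a F p)"
  unfolding lipschitz_on_bounded_def
proof (intro allI impI)
  fix B :: "real set" assume "bounded B"
  then obtain R where R: "\<forall>x\<in>B. norm x \<le> R" unfolding bounded_iff by blast
  obtain L where L: "L \<ge> 0" "\<And>x y. \<bar>x\<bar> \<le> R \<Longrightarrow> \<bar>y\<bar> \<le> R \<Longrightarrow> \<bar>F x - F y\<bar> \<le> L * \<bar>x - y\<bar>"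
    by (rule C1_lipschitz_on_interval[OF F, of R]) blast
  show "\<exists>L\<ge>0. \<forall>t\<ge>0. \<forall>z\<in>B. \<forall>w\<in>B. norm (massless_field \<kappa> a F p t z - massless_field \<kappa> a F p t w) \<le> L * norm (z - w)"
  proof (intro exI[of _ "\<bar>a / (2 * \<kappa>)\<bar> * L"] conjI allI impI ballI)
    fix t z w :: real assume zw: "z \<in> B" "w \<in> B"
    have "norm (massless_field \<kappa> a F p t z - massless_field \<kappa> a F p t w) = \<bar>a / (2 * \<kappa>)\<bar> * \<bar>F z - F w\<bar>"
      by (simp only: massless_field_def real_norm_def abs_mult[symmetric]) (simp add: right_diff_distrib)
    also have "\<dots> \<le> \<bar>a / (2 * \<kappa>)\<bar> * (L * \<bar>z - w\<bar>)"
      using R zw by (intro mult_left_mono L) auto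
    finally show "norm (massless_field \<kappa> a F p t z - massless_field \<kappa> a F p t w) \<le> \<bar>a / (2 * \<kappa>)\<bar> * L * norm (z - w)"
      by (simp add: mult.assoc)
  qed (use L in simp)
qed

lemma scalar_ode_comparison:
  fixes X :: "real \<Rightarrow> real \<Rightarrow> real"
  assumes X: "lipschitz_on_bounded X" and Y: "ode_solution_on {0..} X Y" and Z: "ode_solution_on {0..} X Z"
    and 0: "Y 0 \<le> Z 0" and t: "0 \<le> t"
  shows "Y t \<le> Z t"
proof (rule ccontr)
  assume "\<not> Y t \<le> Z t"
  moreover have "continuous_on {0..t} (\<lambda>s. Y s - Z s)"
    by (intro continuous_intros continuous_on_subset[OF ode_solution_on_continuous[OF Y]]
        continuous_on_subset[OF ode_solution_on_continuous[OF Z]]) auto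
  ultimately obtain s where s: "0 \<le> s" "s \<le> t" "Y s - Z s = 0"
    using IVT'[of "\<lambda>s. Y s - Z s" 0 0 t] 0 t by auto
  have "lipschitz_on_bounded (\<lambda>t. X (t + s))"
    using X s(1) unfolding lipschitz_on_bounded_def by (metis add_nonneg_nonneg)
  then have "Y ((t - s) + s) = Z ((t - s) + s)"
    by (rule ode_unique[where Y="\<lambda>t. Y (t + s)" and Z="\<lambda>t. Z (t + s)"])
      (use s in \<open>auto intro!: ode_solution_on_subset[OF ode_solution_on_translate[OF Y]]
        ode_solution_on_subset[OF ode_solution_on_translate[OF Z]]\<close>)
  with \<open>\<not> Y t \<le> Z t\<close> show False by simp
qed

lemma barrier_above:
  fixes y y' :: "real \<Rightarrow> real"
  assumes y: "\<And>t. t \<ge> 0 \<Longrightarrow> (y has_real_derivative y' t) (at t within {0..})"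
    and "y 0 \<le> U" and neg: "\<And>t. t \<ge> 0 \<Longrightarrow> y t > U \<Longrightarrow> y' t \<le> 0" and t: "t \<ge> 0"
  shows "y t \<le> U"
proof (rule ccontr)
  assume "\<not> y t \<le> U"
  have cont: "continuous_on {0..} y"
    using y by (meson DERIV_continuous atLeast_iff continuous_on_eq_continuous_within)
  define S where "S = {0..t} \<inter> y -` {..U}"
  have "closed S" unfolding S_def
    by (rule continuous_closed_preimage[OF continuous_on_subset[OF cont]]) auto
  moreover have "bounded S" unfolding S_def by (rule bounded_subset[OF bounded_closed_interval[of 0 t]]) auto
  ultimately have "compact S" by (simp add: compact_eq_bounded_closed)
  moreover have "S \<noteq> {}" using \<open>y 0 \<le> U\<close> t by (auto simp: S_def)
  ultimately obtain s where s: "s \<in> S" "\<forall>x\<in>S. x \<le> s" using compact_attains_sup by blast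
  have st: "0 \<le> s" "s \<le> t" "y s \<le> U" using s(1) by (auto simp: S_def)
  have "y t \<le> y s"
  proof (rule DERIV_nonpos_imp_decreasing_open[OF st(2)])
    show "continuous_on {s..t} y" by (rule continuous_on_subset[OF cont]) (use st in auto)
    fix x assume x: "s < x" "x < t"
    then have "x \<notin> S" using s(2) by force
    then have "y x > U" using x st by (auto simp: S_def)
    moreover have "at x within {0..} = at x"
      by (rule at_within_interior) (use x st in \<open>simp add: interior_real_atLeast\<close>)
    then have "(y has_real_derivative y' x) (at x)"
      using y[of x] x st by simp
    ultimately show "\<exists>d. (y has_real_derivative d) (at x) \<and> d \<le> 0" using neg[of x] x st by auto
  qed
  with st \<open>\<not> y t \<le> U\<close> show False by simp
qed

context half_line_periodic
begin

lemma massless_periodic_ode: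
  assumes "F C1_differentiable_on UNIV" "a > 0"
  shows "periodic_ode (massless_field \<kappa> a F p) (\<omega> / a)"
proof
  show "lipschitz_on_bounded (massless_field \<kappa> a F p)" by (rule massless_lipschitz[OF assms(1)])
  show "\<omega> / a > 0" using assms \<omega>_pos by simp
  fix t :: real assume "t \<ge> 0"
  then have "deriv p (a * t + \<omega>) = deriv p (a * t)" using assms by (intro p'_periodic) simp
  then show "massless_field \<kappa> a F p (t + \<omega> / a) = massless_field \<kappa> a F p t"
    using assms by (intro ext) (simp add: massless_field_def distrib_left)
qed

lemma massless_solution_bounded:
  assumes F: "filterlim F at_bot at_top" "filterlim F at_top at_bot" and "a > 0" "\<kappa> > 0"
    and Y: "ode_solution_on {0..} (massless_field \<kappa> a F p) Y"
  shows "bounded (Y ` {0..})"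
proof -
  obtain B where B: "B \<ge> 0" "\<And>z. z \<ge> 0 \<Longrightarrow> \<bar>deriv p z\<bar> \<le> B" by (rule p'_bounded) blast
  have Y': "(Y has_real_derivative massless_field \<kappa> a F p t (Y t)) (at t within {0..})" if "t \<ge> 0" for t
    using Y that by (simp add: ode_solution_on_def has_real_derivative_iff_has_vector_derivative)
  have p': "\<bar>a * deriv p (a * t)\<bar> \<le> a * B" if "t \<ge> 0" for t
    using B(2)[of "a * t"] that \<open>a > 0\<close> by (simp add: abs_mult)
  have cancel: "a / (2 * \<kappa>) * (2 * \<kappa> * B) = a * B" using \<open>\<kappa> > 0\<close> by simp
  obtain U where U: "\<And>y. y \<ge> U \<Longrightarrow> F y \<le> - (2 * \<kappa> * B)"
    using F(1) unfolding filterlim_at_bot eventually_at_top_linorder by meson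
  obtain V where V: "\<And>y. y \<le> V \<Longrightarrow> F y \<ge> 2 * \<kappa> * B"
    using F(2) unfolding filterlim_at_top eventually_at_bot_linorder by meson
  have up: "Y t \<le> max U (Y 0)" if "t \<ge> 0" for t
  proof (rule barrier_above[OF Y'])
    fix t assume t: "0 \<le> t" "max U (Y 0) < Y t"
    have "a / (2 * \<kappa>) * F (Y t) \<le> a / (2 * \<kappa>) * (- (2 * \<kappa> * B))"
      using t assms(3,4) by (intro mult_left_mono U) auto
    then show "massless_field \<kappa> a F p t (Y t) \<le> 0"
      using p'[OF t(1)] cancel unfolding massless_field_def mult_minus_right by linarith
  qed (use that in auto)
  have lo: "- Y t \<le> max (- V) (- Y 0)" if "t \<ge> 0" for t
  proof (rule barrier_above[where y="\<lambda>t. - Y t"])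
    show "((\<lambda>t. - Y t) has_real_derivative - massless_field \<kappa> a F p t (Y t)) (at t within {0..})" if "t \<ge> 0" for t
      by (rule DERIV_minus[OF Y'[OF that]])
    fix t assume t: "0 \<le> t" "max (- V) (- Y 0) < - Y t"
    have "a / (2 * \<kappa>) * (2 * \<kappa> * B) \<le> a / (2 * \<kappa>) * F (Y t)"
      using t assms(3,4) by (intro mult_left_mono V) auto
    then show "- massless_field \<kappa> a F p t (Y t) \<le> 0"
      using p'[OF t(1)] cancel unfolding massless_field_def by linarith
  qed (use that in auto)
  have "\<bar>Y t\<bar> \<le> max (max U (Y 0)) (max (- V) (- Y 0))" if "t \<ge> 0" for t
    using up[OF that] lo[OF that] by linarith
  then show ?thesis unfolding bounded_iff by auto
qed

lemma massless_solution_convergent: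
  assumes F: "F C1_differentiable_on UNIV" "filterlim F at_bot at_top" "filterlim F at_top at_bot"
    and "a > 0" "\<kappa> > 0" and Y: "ode_solution_on {0..} (massless_field \<kappa> a F p) Y"
  shows "convergent (\<lambda>n. Y (real n * (\<omega> / a)))"
proof -
  interpret periodic_ode "massless_field \<kappa> a F p" "\<omega> / a" by (rule massless_periodic_ode[OF F(1) \<open>a > 0\<close>])
  note sh = shift[OF Y, of 1, simplified]
  have suc: "real (Suc n) * (\<omega> / a) = real n * (\<omega> / a) + \<omega> / a" for n by (simp add: algebra_simps)
  have nn: "0 \<le> real n * (\<omega> / a)" for n using \<tau>_pos by (intro mult_nonneg_nonneg) auto
  have "monoseq (\<lambda>n. Y (real n * (\<omega> / a)))"
  proof (cases "Y 0 \<le> Y (\<omega> / a)")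
    case True
    have "Y (real n * (\<omega> / a)) \<le> Y (real (Suc n) * (\<omega> / a))" for n
      unfolding suc by (rule scalar_ode_comparison[OF X_lip Y sh _ nn]) (use True in simp)
    then show ?thesis by (intro incseq_imp_monoseq incseq_SucI)
  next
    case False
    have "Y (real (Suc n) * (\<omega> / a)) \<le> Y (real n * (\<omega> / a))" for n
      unfolding suc by (rule scalar_ode_comparison[OF X_lip sh Y _ nn]) (use False in simp)
    then show ?thesis by (intro decseq_imp_monoseq decseq_SucI)
  qed
  moreover have "Bseq (\<lambda>n. Y (real n * (\<omega> / a)))"
  proof -
    obtain b where "\<forall>x\<in>Y ` {0..}. norm x \<le> b"
      using massless_solution_bounded[OF F(2,3) assms(4,5) Y] unfolding bounded_iff by blast
    then show ?thesis using nn by (intro BseqI'[of _ b]) auto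
  qed
  ultimately show ?thesis by (intro Bseq_monoseq_convergent)
qed

end

subsection \<open>The massive equation\<close>

lemma massive_solution_iff:
  "ode_solution_on I (massive_field m \<kappa> a F p) (\<lambda>t. (y t, v t)) \<longleftrightarrow>
    (\<forall>t\<in>I. (y has_real_derivative v t) (at t within I) \<and>
       (v has_real_derivative (1 / m * F (y t) - 2 * \<kappa> / (a * m) * v t + 2 * \<kappa> / (a * m) * a * deriv p (a * t)))
         (at t within I))"
proof -
  have "((\<lambda>t. (y t, v t)) has_vector_derivative (y', v')) (at t within I) \<longleftrightarrow>
      (y has_vector_derivative y') (at t within I) \<and> (v has_vector_derivative v') (at t within I)" for y' v' t
    using bounded_linear.has_vector_derivative[OF bounded_linear_fst, of "\<lambda>t. (y t, v t)" "(y', v')" "at t within I"]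
      bounded_linear.has_vector_derivative[OF bounded_linear_snd, of "\<lambda>t. (y t, v t)" "(y', v')" "at t within I"]
      has_vector_derivative_Pair[of y y' t I v v'] by auto
  then show ?thesis
    by (simp add: ode_solution_on_def massive_field_def Let_def has_real_derivative_iff_has_vector_derivative)
qed

lemma massive_lipschitz:
  assumes F: "F C1_differentiable_on UNIV"
  shows "lipschitz_on_bounded (massive_field m \<kappa> a F p)"
  unfolding lipschitz_on_bounded_def
proof (intro allI impI)
  fix B :: "(real \<times> real) set" assume "bounded B"
  then obtain R where R: "\<forall>x\<in>B. norm x \<le> R" unfolding bounded_iff by blast
  obtain L where L: "L \<ge> 0" "\<And>x y. \<bar>x\<bar> \<le> R \<Longrightarrow> \<bar>y\<bar> \<le> R \<Longrightarrow> \<bar>F x - F y\<bar> \<le> L * \<bar>x - y\<bar>"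
    by (rule C1_lipschitz_on_interval[OF F, of R]) blast
  define k where "k = 2 * \<kappa> / (a * m)"
  let ?C = "1 + \<bar>1 / m\<bar> * L + \<bar>k\<bar>"
  show "\<exists>L\<ge>0. \<forall>t\<ge>0. \<forall>z\<in>B. \<forall>w\<in>B. norm (massive_field m \<kappa> a F p t z - massive_field m \<kappa> a F p t w) \<le> L * norm (z - w)"
  proof (intro exI[of _ ?C] conjI allI impI ballI)
    fix t :: real and z w :: "real \<times> real" assume zw: "z \<in> B" "w \<in> B"
    have proj: "\<bar>fst q\<bar> \<le> norm q" "\<bar>snd q\<bar> \<le> norm q" for q :: "real \<times> real"
      using norm_fst_le[of "fst q" "snd q"] norm_snd_le[of "snd q" "fst q"] by simp_all
    have f: "\<bar>fst z\<bar> \<le> R" "\<bar>fst w\<bar> \<le> R"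
      using order.trans[OF proj(1)] R zw by blast+
    have d: "\<bar>fst z - fst w\<bar> \<le> norm (z - w)" "\<bar>snd z - snd w\<bar> \<le> norm (z - w)"
      using proj[of "z - w"] unfolding fst_diff snd_diff by this+
    have "massive_field m \<kappa> a F p t z - massive_field m \<kappa> a F p t w =
        (snd z - snd w, 1 / m * (F (fst z) - F (fst w)) - k * (snd z - snd w))"
      by (simp add: massive_field_def Let_def k_def split_beta right_diff_distrib)
    also have "norm \<dots> \<le> \<bar>snd z - snd w\<bar> + \<bar>1 / m * (F (fst z) - F (fst w)) - k * (snd z - snd w)\<bar>"
      using norm_Pair_le[of "snd z - snd w" "1 / m * (F (fst z) - F (fst w)) - k * (snd z - snd w)"]
      unfolding real_norm_def .
    also have "\<bar>1 / m * (F (fst z) - F (fst w)) - k * (snd z - snd w)\<bar> \<le>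
        \<bar>1 / m\<bar> * \<bar>F (fst z) - F (fst w)\<bar> + \<bar>k\<bar> * \<bar>snd z - snd w\<bar>"
      by (rule order.trans[OF abs_triangle_ineq4]) (simp only: abs_mult)
    also have "\<bar>1 / m\<bar> * \<bar>F (fst z) - F (fst w)\<bar> \<le> \<bar>1 / m\<bar> * (L * \<bar>fst z - fst w\<bar>)"
      using f by (intro mult_left_mono L) auto
    also have "\<bar>1 / m\<bar> * (L * \<bar>fst z - fst w\<bar>) \<le> \<bar>1 / m\<bar> * (L * norm (z - w))"
      using d L(1) by (intro mult_left_mono) auto
    also have "\<bar>k\<bar> * \<bar>snd z - snd w\<bar> \<le> \<bar>k\<bar> * norm (z - w)" using d by (intro mult_left_mono) auto
    also note d(2)
    finally show "norm (massive_field m \<kappa> a F p t z - massive_field m \<kappa> a F p t w) \<le> ?C * norm (z - w)"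
      by (simp add: algebra_simps)
  qed (use L in simp)
qed

lemma (in half_line_periodic) massive_periodic_ode:
  assumes "F C1_differentiable_on UNIV" "a > 0"
  shows "periodic_ode (massive_field m \<kappa> a F p) (\<omega> / a)"
proof
  show "lipschitz_on_bounded (massive_field m \<kappa> a F p)" by (rule massive_lipschitz[OF assms(1)])
  show "\<omega> / a > 0" using assms \<omega>_pos by simp
  fix t :: real assume "t \<ge> 0"
  then have "deriv p (a * t + \<omega>) = deriv p (a * t)" using assms by (intro p'_periodic) simp
  then show "massive_field m \<kappa> a F p (t + \<omega> / a) = massive_field m \<kappa> a F p t"
    using assms by (intro ext) (simp add: massive_field_def distrib_left)
qed

subsection \<open>Contraction for the massive equation\<close>

lemma quadratic_form_coercive:
  fixes l k :: real
  assumes "0 < l" "l < 2 * k"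
  obtains \<delta> where "\<delta> > 0" "\<And>d e. \<delta> * (d\<^sup>2 + e\<^sup>2) \<le> e\<^sup>2 + l * d * e + l * k / 2 * d\<^sup>2"
proof -
  define \<theta> where "\<theta> = (1 + l / (2 * k)) / 2"
  have k: "k > 0" using assms by linarith
  have \<theta>: "l / (2 * k) < \<theta>" "\<theta> < 1" "\<theta> > 0" using assms k by (auto simp: \<theta>_def field_simps)
  have "l < \<theta> * (2 * k)" using \<theta>(1) k by (simp add: field_simps)
  then have "l * l < l * (\<theta> * (2 * k))" using assms by (intro mult_strict_left_mono)
  then have pos: "l * k / 2 - l\<^sup>2 / (4 * \<theta>) > 0" using \<theta>(3) by (simp add: field_simps power2_eq_square)
  define \<delta> where "\<delta> = min (1 - \<theta>) (l * k / 2 - l\<^sup>2 / (4 * \<theta>))"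
  have "\<delta> > 0" using \<theta> pos by (simp add: \<delta>_def)
  moreover have "\<delta> * (d\<^sup>2 + e\<^sup>2) \<le> e\<^sup>2 + l * d * e + l * k / 2 * d\<^sup>2" for d e
  proof -
    have "\<delta> * d\<^sup>2 \<le> (l * k / 2 - l\<^sup>2 / (4 * \<theta>)) * d\<^sup>2" by (intro mult_right_mono) (auto simp: \<delta>_def)
    moreover have "\<delta> * e\<^sup>2 \<le> (1 - \<theta>) * e\<^sup>2" by (intro mult_right_mono) (auto simp: \<delta>_def)
    moreover have "0 \<le> \<theta> * (e + l / (2 * \<theta>) * d)\<^sup>2" using \<theta>(3) by simp
    moreover have "\<theta> * (e + l / (2 * \<theta>) * d)\<^sup>2 = \<theta> * e\<^sup>2 + l * d * e + l\<^sup>2 / (4 * \<theta>) * d\<^sup>2"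
      using \<theta>(3) by (simp add: power2_eq_square field_simps)
    ultimately show ?thesis by (simp add: algebra_simps)
  qed
  ultimately show thesis by (rule that)
qed

text \<open>\<open>H\<close> is \<open>0\<close> under (F2) and \<open>d \<Delta>\<close> under (F3).\<close>

lemma lyapunov_decay:
  fixes d e \<Delta> H H' Q :: "real \<Rightarrow> real"
  assumes t0: "t0 \<ge> 0" and lk: "0 < l" "l < 2 * k" and \<eta>: "\<eta> > 0" and K: "K \<ge> 0"
    and d: "\<And>t. t \<ge> 0 \<Longrightarrow> (d has_real_derivative e t) (at t within {0..})"
    and e: "\<And>t. t \<ge> 0 \<Longrightarrow> (e has_real_derivative - \<Delta> t - k * e t) (at t within {0..})"
    and H: "\<And>t. t \<ge> 0 \<Longrightarrow> (H has_real_derivative H' t) (at t within {0..})"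
    and H0: "\<And>t. t \<ge> t0 \<Longrightarrow> H t \<ge> 0"
    and diss: "\<And>t. t \<ge> t0 \<Longrightarrow> - (2 * k - l) * (e t)\<^sup>2 - 2 * e t * \<Delta> t - l * (d t * \<Delta> t) + H' t \<le> - \<eta> * Q t"
    and Q: "\<And>t. t \<ge> t0 \<Longrightarrow> (d t)\<^sup>2 \<le> K * Q t" "\<And>t. t \<ge> t0 \<Longrightarrow> (e t)\<^sup>2 \<le> Q t" "\<And>t. t \<ge> t0 \<Longrightarrow> H t \<le> Q t"
  obtains C \<gamma> where "\<gamma> > 0" "\<And>t. t \<ge> t0 \<Longrightarrow> (d t)\<^sup>2 + (e t)\<^sup>2 \<le> C * exp (- \<gamma> * t)"
proof -
  define W where "W t = (e t)\<^sup>2 + l * d t * e t + l * k / 2 * (d t)\<^sup>2 + H t" for t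
  define W' where "W' t = - (2 * k - l) * (e t)\<^sup>2 - 2 * e t * \<Delta> t - l * (d t * \<Delta> t) + H' t" for t
  have k: "k > 0" using lk by linarith
  obtain \<delta> where \<delta>: "\<delta> > 0" "\<And>d e. \<delta> * (d\<^sup>2 + e\<^sup>2) \<le> e\<^sup>2 + l * d * e + l * k / 2 * d\<^sup>2"
    by (rule quadratic_form_coercive[OF lk]) blast
  define C1 where "C1 = 2 + l * (K + 1) + l * k / 2 * K"
  have C1: "C1 > 0" unfolding C1_def using lk k K by (intro add_pos_nonneg) auto
  have WC: "W t \<le> C1 * Q t" if t: "t \<ge> t0" for t
  proof -
    have "0 \<le> (d t - e t)\<^sup>2" by simp
    then have "d t * e t \<le> (d t)\<^sup>2 + (e t)\<^sup>2" 
      using zero_le_power2[of "d t"] zero_le_power2[of "e t"] unfolding power2_diff by linarith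
    also have "\<dots> \<le> (K + 1) * Q t" using Q[OF t] by (simp add: algebra_simps)
    finally have "l * (d t * e t) \<le> l * ((K + 1) * Q t)" using lk by (intro mult_left_mono) auto
    moreover have "l * k / 2 * (d t)\<^sup>2 \<le> l * k / 2 * (K * Q t)" using lk k Q(1)[OF t] by (intro mult_left_mono) auto
    ultimately show ?thesis using Q(2,3)[OF t] by (simp add: W_def C1_def algebra_simps)
  qed
  define \<gamma> where "\<gamma> = \<eta> / C1"
  have \<gamma>: "\<gamma> > 0" using \<eta> C1 by (simp add: \<gamma>_def)
  have W: "(W has_real_derivative W' t) (at t within {0..})" if "t \<ge> 0" for t
    unfolding W_def W'_def
    by (rule derivative_eq_intros d[OF that] e[OF that] H[OF that] refl | simp)+
       (simp add: algebra_simps power2_eq_square)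
  have W'W: "W' t \<le> - \<gamma> * W t" if t: "t \<ge> t0" for t
  proof -
    have "\<gamma> * W t \<le> \<gamma> * (C1 * Q t)" using WC[OF t] \<gamma> by (intro mult_left_mono) auto
    also have "\<dots> = \<eta> * Q t" using C1 by (simp add: \<gamma>_def)
    finally show ?thesis using diss[OF t] unfolding W'_def by linarith
  qed
  show thesis
  proof (rule that[OF \<gamma>])
    fix t assume t: "t \<ge> t0"
    have "\<delta> * ((d t)\<^sup>2 + (e t)\<^sup>2) \<le> W t" using \<delta>(2)[of "d t" "e t"] H0[OF t] unfolding W_def by linarith
    also have "W t \<le> W t0 * exp (- \<gamma> * (t - t0))"
      by (rule differential_inequality[OF t, where E'=W'])
        (use t0 W'W in \<open>auto intro: DERIV_subset[OF W]\<close>)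
    also have "\<dots> = (W t0 * exp (\<gamma> * t0)) * exp (- \<gamma> * t)"
      by (simp add: exp_diff exp_minus right_diff_distrib divide_inverse)
    finally show "(d t)\<^sup>2 + (e t)\<^sup>2 \<le> (W t0 * exp (\<gamma> * t0) / \<delta>) * exp (- \<gamma> * t)"
      using \<delta>(1) by (simp add: field_simps)
  qed
qed

lemma cond_F2_sector:
  assumes F2: "cond_F2 m \<kappa> a F" and k: "k = 2 * \<kappa> / (a * m)"
    and "d = y1 - y2" "\<Delta> = - (1 / m) * (F y1 - F y2)"
  shows "(k\<^sup>2 / 2 - 1) * d\<^sup>2 \<le> d * \<Delta>" "\<Delta>\<^sup>2 \<le> d * \<Delta>"
proof -
  have g: "0 < k\<^sup>2 / 2 - 1" using F2 unfolding cond_F2_def Let_def k by linarith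
  have "(k\<^sup>2 / 2 - 1) * d\<^sup>2 \<le> d * \<Delta> \<and> \<Delta>\<^sup>2 \<le> d * \<Delta>"
  proof (cases "y1 = y2")
    case True
    then show ?thesis using assms(3,4) by simp
  next
    case False
    define G where "G = - (1 / m) * ((F y1 - F y2) / (y1 - y2))"
    have G: "k\<^sup>2 / 2 - 1 \<le> G" "G \<le> 1"
      using F2 False unfolding cond_F2_def Let_def k G_def by metis+
    have \<Delta>: "\<Delta> = G * d" using False assms(3,4) by (simp add: G_def)
    have "(k\<^sup>2 / 2 - 1) * d\<^sup>2 \<le> G * d\<^sup>2" using G by (intro mult_right_mono) auto
    moreover have "G * (G * d\<^sup>2) \<le> 1 * (G * d\<^sup>2)" using G g by (intro mult_right_mono) auto
    ultimately show ?thesis by (simp add: \<Delta> power2_eq_square mult_ac)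
  qed
  then show "(k\<^sup>2 / 2 - 1) * d\<^sup>2 \<le> d * \<Delta>" "\<Delta>\<^sup>2 \<le> d * \<Delta>" by auto
qed

lemma relative_derivative_bound:
  fixes g g' g'' :: "real \<Rightarrow> real"
  assumes g: "\<And>y. (g has_real_derivative g' y) (at y)" "\<And>y. (g' has_real_derivative g'' y) (at y)"
    and rel: "\<And>y. \<bar>y\<bar> \<le> M \<Longrightarrow> \<bar>g'' y\<bar> \<le> \<mu> * g' y" and xy: "- M \<le> x" "x \<le> y" "y \<le> M"
  shows "\<bar>g' y - g' x\<bar> \<le> \<mu> * (g y - g x)"
proof -
  have "\<mu> * g x - g' x \<le> \<mu> * g y - g' y"
  proof (rule DERIV_nonneg_imp_nondecreasing[OF xy(2)])
    fix z assume "x \<le> z" "z \<le> y"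
    then have "0 \<le> \<mu> * g' z - g'' z" using rel[of z] xy by (simp add: abs_le_iff)
    moreover have "((\<lambda>z. \<mu> * g z - g' z) has_real_derivative \<mu> * g' z - g'' z) (at z)"
      by (intro DERIV_diff DERIV_cmult g)
    ultimately show "\<exists>D. ((\<lambda>z. \<mu> * g z - g' z) has_real_derivative D) (at z) \<and> 0 \<le> D" by blast
  qed
  moreover have "\<mu> * g x + g' x \<le> \<mu> * g y + g' y"
  proof (rule DERIV_nonneg_imp_nondecreasing[OF xy(2)])
    fix z assume "x \<le> z" "z \<le> y"
    then have "0 \<le> \<mu> * g' z + g'' z" using rel[of z] xy by (simp add: abs_le_iff)
    moreover have "((\<lambda>z. \<mu> * g z + g' z) has_real_derivative \<mu> * g' z + g'' z) (at z)"
      by (intro DERIV_add DERIV_cmult g)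
    ultimately show "\<exists>D. ((\<lambda>z. \<mu> * g z + g' z) has_real_derivative D) (at z) \<and> 0 \<le> D" by blast
  qed
  ultimately show ?thesis by (simp add: abs_le_iff algebra_simps)
qed

text \<open>For \<open>v1 = y1'\<close>, \<open>v2 = y2'\<close> and \<open>G = (g(y1) - g(y2)) / (y1 - y2)\<close>, the left-hand side is \<open>(y1 - y2)\<^sup>2 G'\<close>;
  the form without \<open>G\<close> also covers times where \<open>y1 = y2\<close>.\<close>

lemma slope_variation_bound:
  fixes g g' g'' :: "real \<Rightarrow> real"
  assumes g: "\<And>y. (g has_real_derivative g' y) (at y)" "\<And>y. (g' has_real_derivative g'' y) (at y)"
    and rel: "\<And>y. \<bar>y\<bar> \<le> M \<Longrightarrow> \<bar>g'' y\<bar> \<le> \<mu> * g' y"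
    and b: "\<bar>y1\<bar> \<le> M" "\<bar>y2\<bar> \<le> M" "\<bar>v1\<bar> \<le> N" "\<bar>v2\<bar> \<le> N"
  shows "(y1 - y2) * (g' y1 * v1 - g' y2 * v2) - (v1 - v2) * (g y1 - g y2)
    \<le> N * \<mu> * ((y1 - y2) * (g y1 - g y2))"
proof -
  have *: "(y1 - y2) * (g' y1 * v1 - g' y2 * v2) - (v1 - v2) * (g y1 - g y2)
      \<le> N * \<mu> * ((y1 - y2) * (g y1 - g y2))"
    if lt: "y2 < y1" and b: "\<bar>y1\<bar> \<le> M" "\<bar>y2\<bar> \<le> M" "\<bar>v1\<bar> \<le> N" "\<bar>v2\<bar> \<le> N" for y1 y2 v1 v2
  proof -
    obtain \<xi> where \<xi>: "y2 < \<xi>" "\<xi> < y1" "g y1 - g y2 = (y1 - y2) * g' \<xi>"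
      using MVT2[OF lt, of g g'] g(1) by blast
    have N: "N \<ge> 0" using b by linarith
    have "v1 * (g' y1 - g' \<xi>) + v2 * (g' \<xi> - g' y2) \<le> \<bar>v1\<bar> * \<bar>g' y1 - g' \<xi>\<bar> + \<bar>v2\<bar> * \<bar>g' \<xi> - g' y2\<bar>"
      by (intro add_mono) (simp_all only: abs_mult[symmetric] abs_ge_self)
    also have "\<dots> \<le> N * \<bar>g' y1 - g' \<xi>\<bar> + N * \<bar>g' \<xi> - g' y2\<bar>"
      using b by (intro add_mono mult_right_mono) auto
    also have "\<dots> \<le> N * (\<mu> * (g y1 - g \<xi>)) + N * (\<mu> * (g \<xi> - g y2))"
      using b \<xi> by (intro add_mono mult_left_mono[OF _ N] relative_derivative_bound[OF g rel]) auto
    also have "\<dots> = N * \<mu> * (g y1 - g y2)" by (simp add: algebra_simps)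
    finally have "(y1 - y2) * (v1 * (g' y1 - g' \<xi>) + v2 * (g' \<xi> - g' y2)) \<le> (y1 - y2) * (N * \<mu> * (g y1 - g y2))"
      using lt by (intro mult_left_mono) auto
    then show ?thesis unfolding \<xi>(3) by (simp add: algebra_simps)
  qed
  consider "y2 < y1" | "y1 < y2" | "y1 = y2" by linarith
  then show ?thesis
  proof cases
    case 1
    then show ?thesis by (rule *[OF _ b])
  next
    case 2
    from *[OF this b(2,1,4,3)] show ?thesis by (simp add: algebra_simps)
  qed simp
qed

lemma cond_F3_sector:
  assumes F: "F C1_differentiable_on UNIV" "deriv F C1_differentiable_on UNIV"
    and M: "M > 0" and neg: "\<And>y. \<bar>y\<bar> \<le> M \<Longrightarrow> deriv F y < 0"
    and \<mu>: "\<mu> = (SUP y\<in>{- M..M}. \<bar>deriv (deriv F) y\<bar> / \<bar>deriv F y\<bar>)"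
  shows "\<mu> \<ge> 0" "\<And>y. \<bar>y\<bar> \<le> M \<Longrightarrow> \<bar>deriv (deriv F) y\<bar> \<le> \<mu> * (- deriv F y)"
    and "\<exists>s>0. \<forall>y. \<bar>y\<bar> \<le> M \<longrightarrow> s \<le> - deriv F y"
proof -
  let ?q = "\<lambda>y. \<bar>deriv (deriv F) y\<bar> / \<bar>deriv F y\<bar>"
  have cont: "continuous_on {- M..M} (deriv F)" "continuous_on {- M..M} (deriv (deriv F))"
    by (rule continuous_on_subset[OF C1_differentiable_on_UNIV_real(2)[OF F(1)]], simp)
      (rule continuous_on_subset[OF C1_differentiable_on_UNIV_real(2)[OF F(2)]], simp)
  have "continuous_on {- M..M} ?q"
    using neg by (intro continuous_intros cont) (auto simp: abs_le_iff less_imp_neq)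
  then have "compact (?q ` {- M..M})" by (intro compact_continuous_image) auto
  then have bdd: "bdd_above (?q ` {- M..M})" by (intro bounded_imp_bdd_above compact_imp_bounded)
  have q: "?q y \<le> \<mu>" if "\<bar>y\<bar> \<le> M" for y
    unfolding \<mu> by (rule cSUP_upper[OF _ bdd]) (use that in auto)
  show "\<mu> \<ge> 0" using order.trans[OF _ q[of 0]] M by simp
  show "\<bar>deriv (deriv F) y\<bar> \<le> \<mu> * (- deriv F y)" if "\<bar>y\<bar> \<le> M" for y
  proof -
    have "\<bar>deriv F y\<bar> > 0" "- deriv F y = \<bar>deriv F y\<bar>" using neg[OF that] by auto
    with q[OF that] show ?thesis by (simp only: pos_divide_le_eq)
  qed
  obtain z where z: "z \<in> {- M..M}" "\<forall>y\<in>{- M..M}. deriv F y \<le> deriv F z"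
    using continuous_attains_sup[OF _ _ cont(1)] M by auto
  show "\<exists>s>0. \<forall>y. \<bar>y\<bar> \<le> M \<longrightarrow> s \<le> - deriv F y"
    by (rule exI[of _ "- deriv F z"]) (use z neg[of z] in \<open>auto simp: abs_le_iff\<close>)
qed

lemma massive_solutions_contract:
  assumes F: "F C1_differentiable_on UNIV" and pos: "m > 0" "\<kappa> > 0" "a > 0"
    and cond: "cond_F2 m \<kappa> a F \<or> cond_F3 m \<kappa> a F p"
    and s1: "ode_solution_on {0..} (massive_field m \<kappa> a F p) (\<lambda>t. (y1 t, v1 t))"
    and s2: "ode_solution_on {0..} (massive_field m \<kappa> a F p) (\<lambda>t. (y2 t, v2 t))"
  obtains C \<gamma> t0 where "\<gamma> > 0" "t0 \<ge> 0"
    "\<And>t. t \<ge> t0 \<Longrightarrow> norm ((y1 t, v1 t) - (y2 t, v2 t)) \<le> C * exp (- \<gamma> * t)"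
proof -
  define k where "k = 2 * \<kappa> / (a * m)"
  have k: "k > 0" using pos by (simp add: k_def)
  define g where "g y = - (1 / m) * F y" for y
  define d where "d t = y1 t - y2 t" for t
  define e where "e t = v1 t - v2 t" for t
  define \<Delta> where "\<Delta> t = g (y1 t) - g (y2 t)" for t
  note sol = s1[unfolded massive_solution_iff, rule_format, folded k_def]
    s2[unfolded massive_solution_iff, rule_format, folded k_def]
  have d': "(d has_real_derivative e t) (at t within {0..})" if "t \<ge> 0" for t
    unfolding d_def e_def using sol[of t] that by (auto intro: DERIV_diff)
  have e': "(e has_real_derivative - \<Delta> t - k * e t) (at t within {0..})" if "t \<ge> 0" for t
    unfolding e_def \<Delta>_def g_def
    by (rule DERIV_cong[OF DERIV_diff[OF sol(1)[THEN conjunct2] sol(2)[THEN conjunct2]]])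
      (use that in \<open>auto simp: algebra_simps\<close>)
  have "\<exists>\<gamma> C t0. \<gamma> > 0 \<and> t0 \<ge> 0 \<and> (\<forall>t\<ge>t0. (d t)\<^sup>2 + (e t)\<^sup>2 \<le> C * exp (- \<gamma> * t))"
    using cond
  proof
    assume F2: "cond_F2 m \<kappa> a F"
    have k2: "k\<^sup>2 / 2 - 1 > 0" using F2 unfolding cond_F2_def Let_def k_def by linarith
    have k1: "k > 1"
    proof (rule ccontr)
      assume "\<not> k > 1"
      then have "k\<^sup>2 \<le> 1\<^sup>2" using k by (intro power_mono) auto
      with k2 show False by simp
    qed
    have sec: "(k\<^sup>2 / 2 - 1) * (d t)\<^sup>2 \<le> d t * \<Delta> t" "(\<Delta> t)\<^sup>2 \<le> d t * \<Delta> t" for t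
      using cond_F2_sector[OF F2 k_def d_def, of "\<Delta> t" t] by (simp_all add: \<Delta>_def g_def right_diff_distrib)
    define Q where "Q t = (e t)\<^sup>2 + d t * \<Delta> t" for t
    have d\<Delta>: "d t * \<Delta> t \<ge> 0" for t using order.trans[OF zero_le_power2 sec(2)] .
    have dQ: "(d t)\<^sup>2 \<le> 1 / (k\<^sup>2 / 2 - 1) * Q t" for t
    proof -
      have "(k\<^sup>2 / 2 - 1) * (d t)\<^sup>2 \<le> Q t" using sec(1)[of t] by (simp add: Q_def add_increasing)
      then show ?thesis using k2 by (simp add: pos_le_divide_eq mult.commute)
    qed
    obtain C \<gamma> where "\<gamma> > 0" "\<And>t. t \<ge> 0 \<Longrightarrow> (d t)\<^sup>2 + (e t)\<^sup>2 \<le> C * exp (- \<gamma> * t)"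
    proof (rule lyapunov_decay[of 0 k k "k - 1" "1 / (k\<^sup>2 / 2 - 1)" d e \<Delta> "\<lambda>_. 0" "\<lambda>_. 0" Q])
      fix t :: real
      have "0 \<le> (e t + \<Delta> t)\<^sup>2" by simp
      then have "- (2 * e t * \<Delta> t) \<le> (e t)\<^sup>2 + d t * \<Delta> t" using sec(2)[of t] unfolding power2_sum by linarith
      then show "- (2 * k - k) * (e t)\<^sup>2 - 2 * e t * \<Delta> t - k * (d t * \<Delta> t) + 0 \<le> - (k - 1) * Q t"
        by (simp add: Q_def algebra_simps)
    qed (use k k1 k2 d' e' dQ d\<Delta> in \<open>auto simp: Q_def\<close>)
    then show ?thesis by (intro exI[of _ \<gamma>] exI[of _ C] exI[of _ 0]) auto
  next
    assume F3: "cond_F3 m \<kappa> a F p"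
    obtain M N where M: "M > 0" and N: "N > 0"
      and bd: "\<forall>y v. ode_solution_on {0..} (massive_field m \<kappa> a F p) (\<lambda>t. (y t, v t)) \<longrightarrow>
          (\<forall>\<^sub>F t in at_top. \<bar>y t\<bar> \<le> M \<and> \<bar>v t\<bar> \<le> N)"
      and F'': "deriv F C1_differentiable_on UNIV" and neg: "\<forall>y. \<bar>y\<bar> \<le> M \<longrightarrow> deriv F y < 0"
      and kN: "k > 1 / 2 * N * (SUP y\<in>{- M..M}. \<bar>deriv (deriv F) y\<bar> / \<bar>deriv F y\<bar>)"
      using F3[unfolded cond_F3_def Let_def, folded k_def] by (elim exE conjE) (rule that; assumption)
    define \<mu> where "\<mu> = (SUP y\<in>{- M..M}. \<bar>deriv (deriv F) y\<bar> / \<bar>deriv F y\<bar>)"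
    have neg': "deriv F y < 0" if "\<bar>y\<bar> \<le> M" for y using neg that by blast
    have sec: "\<mu> \<ge> 0" "\<bar>y\<bar> \<le> M \<Longrightarrow> \<bar>deriv (deriv F) y\<bar> \<le> \<mu> * (- deriv F y)"
      "\<exists>s>0. \<forall>y. \<bar>y\<bar> \<le> M \<longrightarrow> s \<le> - deriv F y" for y
      by (rule cond_F3_sector[OF F F'' M neg' \<mu>_def]; assumption)+
    obtain s where s: "s > 0" "\<And>y. \<bar>y\<bar> \<le> M \<Longrightarrow> s \<le> - deriv F y" using sec(3) by blast
    define g' where "g' y = - (1 / m) * deriv F y" for y
    define g'' where "g'' y = - (1 / m) * deriv (deriv F) y" for y
    have g: "(g has_real_derivative g' y) (at y)" "(g' has_real_derivative g'' y) (at y)" for y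
      unfolding g_def g'_def g''_def
      by (intro DERIV_cmult C1_differentiable_on_UNIV_real(1) F F'')+
    have rel: "\<bar>g'' y\<bar> \<le> \<mu> * g' y" if "\<bar>y\<bar> \<le> M" for y
      using mult_left_mono[OF sec(2)[OF that], of "1 / m"] pos(1) by (simp add: g'_def g''_def abs_mult)
    have "\<forall>\<^sub>F t in at_top. \<bar>y1 t\<bar> \<le> M \<and> \<bar>v1 t\<bar> \<le> N \<and> \<bar>y2 t\<bar> \<le> M \<and> \<bar>v2 t\<bar> \<le> N"
      using bd[rule_format, OF s1] bd[rule_format, OF s2] by eventually_elim auto
    then obtain t1 where "\<And>t. t \<ge> t1 \<Longrightarrow> \<bar>y1 t\<bar> \<le> M \<and> \<bar>v1 t\<bar> \<le> N \<and> \<bar>y2 t\<bar> \<le> M \<and> \<bar>v2 t\<bar> \<le> N"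
      unfolding eventually_at_top_linorder by blast
    then have b: "\<bar>y1 t\<bar> \<le> M" "\<bar>v1 t\<bar> \<le> N" "\<bar>y2 t\<bar> \<le> M" "\<bar>v2 t\<bar> \<le> N" if "t \<ge> max t1 0" for t
      using that by auto
    define l where "l = (N * \<mu> + 2 * k) / 2"
    have "0 \<le> N * \<mu>" "N * \<mu> < 2 * k" using N sec(1) kN by (auto simp: \<mu>_def[symmetric])
    then have l: "0 < l" "l < 2 * k" "N * \<mu> < l" by (auto simp: l_def)
    define \<eta> where "\<eta> = min (2 * k - l) (l - N * \<mu>)"
    have \<eta>: "\<eta> > 0" "\<eta> \<le> 2 * k - l" "\<eta> \<le> l - N * \<mu>" using l by (auto simp: \<eta>_def)
    define H where "H t = d t * \<Delta> t" for t
    define H' where "H' t = e t * \<Delta> t + d t * (g' (y1 t) * v1 t - g' (y2 t) * v2 t)" for t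
    define Q where "Q t = (e t)\<^sup>2 + H t" for t
    have H': "(H has_real_derivative H' t) (at t within {0..})" if "t \<ge> 0" for t
    proof -
      have "((\<lambda>t. g (y1 t)) has_real_derivative g' (y1 t) * v1 t) (at t within {0..})"
        "((\<lambda>t. g (y2 t)) has_real_derivative g' (y2 t) * v2 t) (at t within {0..})"
        using sol[of t] that by (auto intro!: DERIV_chain2[OF g(1)])
      from DERIV_mult[OF d'[OF that] DERIV_diff[OF this]]
      show ?thesis unfolding H_def[abs_def] \<Delta>_def[abs_def] H'_def by (rule DERIV_cong) (simp add: \<Delta>_def algebra_simps)
    qed
    have lower: "s / m * (d t)\<^sup>2 \<le> H t" if t: "t \<ge> max t1 0" for t
    proof -
      have "\<exists>\<xi>. \<bar>\<xi>\<bar> \<le> M \<and> \<Delta> t = d t * g' \<xi>"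
      proof -
        consider "y2 t < y1 t" | "y1 t < y2 t" | "y1 t = y2 t" by linarith
        then show ?thesis
        proof cases
          case 1
          then obtain \<xi> where "y2 t < \<xi>" "\<xi> < y1 t" "g (y1 t) - g (y2 t) = (y1 t - y2 t) * g' \<xi>"
            using MVT2[of "y2 t" "y1 t" g g'] g(1) by blast
          then show ?thesis using b[OF t] by (intro exI[of _ \<xi>]) (auto simp: \<Delta>_def d_def)
        next
          case 2
          then obtain \<xi> where "y1 t < \<xi>" "\<xi> < y2 t" "g (y2 t) - g (y1 t) = (y2 t - y1 t) * g' \<xi>"
            using MVT2[of "y1 t" "y2 t" g g'] g(1) by blast
          then show ?thesis using b[OF t] by (intro exI[of _ \<xi>]) (auto simp: \<Delta>_def d_def algebra_simps)
        next
          case 3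
          then show ?thesis using b[OF t] by (intro exI[of _ "y1 t"]) (auto simp: \<Delta>_def d_def)
        qed
      qed
      then obtain \<xi> where \<xi>: "\<bar>\<xi>\<bar> \<le> M" "\<Delta> t = d t * g' \<xi>" by blast
      have "s / m \<le> g' \<xi>" using divide_right_mono[OF s(2)[OF \<xi>(1)], of m] pos(1) by (simp add: g'_def)
      then have "s / m * (d t)\<^sup>2 \<le> g' \<xi> * (d t)\<^sup>2" by (rule mult_right_mono) simp
      then show ?thesis by (simp add: H_def \<xi>(2) power2_eq_square mult_ac)
    qed
    have H0: "H t \<ge> 0" if "t \<ge> max t1 0" for t
      using order.trans[OF _ lower[OF that]] s(1) pos(1) by simp
    obtain C \<gamma> where "\<gamma> > 0" "\<And>t. t \<ge> max t1 0 \<Longrightarrow> (d t)\<^sup>2 + (e t)\<^sup>2 \<le> C * exp (- \<gamma> * t)"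
    proof (rule lyapunov_decay[of "max t1 0" l k \<eta> "m / s" d e \<Delta> H H' Q])
      fix t assume t: "t \<ge> max t1 0"
      have "d t * (g' (y1 t) * v1 t - g' (y2 t) * v2 t) - e t * \<Delta> t \<le> N * \<mu> * H t"
        unfolding d_def e_def \<Delta>_def H_def
        by (rule slope_variation_bound[OF g rel b(1,3,2,4)[OF t]])
      then have "- (2 * k - l) * (e t)\<^sup>2 - 2 * e t * \<Delta> t - l * (d t * \<Delta> t) + H' t
          \<le> - (2 * k - l) * (e t)\<^sup>2 - (l - N * \<mu>) * H t"
        unfolding H'_def by (simp add: H_def algebra_simps)
      also have "\<dots> \<le> - \<eta> * (e t)\<^sup>2 - \<eta> * H t"
        using mult_right_mono[OF \<eta>(2) zero_le_power2[of "e t"]] mult_right_mono[OF \<eta>(3) H0[OF t]]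
        unfolding mult_minus_left by linarith
      finally show "- (2 * k - l) * (e t)\<^sup>2 - 2 * e t * \<Delta> t - l * (d t * \<Delta> t) + H' t \<le> - \<eta> * Q t"
        by (simp add: Q_def algebra_simps)
      have "s / m * (d t)\<^sup>2 \<le> Q t" using lower[OF t] by (simp add: Q_def add_increasing)
      then show "(d t)\<^sup>2 \<le> m / s * Q t" using s(1) pos(1) by (simp add: field_simps)
      show "H t \<ge> 0" by (rule H0[OF t])
      then show "(e t)\<^sup>2 \<le> Q t" "H t \<le> Q t" by (auto simp: Q_def)
    qed (use l \<eta> s pos d' e' H' in auto)
    then show ?thesis by (intro exI[of _ \<gamma>] exI[of _ C] exI[of _ "max t1 0"]) auto
  qed
  then obtain \<gamma> C t0 where C: "\<gamma> > 0" "t0 \<ge> 0" "\<And>t. t \<ge> t0 \<Longrightarrow> (d t)\<^sup>2 + (e t)\<^sup>2 \<le> C * exp (- \<gamma> * t)" by blast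
  show thesis
  proof (rule that[of "\<gamma> / 2" t0 "sqrt C"])
    fix t assume "t \<ge> t0"
    have "norm ((y1 t, v1 t) - (y2 t, v2 t)) = sqrt ((d t)\<^sup>2 + (e t)\<^sup>2)"
      by (simp add: norm_Pair d_def e_def)
    also have "\<dots> \<le> sqrt (C * exp (- \<gamma> * t))" using C(3)[OF \<open>t \<ge> t0\<close>] by (rule real_sqrt_le_mono)
    also have "exp (- \<gamma> * t) = (exp (- (\<gamma> / 2) * t))\<^sup>2" by (simp add: exp_double[symmetric])
    also have "sqrt (C * (exp (- (\<gamma> / 2) * t))\<^sup>2) = sqrt C * exp (- (\<gamma> / 2) * t)"
      by (simp add: real_sqrt_mult)
    finally show "norm ((y1 t, v1 t) - (y2 t, v2 t)) \<le> sqrt C * exp (- (\<gamma> / 2) * t)" .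
  qed (use C in auto)
qed

subsection \<open>The string driven at the origin\<close>

lemma time_continuous_derivI:
  assumes D: "L2_weak_deriv e u D" "loc_bdd D"
    and S: "\<And>t. t > 0 \<Longrightarrow> finite (S t)" "\<And>t x. t > 0 \<Longrightarrow> x \<notin> S t \<Longrightarrow> isCont (\<lambda>s. D (x, s)) t"
  shows "time_continuous_deriv e u D"
  unfolding time_continuous_deriv_def
proof (intro conjI allI impI D)
  fix R t :: real assume R: "R > 0" and t: "t > 0"
  have lbD: "loc_bdd (\<lambda>x. D (x, s))" for s
    by (rule loc_bdd_compose[OF D(2)]) (intro continuous_intros)
  have "L2_loc (\<lambda>x. D (x, t))" by (rule loc_bdd_imp_L2_loc[OF lbD])
  then have "set_integrable lborel {-R..R} (\<lambda>x. (D (x, t))\<^sup>2)" by (simp add: L2_loc_def)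
  then show "set_integrable lborel {-R<..<R} (\<lambda>x. (D (x, t))\<^sup>2)"
    by (rule set_integrable_subset) auto
  show "((\<lambda>s. LINT x:{-R<..<R}|lborel. (D (x, s) - D (x, t))\<^sup>2) \<longlongrightarrow> 0) (at t)"
    unfolding tendsto_at_iff_sequentially
  proof (intro allI impI)
    fix X :: "nat \<Rightarrow> real" assume X: "X \<longlonglongrightarrow> t"
    have "bounded (insert t (range X))" using convergent_imp_bounded[OF X] by simp
    then obtain b where b: "\<forall>s\<in>insert t (range X). norm s \<le> b" unfolding bounded_iff by blast
    have "compact ({-R..R} \<times> {-b..b})" by (intro compact_Times compact_Icc)
    then obtain B where B: "B \<ge> 0" "\<And>z. z \<in> {-R..R} \<times> {-b..b} \<Longrightarrow> \<bar>D z\<bar> \<le> B"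
      using loc_bdd_bound[OF D(2)] by metis
    have tb: "t \<in> {-b..b}" "X n \<in> {-b..b}" for n
      using b[rule_format, of t] b[rule_format, of "X n"] by (auto simp: abs_le_iff)
    let ?f = "\<lambda>n x. indicator {-R<..<R} x *\<^sub>R (D (x, X n) - D (x, t))\<^sup>2"
    have "(\<lambda>n. LBINT x. ?f n x) \<longlonglongrightarrow> integral\<^sup>L lborel (\<lambda>x::real. 0::real)"
    proof (rule Bochner_Integration.integral_dominated_convergence[where f="\<lambda>_. 0" and w="\<lambda>x. (2 * B)\<^sup>2 * indicator {-R..R} x"])
      show "integrable lborel (\<lambda>x. (2 * B)\<^sup>2 * indicator {-R..R} x)" by (rule integrable_indicator_compact) simp
      have "(\<lambda>x. D (x, s)) \<in> borel_measurable borel" for s by (rule loc_bdd_measurable[OF lbD])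
      then show "?f n \<in> borel_measurable lborel" for n by simp
      have "AE x in lborel. x \<notin> S t"
        using S(1)[OF t] by (intro AE_not_in finite_imp_null_set_lborel)
      then show "AE x in lborel. (\<lambda>n. ?f n x) \<longlonglongrightarrow> 0"
      proof eventually_elim
        fix x assume "x \<notin> S t"
        then have "(\<lambda>n. D (x, X n)) \<longlonglongrightarrow> D (x, t)" by (rule isCont_tendsto_compose[OF S(2)[OF t] X])
        then have "(\<lambda>n. ?f n x) \<longlonglongrightarrow> indicator {-R<..<R} x *\<^sub>R (D (x, t) - D (x, t))\<^sup>2"
          by (intro tendsto_intros)
        then show "(\<lambda>n. ?f n x) \<longlonglongrightarrow> 0" by simp
      qed
      fix n
      show "AE x in lborel. norm (?f n x) \<le> (2 * B)\<^sup>2 * indicator {-R..R} x"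
      proof (rule AE_I2)
        fix x
        show "norm (?f n x) \<le> (2 * B)\<^sup>2 * indicator {-R..R} x"
        proof (cases "x \<in> {-R<..<R}")
          case True
          then have "\<bar>D (x, X n)\<bar> \<le> B" "\<bar>D (x, t)\<bar> \<le> B" using tb by (auto intro!: B(2))
          then have "\<bar>D (x, X n) - D (x, t)\<bar> \<le> 2 * B" by linarith
          then have "\<bar>D (x, X n) - D (x, t)\<bar>\<^sup>2 \<le> (2 * B)\<^sup>2" by (intro power_mono) auto
          then show ?thesis using True by simp
        qed simp
      qed
    qed simp
    then show "((\<lambda>s. LINT x:{-R<..<R}|lborel. (D (x, s) - D (x, t))\<^sup>2) \<circ> X) \<longlonglongrightarrow> 0"
      by (simp add: set_lebesgue_integral_def o_def)
  qed
qed

lemma pred_fst_pos: "Measurable.pred borel (\<lambda>z :: real \<times> real. 0 < fst z)"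
proof -
  have "open {z :: real \<times> real. 0 < fst z}" by (intro open_Collect_less continuous_intros)
  then show ?thesis by (simp add: pred_def)
qed

locale driven_string = half_line_periodic +
  fixes a :: real and y v :: "real \<Rightarrow> real"
  assumes a_pos: "a > 0"
    and y_deriv: "\<And>t. t \<ge> 0 \<Longrightarrow> (y has_real_derivative v t) (at t within {0..})"
    and v_cont: "continuous_on {0..} v" and y_nonpos: "\<And>t. t \<le> 0 \<Longrightarrow> y t = y 0"
begin

text \<open>\<open>y\<close> may have a kink at \<open>0\<close>, so \<open>y'\<close> is its derivative only off \<open>0\<close>.\<close>

definition y' :: "real \<Rightarrow> real" where
  "y' t = (if t > 0 then v t else 0)"

definition wave :: "real \<times> real \<Rightarrow> real" where
  "wave z = y (snd z - \<bar>fst z\<bar> / a) + (if fst z > 0 then p (a * snd z + fst z) - p (a * snd z - fst z) else 0)"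

definition wave_t :: "real \<times> real \<Rightarrow> real" where
  "wave_t z = y' (snd z - \<bar>fst z\<bar> / a) +
     (if fst z > 0 then a * (deriv p (a * snd z + fst z) - deriv p (a * snd z - fst z)) else 0)"

definition wave_x :: "real \<times> real \<Rightarrow> real" where
  "wave_x z = (if fst z > 0 then - (y' (snd z - \<bar>fst z\<bar> / a) / a) + deriv p (a * snd z + fst z) + deriv p (a * snd z - fst z)
     else y' (snd z - \<bar>fst z\<bar> / a) / a)"

lemma y_cont: "continuous_on UNIV y"
proof -
  have "continuous_on {0..} y"
    using y_deriv by (meson DERIV_continuous atLeast_iff continuous_on_eq_continuous_within)
  then have "continuous_on UNIV (\<lambda>t. y (max t 0))"
    by (rule continuous_on_compose2) (auto intro!: continuous_intros)
  moreover have "y (max t 0) = y t" for t using y_nonpos[of t] by (simp add: max_def)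
  ultimately show ?thesis by simp
qed

lemma v_max_cont: "continuous_on UNIV (\<lambda>t. v (max t 0))"
  by (rule continuous_on_compose2[OF v_cont]) (auto intro!: continuous_intros)

lemma y'_loc_bdd: "loc_bdd y'"
proof -
  have "y' = (\<lambda>t. if t > 0 then v (max t 0) else 0)" by (auto simp: y'_def)
  moreover have "Measurable.pred borel (\<lambda>t::real. t > 0)" by simp
  ultimately show ?thesis using loc_bdd_If[OF loc_bdd_continuous[OF v_max_cont] loc_bdd_const] by simp
qed

lemma y_has_deriv: assumes "t \<noteq> 0" shows "(y has_real_derivative y' t) (at t)"
proof (cases "t > 0")
  case True
  have "at t within {0..} = at t" by (rule at_within_interior) (use True in simp)
  then show ?thesis using y_deriv[of t] True by (simp add: y'_def)
next
  case False
  have c: "((\<lambda>_. y 0) has_real_derivative 0) (at t)" by simp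
  have e: "y 0 = y s" if "s \<in> {..<0}" for s using y_nonpos[of s] that by simp
  have "(y has_real_derivative 0) (at t)"
    by (rule has_field_derivative_transform_within_open[of _ _ _ "{..<0}", OF c _ _ e]) (use False assms in auto)
  then show ?thesis using False by (simp add: y'_def)
qed

lemma y'_isCont: assumes "t \<noteq> 0" shows "isCont y' t"
proof (cases "t > 0")
  case True
  have "\<forall>\<^sub>F s in nhds t. s \<in> {0<..}" using True by (intro eventually_nhds_in_open) auto
  then have "\<forall>\<^sub>F s in nhds t. y' s = v (max s 0)" by (rule eventually_mono) (simp add: y'_def)
  from isCont_cong[OF this] show ?thesis using v_max_cont by (simp add: continuous_on_eq_continuous_at)
next
  case False
  have "\<forall>\<^sub>F s in nhds t. s \<in> {..<0}" using False assms by (intro eventually_nhds_in_open) auto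
  then have "\<forall>\<^sub>F s in nhds t. y' s = 0" by (rule eventually_mono) (simp add: y'_def)
  from isCont_cong[OF this] show ?thesis by simp
qed

lemma p'_compose_cont: "continuous_on UNIV f \<Longrightarrow> continuous_on UNIV (\<lambda>z. deriv p (f z))"
  by (rule continuous_on_compose2[OF p'_cont]) auto

lemma p_compose_cont: "continuous_on UNIV f \<Longrightarrow> continuous_on UNIV (\<lambda>z. p (f z))"
  by (rule continuous_on_compose2[OF p_cont[of UNIV]]) auto

lemma wave_continuous: "continuous_on UNIV wave"
proof -
  have "wave = (\<lambda>z. y (snd z - \<bar>fst z\<bar> / a) + (p (a * snd z + max (fst z) 0) - p (a * snd z - max (fst z) 0)))"
    by (auto simp: wave_def max_def)
  moreover have "continuous_on UNIV (\<lambda>z :: real \<times> real. y (snd z - \<bar>fst z\<bar> / a) + (p (a * snd z + max (fst z) 0) - p (a * snd z - max (fst z) 0)))"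
    using a_pos by (intro continuous_intros p_compose_cont continuous_on_compose2[OF y_cont]) auto
  ultimately show ?thesis by simp
qed

lemma wave_t_loc_bdd: "loc_bdd wave_t" and wave_x_loc_bdd: "loc_bdd wave_x"
proof -
  have 1: "loc_bdd (\<lambda>z::real \<times> real. y' (snd z - \<bar>fst z\<bar> / a))"
    using a_pos by (intro loc_bdd_compose[OF y'_loc_bdd] continuous_intros) auto
  have 2: "continuous_on UNIV (\<lambda>z::real \<times> real. deriv p (a * snd z + fst z))"
    "continuous_on UNIV (\<lambda>z::real \<times> real. deriv p (a * snd z - fst z))"
    by (intro p'_compose_cont continuous_intros)+
  show "loc_bdd wave_t"
    unfolding wave_t_def[abs_def]
    by (intro loc_bdd_add 1 loc_bdd_If[OF _ _ pred_fst_pos] loc_bdd_const loc_bdd_continuous continuous_intros 2)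
  have 3: "loc_bdd (\<lambda>z::real \<times> real. y' (snd z - \<bar>fst z\<bar> / a) * (1 / a))"
    by (intro loc_bdd_mult 1 loc_bdd_const)
  have 4: "loc_bdd (\<lambda>z::real \<times> real. (- 1) * (y' (snd z - \<bar>fst z\<bar> / a) * (1 / a)) + deriv p (a * snd z + fst z) + deriv p (a * snd z - fst z))"
    by (intro loc_bdd_add loc_bdd_mult[OF loc_bdd_const 3] loc_bdd_continuous 2)
  show "loc_bdd wave_x"
  proof -
    have "wave_x = (\<lambda>z. if 0 < fst z then (- 1) * (y' (snd z - \<bar>fst z\<bar> / a) * (1 / a)) + deriv p (a * snd z + fst z) + deriv p (a * snd z - fst z)
        else y' (snd z - \<bar>fst z\<bar> / a) * (1 / a))" by (intro ext) (simp add: wave_x_def)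
    with loc_bdd_If[OF 4 3 pred_fst_pos] show ?thesis by (simp only:)
  qed
qed

lemma wave_weak_t: "L2_weak_deriv (0, 1) wave wave_t"
proof (rule L2_weak_deriv_timeI[where S="\<lambda>x. {\<bar>x\<bar> / a}"])
  fix x t :: real assume "t \<notin> {\<bar>x\<bar> / a}"
  then have "(y has_real_derivative y' (t - \<bar>x\<bar> / a)) (at (t - \<bar>x\<bar> / a))" by (intro y_has_deriv) auto
  then have 1: "((\<lambda>t. y (t - \<bar>x\<bar> / a)) has_real_derivative y' (t - \<bar>x\<bar> / a) * 1) (at t)"
    by (rule DERIV_chain2) (auto intro!: derivative_eq_intros)
  have 2: "((\<lambda>t. p (a * t + x)) has_real_derivative deriv p (a * t + x) * a) (at t)"
    by (rule DERIV_chain2[OF p_deriv]) (auto intro!: derivative_eq_intros)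
  have 3: "((\<lambda>t. p (a * t - x)) has_real_derivative deriv p (a * t - x) * a) (at t)"
    by (rule DERIV_chain2[OF p_deriv]) (auto intro!: derivative_eq_intros)
  show "((\<lambda>t. wave (x, t)) has_real_derivative wave_t (x, t)) (at t)"
  proof (cases "x > 0")
    case True
    from DERIV_add[OF 1 DERIV_diff[OF 2 3]] show ?thesis using True by (simp add: wave_def wave_t_def algebra_simps)
  next
    case False
    with 1 show ?thesis by (simp add: wave_def wave_t_def)
  qed
qed (simp_all add: wave_continuous wave_t_loc_bdd)

lemma wave_weak_x: "L2_weak_deriv (1, 0) wave wave_x"
proof (rule L2_weak_deriv_spaceI[where S="\<lambda>t. {0, a * t, - (a * t)}"])
  fix x t :: real assume x: "x \<notin> {0, a * t, - (a * t)}"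
  show "((\<lambda>x. wave (x, t)) has_real_derivative wave_x (x, t)) (at x)"
  proof (cases "x > 0")
    case True
    have "(y has_real_derivative y' (t - x / a)) (at (t - x / a))"
      by (rule y_has_deriv) (use x a_pos in \<open>auto simp: field_simps\<close>)
    then have 1: "((\<lambda>x. y (t - x / a)) has_real_derivative y' (t - x / a) * (- 1 / a)) (at x)"
      by (rule DERIV_chain2) (use a_pos in \<open>auto intro!: derivative_eq_intros\<close>)
    have 2: "((\<lambda>x. p (a * t + x)) has_real_derivative deriv p (a * t + x) * 1) (at x)"
      by (rule DERIV_chain2[OF p_deriv]) (auto intro!: derivative_eq_intros)
    have 3: "((\<lambda>x. p (a * t - x)) has_real_derivative deriv p (a * t - x) * (- 1)) (at x)"
      by (rule DERIV_chain2[OF p_deriv]) (auto intro!: derivative_eq_intros)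
    have "((\<lambda>x. y (t - x / a) + (p (a * t + x) - p (a * t - x))) has_real_derivative wave_x (x, t)) (at x)"
      by (rule DERIV_cong[OF DERIV_add[OF 1 DERIV_diff[OF 2 3]]]) (use True in \<open>simp add: wave_x_def\<close>)
    then show ?thesis
      by (rule has_field_derivative_transform_within_open[of _ _ _ "{0<..}"]) (use True in \<open>auto simp: wave_def\<close>)
  next
    case False
    have "(y has_real_derivative y' (t + x / a)) (at (t + x / a))"
      by (rule y_has_deriv) (use x a_pos in \<open>auto simp: field_simps\<close>)
    then have 1: "((\<lambda>x. y (t + x / a)) has_real_derivative y' (t + x / a) * (1 / a)) (at x)"
      by (rule DERIV_chain2) (use a_pos in \<open>auto intro!: derivative_eq_intros\<close>)
    have "((\<lambda>x. y (t + x / a)) has_real_derivative wave_x (x, t)) (at x)"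
      by (rule DERIV_cong[OF 1]) (use False in \<open>simp add: wave_x_def\<close>)
    then show ?thesis
      by (rule has_field_derivative_transform_within_open[of _ _ _ "{..<0}"]) (use x False in \<open>auto simp: wave_def\<close>)
  qed
qed (simp_all add: wave_continuous wave_x_loc_bdd)

lemma wave_in_class_E: "wave \<in> class_E"
  unfolding class_E_def using wave_continuous wave_weak_t wave_weak_x by auto

lemma y'_shift_isCont:
  assumes "x \<notin> {a * t, - (a * t)}" shows "isCont (\<lambda>s. y' (s - \<bar>x\<bar> / a)) t"
proof -
  have "isCont y' (t - \<bar>x\<bar> / a)" by (rule y'_isCont) (use assms a_pos in \<open>auto simp: field_simps abs_if split: if_splits\<close>)
  moreover have "isCont (\<lambda>s. s - \<bar>x\<bar> / a) t" by (intro continuous_intros)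
  ultimately show ?thesis by (rule isCont_o2[rotated])
qed

lemma p'_line_isCont: "isCont (\<lambda>s. deriv p (a * s + x)) t" "isCont (\<lambda>s. deriv p (a * s - x)) t"
  using p'_compose_cont[of "\<lambda>s. a * s + x"] p'_compose_cont[of "\<lambda>s. a * s - x"]
  by (auto intro!: continuous_intros simp: continuous_on_eq_continuous_at)

lemma wave_time_continuous: "time_continuous_deriv (0, 1) wave wave_t" "time_continuous_deriv (1, 0) wave wave_x"
proof -
  show "time_continuous_deriv (0, 1) wave wave_t"
  proof (rule time_continuous_derivI[OF wave_weak_t wave_t_loc_bdd, where S="\<lambda>t. {a * t, - (a * t)}"])
    fix t x assume "x \<notin> {a * t, - (a * t)}"
    from y'_shift_isCont[OF this] show "isCont (\<lambda>s. wave_t (x, s)) t"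
      by (cases "x > 0") (auto simp: wave_t_def intro!: continuous_intros p'_line_isCont)
  qed simp
  show "time_continuous_deriv (1, 0) wave wave_x"
  proof (rule time_continuous_derivI[OF wave_weak_x wave_x_loc_bdd, where S="\<lambda>t. {a * t, - (a * t)}"])
    fix t x assume "x \<notin> {a * t, - (a * t)}"
    from y'_shift_isCont[OF this] show "isCont (\<lambda>s. wave_x (x, s)) t"
      using a_pos by (cases "x > 0") (auto simp: wave_x_def intro!: continuous_intros p'_line_isCont)
  qed simp
qed

end

lemma dir_deriv_space_time:
  assumes "smooth_fun \<phi>"
  shows "dir_deriv (c, 1) \<phi> z = c * dir_deriv (1, 0) \<phi> z + dir_deriv (0, 1 :: real) \<phi> (z :: real \<times> real)"
proof -
  have lin: "linear (\<lambda>e. dir_deriv e \<phi> z)" by (rule has_derivative_linear[OF smooth_fun_has_derivative[OF assms]])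
  have "(c, 1) = c *\<^sub>R (1, 0) + (0, 1 :: real)" by simp
  then have "dir_deriv (c, 1) \<phi> z = dir_deriv (c *\<^sub>R (1, 0) + (0, 1)) \<phi> z" by simp
  also have "\<dots> = dir_deriv (c *\<^sub>R (1, 0)) \<phi> z + dir_deriv (0, 1) \<phi> z" by (rule linear_add[OF lin])
  also have "dir_deriv (c *\<^sub>R (1, 0)) \<phi> z = c * dir_deriv (1, 0) \<phi> z" using linear_scale[OF lin, of c "(1, 0)"] by simp
  finally show ?thesis .
qed

lemma set_lebesgue_integral_le_const:
  fixes f :: "real \<Rightarrow> real"
  assumes "R > 0" "c \<ge> 0" "\<And>x. x \<in> {-R<..<R} \<Longrightarrow> f x \<le> c"
  shows "(LINT x:{-R<..<R}|lborel. f x) \<le> 2 * R * c"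
proof -
  have "(LINT x:{-R<..<R}|lborel. f x) \<le> (LBINT x. c * indicator {-R<..<R} x)"
    unfolding set_lebesgue_integral_def
  proof (rule integral_mono')
    show "integrable lborel (\<lambda>x. c * indicator {-R<..<R} x)"
      using assms(1) by (intro integrable_mult_right integrable_real_indicator) simp_all
  qed (use assms in \<open>auto simp: indicator_def\<close>)
  also have "\<dots> = 2 * R * c" using assms(1) by simp
  finally show ?thesis .
qed

lemma driven_strings_local_energy_convergent:
  assumes A: "driven_string p \<omega> p0 a y1 v1" and B: "driven_string p \<omega> p0 a y2 v2"
    and y: "((\<lambda>t. y1 t - y2 t) \<longlongrightarrow> 0) at_top" and v: "((\<lambda>t. v1 t - v2 t) \<longlongrightarrow> 0) at_top"
  shows "local_energy_convergent (driven_string.wave p a y1) (driven_string.wave p a y2)"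
proof -
  interpret A: driven_string p \<omega> p0 a y1 v1 by (rule A)
  interpret B: driven_string p \<omega> p0 a y2 v2 by (rule B)
  note a = A.a_pos
  let ?E = "\<lambda>x t. \<bar>A.wave_t (x, t) - B.wave_t (x, t)\<bar>\<^sup>2 + \<bar>A.wave_x (x, t) - B.wave_x (x, t)\<bar>\<^sup>2"
  let ?I = "\<lambda>R t. LINT x:{-R<..<R}|lborel. ?E x t"
  let ?S = "\<lambda>R t. SUP x\<in>{-R<..<R}. \<bar>A.wave (x, t) - B.wave (x, t)\<bar>"
  have lim: "((\<lambda>t. ?I R t
        + ?S R t) \<longlongrightarrow> 0) at_top" if R: "R > 0" for R
  proof (rule tendstoI)
    fix e :: real assume e: "e > 0"
    define C where "C = 2 * R * (1 + 1 / a\<^sup>2)"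
    have C: "C > 0" using R a by (simp add: C_def add_pos_nonneg)
    have "((\<lambda>t. (v1 t - v2 t)\<^sup>2) \<longlongrightarrow> 0\<^sup>2) at_top" by (intro tendsto_intros v)
    then have "((\<lambda>t. (v1 t - v2 t)\<^sup>2) \<longlongrightarrow> 0) at_top" by simp
    then have "\<forall>\<^sub>F t in at_top. (v1 t - v2 t)\<^sup>2 < e / (3 * C)"
      by (rule order_tendstoD(2)) (use e C in simp)
    moreover have "\<forall>\<^sub>F t in at_top. \<bar>y1 t - y2 t\<bar> < e / 3"
      using tendstoD[OF y, of "e / 3"] e by (simp add: dist_real_def)
    ultimately have "\<forall>\<^sub>F t in at_top. (v1 t - v2 t)\<^sup>2 < e / (3 * C) \<and> \<bar>y1 t - y2 t\<bar> < e / 3"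
      by eventually_elim simp
    then obtain t1 where t1: "\<And>t. t \<ge> t1 \<Longrightarrow> (v1 t - v2 t)\<^sup>2 < e / (3 * C)" "\<And>t. t \<ge> t1 \<Longrightarrow> \<bar>y1 t - y2 t\<bar> < e / 3"
      unfolding eventually_at_top_linorder by blast
    show "\<forall>\<^sub>F t in at_top. dist (?I R t
        + ?S R t) 0 < e"
    proof (rule eventually_at_top_linorderI)
      fix t assume t: "max t1 0 + R / a + 1 \<le> t"
      have r: "t - \<bar>x\<bar> / a > 0" "t - \<bar>x\<bar> / a \<ge> t1" if "x \<in> {-R<..<R}" for x
      proof -
        have "\<bar>x\<bar> / a \<le> R / a" using that a by (intro divide_right_mono) auto
        then show "t - \<bar>x\<bar> / a > 0" "t - \<bar>x\<bar> / a \<ge> t1" using t by linarith+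
      qed
      have "?E x t \<le> (1 + 1 / a\<^sup>2) * (e / (3 * C))"
        if x: "x \<in> {-R<..<R}" for x
      proof -
        let ?d = "v1 (t - \<bar>x\<bar> / a) - v2 (t - \<bar>x\<bar> / a)"
        have y': "A.y' (t - \<bar>x\<bar> / a) = v1 (t - \<bar>x\<bar> / a)" "B.y' (t - \<bar>x\<bar> / a) = v2 (t - \<bar>x\<bar> / a)"
          using r(1)[OF x] unfolding A.y'_def B.y'_def by (simp_all only: if_True)
        have 1: "A.wave_t (x, t) - B.wave_t (x, t) = ?d"
          unfolding A.wave_t_def B.wave_t_def fst_conv snd_conv y' by simp
        have 2: "A.wave_x (x, t) - B.wave_x (x, t) = (if x > 0 then - (?d / a) else ?d / a)"
          unfolding A.wave_x_def B.wave_x_def fst_conv snd_conv y' by (simp add: diff_divide_distrib)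
        have "\<bar>A.wave_x (x, t) - B.wave_x (x, t)\<bar>\<^sup>2 = ?d\<^sup>2 / a\<^sup>2" unfolding 2 by (simp add: power_divide)
        then have "?E x t = (1 + 1 / a\<^sup>2) * ?d\<^sup>2"
          unfolding 1 by (simp add: algebra_simps)
        also have "\<dots> \<le> (1 + 1 / a\<^sup>2) * (e / (3 * C))"
          using t1(1)[OF r(2)[OF x]] by (intro mult_left_mono) auto
        finally show ?thesis .
      qed
      then have "?I R t
          \<le> 2 * R * ((1 + 1 / a\<^sup>2) * (e / (3 * C)))"
        using R C e by (intro set_lebesgue_integral_le_const) auto
      also have "\<dots> = C * (e / (3 * C))" by (simp only: C_def mult.assoc)
      also have "\<dots> = e / 3" using C by simp
      finally have I: "?I R t \<le> e / 3" .
      have I0: "0 \<le> ?I R t"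
        unfolding set_lebesgue_integral_def by (rule integral_nonneg_AE) auto
      have w: "\<bar>A.wave (x, t) - B.wave (x, t)\<bar> \<le> e / 3" if "x \<in> {-R<..<R}" for x
        using t1(2)[OF r(2)[OF that]] by (simp add: A.wave_def B.wave_def)
      have S: "?S R t \<le> e / 3"
        by (rule cSUP_least) (use R w in auto)
      have "bdd_above ((\<lambda>x. \<bar>A.wave (x, t) - B.wave (x, t)\<bar>) ` {-R<..<R})"
        using w by (intro bdd_aboveI[of _ "e / 3"]) auto
      from cSUP_upper[OF _ this, of 0] have S0: "0 \<le> ?S R t"
        using R by (auto intro: order.trans[OF abs_ge_zero])
      show "dist (?I R t
        + ?S R t) 0 < e"
        using I I0 S S0 e unfolding dist_real_def by linarith
    qed
  qed
  show ?thesis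
    unfolding local_energy_convergent_def
    using A.wave_time_continuous B.wave_time_continuous lim by blast
qed

context driven_string
begin

lemma wave_equation:
  assumes \<phi>: "test_fun {(x, t). x \<noteq> 0 \<and> t > 0} \<phi>"
  shows "(LBINT z. wave z * dir_deriv (0, 1) (dir_deriv (0, 1) \<phi>) z) =
    a\<^sup>2 * (LBINT z. wave z * dir_deriv (1, 0) (dir_deriv (1, 0) \<phi>) z)"
proof -
  obtain K where K: "K \<subseteq> {(x, t). x \<noteq> 0 \<and> t > 0}" "\<And>e z. z \<notin> K \<Longrightarrow> dir_deriv e \<phi> z = 0"
    using test_funE[OF \<phi>] by metis
  note s = test_fun_smooth[OF \<phi>]
  have T: "test_fun UNIV (dir_deriv e \<phi>)" for e by (rule test_fun_mono[OF test_fun_dir_deriv[OF \<phi>]]) simp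
  define hA where "hA s = y' (- s / a) + (- a) * deriv p (- s)" for s
  define hB where "hB s = a * deriv p s" for s
  define hC where "hC s = y' (s / a)" for s
  have hA: "loc_bdd hA" unfolding hA_def[abs_def]
    using a_pos by (intro loc_bdd_add loc_bdd_compose[OF y'_loc_bdd] loc_bdd_continuous continuous_intros p'_compose_cont) auto
  have hB: "loc_bdd hB" unfolding hB_def[abs_def]
    by (intro loc_bdd_continuous continuous_intros p'_compose_cont)
  have hC: "loc_bdd hC" unfolding hC_def[abs_def]
    using a_pos by (intro loc_bdd_compose[OF y'_loc_bdd] continuous_intros) auto
  let ?P = "{0<..} :: real set" and ?N = "{..<0} :: real set"
  let ?fA = "\<lambda>z. hA (fst z - a * snd z) * (indicator ?P (fst z) * dir_deriv (a, 1) \<phi> z)"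
  let ?fB = "\<lambda>z. hB (fst z - (- a) * snd z) * (indicator ?P (fst z) * dir_deriv (- a, 1) \<phi> z)"
  let ?fC = "\<lambda>z. hC (fst z - (- a) * snd z) * (indicator ?N (fst z) * dir_deriv (- a, 1) \<phi> z)"
  have fst_cont: "continuous_on UNIV (fst :: real \<times> real \<Rightarrow> real)" by (intro continuous_intros)
  have int: "integrable lborel (\<lambda>z. h (fst z - c * snd z) * (indicator A (fst z) * dir_deriv e \<phi> z))"
    if h: "loc_bdd h" and A: "open A" for h :: "real \<Rightarrow> real" and A c e
  proof -
    have "loc_bdd (\<lambda>z. h (fst z - c * snd z) * indicator A (fst z))"
      using A by (intro loc_bdd_mult loc_bdd_compose[OF h] loc_bdd_compose[OF loc_bdd_indicator fst_cont] continuous_intros) auto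
    from integrable_mult_test_fun[OF this T[of e]] show ?thesis by (simp add: mult.assoc)
  qed
  have zero: "(LBINT z. ?fA z) = 0" "(LBINT z. ?fB z) = 0" "(LBINT z. ?fC z) = 0"
    by (rule travelling_wave_annihilates[OF \<phi>]; auto simp: hA hB hC)+
  have eq: "wave_t z * dir_deriv (0, 1) \<phi> z + (- (a\<^sup>2)) * (wave_x z * dir_deriv (1, 0) \<phi> z) = ?fA z + ?fB z + ?fC z" for z
  proof -
    consider "fst z > 0" | "fst z < 0" | "fst z = 0" by linarith
    then show ?thesis
    proof cases
      case 1
      define \<beta> P M where "\<beta> = y' (snd z - fst z / a) / a" and "P = deriv p (a * snd z + fst z)"
        and "M = deriv p (a * snd z - fst z)"
      have \<beta>: "y' (snd z - fst z / a) = a * \<beta>" using a_pos by (simp add: \<beta>_def)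
      have "- (fst z - a * snd z) / a = snd z - fst z / a" "- (fst z - a * snd z) = a * snd z - fst z"
        using a_pos by (simp_all add: field_simps)
      then have A: "hA (fst z - a * snd z) = a * \<beta> - a * M" unfolding hA_def M_def by (simp add: \<beta>)
      have B: "hB (fst z - (- a) * snd z) = a * P" by (simp add: hB_def P_def add.commute)
      have w: "wave_t z = a * \<beta> + a * (P - M)" "wave_x z = - \<beta> + P + M"
        using 1 a_pos by (simp_all add: wave_t_def wave_x_def \<beta> P_def M_def)
      have ind: "indicator ?P (fst z) = (1::real)" "indicator ?N (fst z) = (0::real)" using 1 by auto
      show ?thesis
        unfolding dir_deriv_space_time[OF s, of a] dir_deriv_space_time[OF s, of "- a"] A B w ind by (simp add: algebra_simps power2_eq_square)
    next
      case 2
      define \<beta> where "\<beta> = y' (snd z + fst z / a) / a"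
      have \<beta>: "y' (snd z + fst z / a) = a * \<beta>" using a_pos by (simp add: \<beta>_def)
      have "(fst z - (- a) * snd z) / a = snd z + fst z / a" using a_pos by (simp add: field_simps)
      then have C: "hC (fst z - (- a) * snd z) = a * \<beta>" by (simp only: hC_def \<beta>)
      have w: "wave_t z = a * \<beta>" "wave_x z = \<beta>"
        using 2 a_pos by (simp_all add: wave_t_def wave_x_def \<beta>)
      have ind: "indicator ?P (fst z) = (0::real)" "indicator ?N (fst z) = (1::real)" using 2 by auto
      show ?thesis
        unfolding dir_deriv_space_time[OF s, of a] dir_deriv_space_time[OF s, of "- a"] C w ind by (simp add: algebra_simps power2_eq_square)
    next
      case 3
      then have "z \<notin> K" using K(1) by auto
      from K(2)[OF this] show ?thesis using 3 by simp
    qed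
  qed
  have i: "integrable lborel (\<lambda>z. wave_t z * dir_deriv (0, 1) \<phi> z)" "integrable lborel (\<lambda>z. wave_x z * dir_deriv (1, 0) \<phi> z)"
    by (intro integrable_mult_test_fun[OF _ T] wave_t_loc_bdd wave_x_loc_bdd)+
  have "(LBINT z. wave_t z * dir_deriv (0, 1) \<phi> z) - a\<^sup>2 * (LBINT z. wave_x z * dir_deriv (1, 0) \<phi> z)
      = (LBINT z. wave_t z * dir_deriv (0, 1) \<phi> z + (- (a\<^sup>2)) * (wave_x z * dir_deriv (1, 0) \<phi> z))"
    using i by simp
  also have "\<dots> = (LBINT z. ?fA z + ?fB z + ?fC z)" by (simp only: eq)
  also have "\<dots> = (LBINT z. ?fA z) + (LBINT z. ?fB z) + (LBINT z. ?fC z)"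
    using int[OF hA, of ?P a] int[OF hB, of ?P "- a"] int[OF hC, of ?N "- a"]
    by (subst Bochner_Integration.integral_add, simp, simp, subst Bochner_Integration.integral_add) simp_all
  also have "\<dots> = 0" by (simp only: zero)
  finally have "(LBINT z. wave_t z * dir_deriv (0, 1) \<phi> z) = a\<^sup>2 * (LBINT z. wave_x z * dir_deriv (1, 0) \<phi> z)" by simp
  moreover have "(LBINT z. wave z * dir_deriv (0, 1) (dir_deriv (0, 1) \<phi>) z) = - (LBINT z. wave_t z * dir_deriv (0, 1) \<phi> z)"
    using wave_weak_t T[of "(0, 1)"] unfolding L2_weak_deriv_def weak_deriv_def by blast
  moreover have "(LBINT z. wave z * dir_deriv (1, 0) (dir_deriv (1, 0) \<phi>) z) = - (LBINT z. wave_x z * dir_deriv (1, 0) \<phi> z)"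
    using wave_weak_x T[of "(1, 0)"] unfolding L2_weak_deriv_def weak_deriv_def by blast
  ultimately show ?thesis by simp
qed

lemma y_weak_second_derivative:
  assumes r: "\<And>t. t \<ge> 0 \<Longrightarrow> ((\<lambda>t. m * v t) has_real_derivative r t) (at t within {0..})"
    and r_cont: "continuous_on {0..} r" and \<phi>: "test_fun {0<..} \<phi>"
  shows "m * (LBINT t. y t * dir_deriv 1 (dir_deriv 1 \<phi>) t) = (LBINT t. r t * \<phi> t)"
proof -
  obtain K where K: "K \<subseteq> {0<..}" "\<And>z. z \<notin> K \<Longrightarrow> \<phi> z = 0" "\<And>e z. z \<notin> K \<Longrightarrow> dir_deriv e \<phi> z = 0"
    using test_funE[OF \<phi>] by metis
  have T: "test_fun UNIV \<phi>" by (rule test_fun_mono[OF \<phi>]) simp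
  have "L2_weak_deriv 1 y y'"
    by (rule L2_weak_deriv_1I[where S="{0}"]) (auto simp: y_cont y'_loc_bdd y_has_deriv)
  then have 1: "(LBINT t. y t * dir_deriv 1 (dir_deriv 1 \<phi>) t) = - (LBINT t. y' t * dir_deriv 1 \<phi> t)"
    using test_fun_dir_deriv[OF T] unfolding L2_weak_deriv_def weak_deriv_def by blast
  let ?w = "\<lambda>t. m * v (max t 0)" and ?D = "\<lambda>t. if t > 0 then r (max t 0) else 0"
  have "L2_weak_deriv 1 ?w ?D"
  proof (rule L2_weak_deriv_1I[where S="{0}"])
    show "continuous_on UNIV ?w" by (intro continuous_intros v_max_cont)
    have "continuous_on UNIV (\<lambda>t. r (max t 0))"
      by (rule continuous_on_compose2[OF r_cont]) (auto intro!: continuous_intros)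
    moreover have "Measurable.pred borel (\<lambda>t::real. t > 0)" by simp
    ultimately show "loc_bdd ?D" by (intro loc_bdd_If loc_bdd_continuous loc_bdd_const)
    fix t :: real assume "t \<notin> {0}"
    show "(?w has_real_derivative ?D t) (at t)"
    proof (cases "t > 0")
      case True
      have "at t within {0..} = at t" by (rule at_within_interior) (use True in simp)
      then have "((\<lambda>t. m * v t) has_real_derivative ?D t) (at t)" using r[of t] True by simp
      then show ?thesis
        by (rule has_field_derivative_transform_within_open[of _ _ _ "{0<..}"]) (use True in auto)
    next
      case False
      have "((\<lambda>_. m * v 0) has_real_derivative ?D t) (at t)" using False by simp
      then show ?thesis
        by (rule has_field_derivative_transform_within_open[of _ _ _ "{..<0}"]) (use False \<open>t \<notin> {0}\<close> in auto)
    qed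
  qed simp
  then have "(LBINT t. ?w t * dir_deriv 1 \<phi> t) = - (LBINT t. ?D t * \<phi> t)"
    using T unfolding L2_weak_deriv_def weak_deriv_def by blast
  moreover have "?w t * dir_deriv 1 \<phi> t = m * (y' t * dir_deriv 1 \<phi> t)" "?D t * \<phi> t = r t * \<phi> t" for t
    using K(1) K(2)[of t] K(3)[of t 1] by (cases "t > 0"; force simp: y'_def)+
  ultimately have "m * (LBINT t. y' t * dir_deriv 1 \<phi> t) = - (LBINT t. r t * \<phi> t)" by simp
  with 1 show ?thesis by simp
qed

lemma wave_string_solution:
  assumes "\<mu> > 0" "\<kappa> > 0" "a = sqrt (\<kappa> / \<mu>)" and F: "continuous_on UNIV F"
    and jump: "\<And>t. t \<ge> 0 \<Longrightarrow>
      ((\<lambda>t. m * v t) has_real_derivative F (y t) + \<kappa> * (2 * deriv p (a * t) - 2 * v t / a)) (at t within {0..})"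
  shows "string_solution m \<mu> \<kappa> F wave"
proof -
  have a2: "\<mu> * a\<^sup>2 = \<kappa>" using assms(1-3) by simp
  let ?fp = "\<lambda>s. y (- s / a) - p (- s)" and ?fp' = "\<lambda>s. y' (- s / a) * (- 1 / a) + deriv p (- s)"
  let ?gm = "\<lambda>s. y (s / a)" and ?gm' = "\<lambda>s. y' (s / a) * (1 / a)"
  have c1: "continuous_on UNIV ?fp"
    using a_pos by (intro continuous_intros p_compose_cont continuous_on_compose2[OF y_cont]) auto
  have c2: "continuous_on UNIV ?gm"
    using a_pos by (intro continuous_intros continuous_on_compose2[OF y_cont]) auto
  have d1: "L2_weak_deriv 1 ?fp ?fp'"
  proof (rule L2_weak_deriv_1I[OF c1, where S="{0}"])
    show "loc_bdd ?fp'"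
      using a_pos by (intro loc_bdd_add loc_bdd_mult loc_bdd_const loc_bdd_compose[OF y'_loc_bdd] loc_bdd_continuous p'_compose_cont continuous_intros) auto
    fix s :: real assume "s \<notin> {0}"
    then have "(y has_real_derivative y' (- s / a)) (at (- s / a))" using a_pos by (intro y_has_deriv) auto
    then have 1: "((\<lambda>s. y (- s / a)) has_real_derivative y' (- s / a) * (- 1 / a)) (at s)"
      by (rule DERIV_chain2) (use a_pos in \<open>auto intro!: derivative_eq_intros\<close>)
    have 2: "((\<lambda>s. p (- s)) has_real_derivative deriv p (- s) * (- 1)) (at s)"
      by (rule DERIV_chain2[OF p_deriv]) (auto intro!: derivative_eq_intros)
    from DERIV_diff[OF 1 2] show "(?fp has_real_derivative ?fp' s) (at s)" by simp
  qed simp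
  have d2: "L2_weak_deriv 1 ?gm ?gm'"
  proof (rule L2_weak_deriv_1I[OF c2, where S="{0}"])
    show "loc_bdd ?gm'"
      using a_pos by (intro loc_bdd_mult loc_bdd_const loc_bdd_compose[OF y'_loc_bdd] continuous_intros) auto
    fix s :: real assume "s \<notin> {0}"
    then have "(y has_real_derivative y' (s / a)) (at (s / a))" using a_pos by (intro y_has_deriv) auto
    then show "(?gm has_real_derivative ?gm' s) (at s)"
      by (rule DERIV_chain2) (use a_pos in \<open>auto intro!: derivative_eq_intros\<close>)
  qed simp
  have d3: "L2_weak_deriv 1 p (deriv p)"
    by (rule L2_weak_deriv_1I[where S="{}"]) (auto simp: p_cont p_deriv intro: loc_bdd_continuous p'_cont)
  have d4: "L2_weak_deriv 1 (\<lambda>_ :: real. 0) (\<lambda>_. 0)"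
    by (rule L2_weak_deriv_1I[where S="{}"]) (auto intro: loc_bdd_const)
  have u1: "wave (x, t) = ?fp (x - a * t) + p (x + a * t)" if "x > 0" for x t
  proof -
    have "- (x - a * t) / a = t - x / a" using a_pos by (simp add: field_simps)
    then show ?thesis using that by (simp add: wave_def add.commute)
  qed
  have u2: "wave (x, t) = 0 + ?gm (x + a * t)" if "x < 0" for x t
  proof -
    have "(x + a * t) / a = t + x / a" using a_pos by (simp add: field_simps)
    then show ?thesis using that by (simp add: wave_def)
  qed
  have w0: "wave (0, t) = y t" for t by (simp add: wave_def)
  let ?r = "\<lambda>t. F (y t) + \<kappa> * (2 * deriv p (a * t) - 2 * v t / a)"
  have jump': "m * (LBINT t. wave (0, t) * dir_deriv 1 (dir_deriv 1 \<phi>) t) =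
      (LBINT t. (F (wave (0, t)) + \<kappa> * ((?fp' (- a * t) + deriv p (a * t)) - (0 + ?gm' (a * t)))) * \<phi> t)"
    if \<phi>: "test_fun {0<..} \<phi>" for \<phi>
  proof -
    obtain K where K: "K \<subseteq> {0<..}" "\<And>z. z \<notin> K \<Longrightarrow> \<phi> z = 0" using test_funE[OF \<phi>] by metis
    have "continuous_on {0..} ?r"
      using a_pos by (intro continuous_intros v_cont continuous_on_compose2[OF F] continuous_on_subset[OF y_cont]
          continuous_on_compose2[OF p'_cont]) auto
    then have "m * (LBINT t. y t * dir_deriv 1 (dir_deriv 1 \<phi>) t) = (LBINT t. ?r t * \<phi> t)"
      by (intro y_weak_second_derivative jump \<phi>)
    moreover have "?r t * \<phi> t = (F (wave (0, t)) + \<kappa> * ((?fp' (- a * t) + deriv p (a * t)) - (0 + ?gm' (a * t)))) * \<phi> t" for t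
    proof (cases "t > 0")
      case True
      then show ?thesis using a_pos by (simp add: w0 y'_def)
    next
      case False
      then have "t \<notin> K" using K(1) by auto
      then show ?thesis by (simp add: K(2))
    qed
    ultimately show ?thesis by (simp only: w0)
  qed
  show ?thesis
    unfolding string_solution_def Let_def assms(3)[symmetric]
  proof (intro conjI allI impI)
    show "wave \<in> class_E" by (rule wave_in_class_E)
    show "\<mu> * (LBINT z. wave z * dir_deriv (0, 1) (dir_deriv (0, 1) \<phi>) z) =
        \<kappa> * (LBINT z. wave z * dir_deriv (1, 0) (dir_deriv (1, 0) \<phi>) z)"
      if "test_fun {(x, t). x \<noteq> 0 \<and> t > 0} \<phi>" for \<phi>
      using wave_equation[OF that] by (simp add: a2[symmetric])
  qed (rule exI[of _ ?fp], rule exI[of _ p], rule exI[of _ "\<lambda>_. 0"], rule exI[of _ ?gm],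
      rule exI[of _ ?fp'], rule exI[of _ "deriv p"], rule exI[of _ "\<lambda>_. 0"], rule exI[of _ ?gm'],
      intro conjI allI impI c1 c2 d1 d2 d3 d4 u1 u2 jump' p_cont continuous_on_const)
qed

end

subsection \<open>The given solution as a driven string\<close>

lemma weak_deriv_scaled:
  fixes f f' :: "real \<Rightarrow> real"
  assumes f: "L2_weak_deriv 1 f f'" and c: "c \<noteq> 0" and \<phi>: "test_fun UNIV \<phi>"
  shows "integrable lborel (\<lambda>t. f' (c * t) * \<phi> t)"
    "(LBINT t. f' (c * t) * \<phi> t) = - (1 / c) * (LBINT t. f (c * t) * dir_deriv 1 \<phi> t)"
proof -
  have \<psi>: "test_fun UNIV (\<lambda>s. \<phi> (s / c))" by (rule test_fun_scale[OF \<phi> c])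
  have i: "integrable lborel (\<lambda>s. f' s * \<phi> (s / c))"
    using f \<psi> by (intro integrable_L2_loc_mult_test_fun) (auto simp: L2_weak_deriv_def)
  from lborel_integrable_real_affine[OF this c, of 0] show "integrable lborel (\<lambda>t. f' (c * t) * \<phi> t)" using c by simp
  have "dir_deriv 1 (\<lambda>s. \<phi> (s / c)) = (\<lambda>s. (1 / c) * dir_deriv 1 \<phi> (s / c))"
    using dir_deriv_affine_arg[OF test_fun_smooth[OF \<phi>], of 1 "1 / c" 0] by simp
  then have "(LBINT s. f s * ((1 / c) * dir_deriv 1 \<phi> (s / c))) = - (LBINT s. f' s * \<phi> (s / c))"
    using f \<psi> unfolding L2_weak_deriv_def weak_deriv_def by metis
  moreover have "(LBINT s. f s * ((1 / c) * dir_deriv 1 \<phi> (s / c))) = \<bar>c\<bar> * ((1 / c) * (LBINT t. f (c * t) * dir_deriv 1 \<phi> t))"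
    using lborel_integral_real_affine[OF c, of "\<lambda>s. f s * ((1 / c) * dir_deriv 1 \<phi> (s / c))" 0] c
    by (simp add: mult.left_commute)
  moreover have "(LBINT s. f' s * \<phi> (s / c)) = \<bar>c\<bar> * (LBINT t. f' (c * t) * \<phi> t)"
    using lborel_integral_real_affine[OF c, of "\<lambda>s. f' s * \<phi> (s / c)" 0] c by simp
  ultimately have "\<bar>c\<bar> * ((1 / c) * (LBINT t. f (c * t) * dir_deriv 1 \<phi> t)) = \<bar>c\<bar> * (- (LBINT t. f' (c * t) * \<phi> t))"
    by simp
  then have "(1 / c) * (LBINT t. f (c * t) * dir_deriv 1 \<phi> t) = - (LBINT t. f' (c * t) * \<phi> t)"
    using c by (simp only: mult_cancel_left) simp
  then show "(LBINT t. f' (c * t) * \<phi> t) = - (1 / c) * (LBINT t. f (c * t) * dir_deriv 1 \<phi> t)"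
    by simp
qed

lemma continuous_antiderivative:
  fixes f :: "real \<Rightarrow> real"
  assumes "continuous_on UNIV f"
  obtains G where "\<And>x. (G has_real_derivative f x) (at x)" "continuous_on UNIV G"
proof -
  have "isCont f x" for x using assms by (simp add: continuous_on_eq_continuous_at)
  then obtain G where G: "\<And>x. (G has_vector_derivative f x) (at x)"
    using einterval_antiderivative[of "-\<infinity>" "\<infinity>" f] by auto
  then have D: "(G has_real_derivative f x) (at x)" for x by (simp add: has_real_derivative_iff_has_vector_derivative)
  moreover have "continuous_on UNIV G" using D by (meson DERIV_isCont continuous_at_imp_continuous_on)
  ultimately show thesis by (rule that)
qed

lemma has_real_derivative_within_cong:
  assumes "(f has_real_derivative D) (at t within S)" "t \<in> S" "\<And>s. s \<in> S \<Longrightarrow> g s = f s"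
  shows "(g has_real_derivative D) (at t within S)"
  using assms unfolding has_field_derivative_def by (metis has_derivative_transform)

lemma eq_on_half_line_closure:
  fixes h :: "real \<Rightarrow> real"
  assumes "continuous_on UNIV h" "\<And>t. t > 0 \<Longrightarrow> h t = c" "t \<ge> 0"
  shows "h t = c"
  by (rule continuous_constant_on_closure[of "{0<..}" h])
    (use assms in \<open>auto intro: continuous_on_subset\<close>)

context half_line_periodic
begin

lemma string_solution_wave_form:
  assumes pos: "\<mu> > 0" "\<kappa> > 0" and a: "a = sqrt (\<kappa> / \<mu>)"
    and u: "string_solution m \<mu> \<kappa> F u" and init: "\<And>x t. t \<le> 0 \<Longrightarrow> u (x, t) = p (x + a * t)"
  shows "continuous_on UNIV (\<lambda>t. u (0, t))"
    and "u (x, t) = u (0, t - \<bar>x\<bar> / a) + (if x > 0 then p (a * t + x) - p (a * t - x) else 0)"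
    and "F' = (\<lambda>t. F (u (0, t))) \<Longrightarrow> continuous_on UNIV F' \<Longrightarrow> \<exists>c. \<forall>\<phi>. test_fun {0<..} \<phi> \<longrightarrow>
      m * (LBINT t. u (0, t) * dir_deriv 1 (dir_deriv 1 \<phi>) t) =
      (LBINT t. F' t * \<phi> t) + (LBINT t. (\<kappa> / a * (2 * u (0, t) - 2 * p (a * t) + c)) * dir_deriv 1 \<phi> t)"
proof -
  have a_pos: "a > 0" using pos a by simp
  from u have uE: "u \<in> class_E" unfolding string_solution_def Let_def by blast
  then have u_cont: "continuous_on UNIV u" by (simp add: class_E_def)
  have line: "continuous_on UNIV (\<lambda>x. u (x, t))" "continuous_on UNIV (\<lambda>t. u (x, t))" for x t
    by (intro continuous_on_compose2[OF u_cont] continuous_intros; simp)+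
  then show "continuous_on UNIV (\<lambda>t. u (0, t))" by blast
  obtain fp gp fm gm fp' gp' fm' gm' where
    cont: "continuous_on UNIV fp" "continuous_on UNIV gp" "continuous_on UNIV fm" "continuous_on UNIV gm"
    and weak: "L2_weak_deriv 1 fp fp'" "L2_weak_deriv 1 gp gp'" "L2_weak_deriv 1 fm fm'" "L2_weak_deriv 1 gm gm'"
    and up: "\<forall>x t. x > 0 \<longrightarrow> u (x, t) = fp (x - a * t) + gp (x + a * t)"
    and um: "\<forall>x t. x < 0 \<longrightarrow> u (x, t) = fm (x - a * t) + gm (x + a * t)"
    and jump: "\<forall>\<phi>. test_fun {0<..} \<phi> \<longrightarrow>
           m * (LBINT t. u (0, t) * dir_deriv 1 (dir_deriv 1 \<phi>) t) =
           (LBINT t. (F (u (0, t)) +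
                 \<kappa> * ((fp' (- a * t) + gp' (a * t)) - (fm' (- a * t) + gm' (a * t)))) * \<phi> t)"
    using u unfolding string_solution_def Let_def a[symmetric] by (elim conjE exE) (rule that; assumption)
  have char: "(s + r) / 2 - a * ((r - s) / (2 * a)) = s" "(s + r) / 2 + a * ((r - s) / (2 * a)) = r" for s r
    using a_pos by (simp_all add: field_simps)
  have plus: "fp s + gp r = p r" if "- s < r" "r \<le> s" for s r
    using up[rule_format, of "(s + r) / 2" "(r - s) / (2 * a)"] init[of "(r - s) / (2 * a)" "(s + r) / 2"] that a_pos
    unfolding char by (simp add: divide_nonpos_pos)
  have minus: "fm s + gm r = p0" if "s < - r" "r \<le> s" "r < 0" for s r
    using um[rule_format, of "(s + r) / 2" "(r - s) / (2 * a)"] init[of "(r - s) / (2 * a)" "(s + r) / 2"] that a_pos p_const[of r]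
    unfolding char by (simp add: divide_nonpos_pos)
  define C where "C = fp 1"
  define D where "D = fm 0"
  have gp: "gp r = p r - C" for r
  proof -
    have fpC: "fp s = C" if "s > 0" for s
      using plus[of s 0] plus[of 1 0] that by (simp add: C_def)
    have "- (\<bar>r\<bar> + 1) < r" "r \<le> \<bar>r\<bar> + 1" "\<bar>r\<bar> + 1 > 0" by linarith+
    with plus[of "\<bar>r\<bar> + 1" r] fpC[of "\<bar>r\<bar> + 1"] show ?thesis by simp
  qed
  have fm: "fm s = D" for s
  proof -
    have "s < - (- \<bar>s\<bar> - 1)" "- \<bar>s\<bar> - 1 \<le> s" "- \<bar>s\<bar> - 1 < 0" "0 < - (- \<bar>s\<bar> - 1)" by linarith+
    with minus[of s "- \<bar>s\<bar> - 1"] minus[of 0 "- \<bar>s\<bar> - 1"] show ?thesis by (simp add: D_def)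
  qed
  have gm: "gm (a * t) = u (0, t) - D" for t
  proof -
    have "u (0, t) - gm (0 + a * t) = D"
      by (rule continuous_constant_on_closure[of "{..<0}" "\<lambda>x. u (x, t) - gm (x + a * t)"])
        (use um fm in \<open>auto intro!: continuous_intros continuous_on_subset[OF line(1)] continuous_on_compose2[OF cont(4)]\<close>)
    then show ?thesis by simp
  qed
  have fp: "fp (- a * t) = u (0, t) - p (a * t) + C" for t
  proof -
    have "u (0, t) - fp (0 - a * t) - gp (0 + a * t) = 0"
      by (rule continuous_constant_on_closure[of "{0<..}" "\<lambda>x. u (x, t) - fp (x - a * t) - gp (x + a * t)"])
        (use up in \<open>auto intro!: continuous_intros continuous_on_subset[OF line(1)] continuous_on_compose2[OF cont(1)] continuous_on_compose2[OF cont(2)]\<close>)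
    then show ?thesis by (simp add: gp)
  qed
  show "u (x, t) = u (0, t - \<bar>x\<bar> / a) + (if x > 0 then p (a * t + x) - p (a * t - x) else 0)" for x t
  proof -
    consider "x > 0" | "x < 0" | "x = 0" by linarith
    then show ?thesis
    proof cases
      case 1
      have "- a * (t - x / a) = x - a * t" "a * (t - x / a) = a * t - x" using a_pos by (simp_all add: field_simps)
      then have "fp (x - a * t) = u (0, t - x / a) - p (a * t - x) + C" using fp[of "t - x / a"] by simp
      then show ?thesis using 1 up by (simp add: gp add.commute)
    next
      case 2
      have "a * (t + x / a) = x + a * t" using a_pos by (simp add: field_simps)
      then have "gm (x + a * t) = u (0, t + x / a) - D" using gm[of "t + x / a"] by simp
      then show ?thesis using 2 um by (simp add: fm)
    qed simp
  qed
  assume F': "F' = (\<lambda>t. F (u (0, t)))" "continuous_on UNIV F'"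
  show "\<exists>c. \<forall>\<phi>. test_fun {0<..} \<phi> \<longrightarrow>
      m * (LBINT t. u (0, t) * dir_deriv 1 (dir_deriv 1 \<phi>) t) =
      (LBINT t. F' t * \<phi> t) + (LBINT t. (\<kappa> / a * (2 * u (0, t) - 2 * p (a * t) + c)) * dir_deriv 1 \<phi> t)"
  proof (intro exI[of _ "2 * C - 2 * D"] allI impI)
    fix \<phi> :: "real \<Rightarrow> real" assume \<phi>: "test_fun {0<..} \<phi>"
    have T: "test_fun UNIV \<phi>" by (rule test_fun_mono[OF \<phi>]) simp
    note T' = test_fun_dir_deriv[OF T, of 1]
    have a0: "- a \<noteq> 0" "a \<noteq> 0" using a_pos by auto
    note w = weak_deriv_scaled[OF weak(1) a0(1) T] weak_deriv_scaled[OF weak(2) a0(2) T]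
      weak_deriv_scaled[OF weak(3) a0(1) T] weak_deriv_scaled[OF weak(4) a0(2) T]
    have iF: "integrable lborel (\<lambda>t. F' t * \<phi> t)" by (rule integrable_mult_test_fun[OF loc_bdd_continuous[OF F'(2)] T])
    have ic: "integrable lborel (\<lambda>t. f (c * t) * dir_deriv 1 \<phi> t)" if "continuous_on UNIV f" for f :: "real \<Rightarrow> real" and c
      by (intro integrable_mult_test_fun[OF loc_bdd_compose[OF loc_bdd_continuous[OF that]] T'] continuous_intros)
    note ii = ic[OF cont(1), of "- a"] ic[OF cont(2), of a] ic[OF cont(3), of "- a"] ic[OF cont(4), of a]
    have "m * (LBINT t. u (0, t) * dir_deriv 1 (dir_deriv 1 \<phi>) t) =
        (LBINT t. F' t * \<phi> t + \<kappa> * ((fp' (- a * t) * \<phi> t + gp' (a * t) * \<phi> t) - (fm' (- a * t) * \<phi> t + gm' (a * t) * \<phi> t)))"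
      using jump[rule_format, OF \<phi>] by (simp add: F'(1) algebra_simps)
    also have "\<dots> = (LBINT t. F' t * \<phi> t) + \<kappa> * (((LBINT t. fp' (- a * t) * \<phi> t) + (LBINT t. gp' (a * t) * \<phi> t))
        - ((LBINT t. fm' (- a * t) * \<phi> t) + (LBINT t. gm' (a * t) * \<phi> t)))"
      using iF w(1,3,5,7) by simp
    also have "\<dots> = (LBINT t. F' t * \<phi> t) + \<kappa> / a * (((LBINT t. fp (- a * t) * dir_deriv 1 \<phi> t) - (LBINT t. gp (a * t) * dir_deriv 1 \<phi> t))
        - ((LBINT t. fm (- a * t) * dir_deriv 1 \<phi> t) - (LBINT t. gm (a * t) * dir_deriv 1 \<phi> t)))"
      unfolding w(2,4,6,8) using a_pos by (simp add: field_simps)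
    also have "\<dots> = (LBINT t. F' t * \<phi> t) + (LBINT t. \<kappa> / a * ((fp (- a * t) * dir_deriv 1 \<phi> t - gp (a * t) * dir_deriv 1 \<phi> t)
        - (fm (- a * t) * dir_deriv 1 \<phi> t - gm (a * t) * dir_deriv 1 \<phi> t)))"
      using ii by simp
    also have "(\<lambda>t. \<kappa> / a * ((fp (- a * t) * dir_deriv 1 \<phi> t - gp (a * t) * dir_deriv 1 \<phi> t)
        - (fm (- a * t) * dir_deriv 1 \<phi> t - gm (a * t) * dir_deriv 1 \<phi> t))) =
        (\<lambda>t. (\<kappa> / a * (2 * u (0, t) - 2 * p (a * t) + (2 * C - 2 * D))) * dir_deriv 1 \<phi> t)"
      unfolding fp gp fm gm by (intro ext) (simp add: algebra_simps)
    finally show "m * (LBINT t. u (0, t) * dir_deriv 1 (dir_deriv 1 \<phi>) t) =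
      (LBINT t. F' t * \<phi> t) + (LBINT t. (\<kappa> / a * (2 * u (0, t) - 2 * p (a * t) + (2 * C - 2 * D))) * dir_deriv 1 \<phi> t)" .
  qed
qed

lemma line_derivative:
  "((\<lambda>t. p (a * t)) has_real_derivative deriv p (a * t) * a) (at t within S)"
  by (rule has_field_derivative_at_within, rule DERIV_chain2[OF p_deriv]) (auto intro!: derivative_eq_intros)

lemma string_solution_driven:
  assumes pos: "m \<ge> 0" "\<mu> > 0" "\<kappa> > 0" and a: "a = sqrt (\<kappa> / \<mu>)" and F: "continuous_on UNIV F"
    and u: "string_solution m \<mu> \<kappa> F u" and init: "\<And>x t. t \<le> 0 \<Longrightarrow> u (x, t) = p (x + a * t)"
    and rest: "m > 0 \<Longrightarrow> ((\<lambda>t. u (0, t)) has_real_derivative 0) (at 0 within {0..})"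
  obtains v where "driven_string p \<omega> p0 a (\<lambda>t. u (0, t)) v" "u = driven_string.wave p a (\<lambda>t. u (0, t))"
    "m = 0 \<Longrightarrow> v = (\<lambda>t. massless_field \<kappa> a F p t (u (0, t))) \<and>
       ode_solution_on {0..} (massless_field \<kappa> a F p) (\<lambda>t. u (0, t))"
    "m > 0 \<Longrightarrow> v 0 = 0 \<and> ode_solution_on {0..} (massive_field m \<kappa> a F p) (\<lambda>t. (u (0, t), v t))"
proof -
  have a_pos: "a > 0" using pos a by simp
  define y where "y t = u (0, t)" for t
  have y_cont: "continuous_on UNIV y"
    using string_solution_wave_form(1)[OF pos(2,3) a u init] by (simp add: y_def[abs_def])
  have y0: "y t = p0" if "t \<le> 0" for t
    using init[OF that, of 0] that a_pos by (simp add: y_def p_const mult_nonneg_nonpos)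
  define F' where "F' t = F (y t)" for t
  have F'_cont: "continuous_on UNIV F'" unfolding F'_def[abs_def] by (rule continuous_on_compose2[OF F y_cont]) simp
  obtain c where c: "\<And>\<phi>. test_fun {0<..} \<phi> \<Longrightarrow>
      m * (LBINT t. y t * dir_deriv 1 (dir_deriv 1 \<phi>) t) =
      (LBINT t. F' t * \<phi> t) + (LBINT t. (\<kappa> / a * (2 * y t - 2 * p (a * t) + c)) * dir_deriv 1 \<phi> t)"
    using string_solution_wave_form(3)[OF pos(2,3) a u init, of F'] F'_cont unfolding F'_def[abs_def] y_def by blast
  define q where "q t = \<kappa> / a * (2 * y t - 2 * p (a * t) + c)" for t
  have q_cont: "continuous_on UNIV q"
    unfolding q_def[abs_def] using a_pos
    by (intro continuous_intros y_cont continuous_on_compose2[OF p_cont[of UNIV]]) auto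
  obtain G where G: "\<And>x. (G has_real_derivative F' x) (at x)" "continuous_on UNIV G"
    by (rule continuous_antiderivative[OF F'_cont]) blast
  have qG: "continuous_on UNIV (\<lambda>t. q t - G t)" by (intro continuous_intros q_cont G)
  have weak: "m * (LBINT t. y t * dir_deriv 1 (dir_deriv 1 \<phi>) t) = (LBINT t. (q t - G t) * dir_deriv 1 \<phi> t)"
    if \<phi>: "test_fun {0<..} \<phi>" for \<phi>
  proof -
    have T: "test_fun UNIV \<phi>" by (rule test_fun_mono[OF \<phi>]) simp
    note T' = test_fun_dir_deriv[OF T, of 1]
    have "L2_weak_deriv 1 G F'"
      by (rule L2_weak_deriv_1I[where S="{}"]) (auto simp: G intro: loc_bdd_continuous F'_cont)
    then have "(LBINT t. G t * dir_deriv 1 \<phi> t) = - (LBINT t. F' t * \<phi> t)"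
      using T unfolding L2_weak_deriv_def weak_deriv_def by blast
    moreover have "(LBINT t. (q t - G t) * dir_deriv 1 \<phi> t) =
        (LBINT t. q t * dir_deriv 1 \<phi> t) - (LBINT t. G t * dir_deriv 1 \<phi> t)"
      using integrable_mult_test_fun[OF loc_bdd_continuous[OF q_cont] T'] integrable_mult_test_fun[OF loc_bdd_continuous[OF G(2)] T']
      by (simp add: left_diff_distrib)
    ultimately show ?thesis using c[OF \<phi>] by (simp add: q_def)
  qed
  have y_nonpos: "y t = y 0" if "t \<le> 0" for t using y0[OF that] y0[of 0] by simp
  have wave: "u = driven_string.wave p a y" if "driven_string p \<omega> p0 a y v" for v
  proof -
    interpret driven_string p \<omega> p0 a y v by (rule that)
    show ?thesis
    proof
      fix z :: "real \<times> real"
      show "u z = wave z"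
        using string_solution_wave_form(2)[OF pos(2,3) a u init, of "fst z" "snd z"] by (simp add: wave_def y_def)
    qed
  qed
  have eq_y: "(\<lambda>t. u (0, t)) = y" by (rule ext) (simp add: y_def)
  show thesis
  proof (cases "m = 0")
    case True
    have "(LBINT t. (q t - G t) * dir_deriv 1 \<phi> t) = 0" if "test_fun {0<..} \<phi>" for \<phi>
      using weak[OF that] True by simp
    from du_Bois_Reymond_1[OF qG this] obtain b where "\<And>t. t > 0 \<Longrightarrow> q t - G t = b" by blast
    then have b: "q t - G t = b" if "t \<ge> 0" for t using eq_on_half_line_closure[OF qG _ that] by blast
    let ?v = "\<lambda>t. massless_field \<kappa> a F p t (y t)"
    have yG: "y t = a / (2 * \<kappa>) * (b + G t) + p (a * t) - c / 2" if "t \<ge> 0" for t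
      using b[OF that] pos(3) a_pos by (simp add: q_def field_simps)
    have D: "(y has_real_derivative ?v t) (at t within {0..})" if "t \<ge> 0" for t
    proof (rule has_real_derivative_within_cong[where f="\<lambda>t. a / (2 * \<kappa>) * (b + G t) + p (a * t) - c / 2"])
      show "((\<lambda>t. a / (2 * \<kappa>) * (b + G t) + p (a * t) - c / 2) has_real_derivative ?v t) (at t within {0..})"
        by (rule derivative_eq_intros line_derivative has_field_derivative_at_within[OF G(1)] refl)+
          (simp add: massless_field_def F'_def mult.commute)
    qed (use that yG in auto)
    have "continuous_on UNIV (\<lambda>t. deriv p (a * t))"
      by (rule continuous_on_compose2[OF p'_cont]) (auto intro!: continuous_intros)
    then have "continuous_on UNIV (\<lambda>t. a / (2 * \<kappa>) * F' t + a * deriv p (a * t))"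
      by (intro continuous_on_add continuous_on_mult_left F'_cont)
    then have v_cont: "continuous_on {0..} ?v"
      unfolding massless_field_def F'_def by (rule continuous_on_subset) simp
    have d: "driven_string p \<omega> p0 a y ?v"
      by (intro driven_string.intro driven_string_axioms.intro half_line_periodic_axioms a_pos D v_cont y_nonpos)
    show thesis
    proof (rule that[of ?v, unfolded eq_y, OF d wave[OF d]])
      show "?v = (\<lambda>t. massless_field \<kappa> a F p t (u (0, t))) \<and> ode_solution_on {0..} (massless_field \<kappa> a F p) y"
        using D by (auto simp: ode_solution_on_def has_real_derivative_iff_has_vector_derivative y_def)
    qed (use True in auto)
  next
    case False
    then have m: "m > 0" using pos(1) by simp
    obtain H where H: "\<And>x. (H has_real_derivative q x - G x) (at x)" "continuous_on UNIV H"
      by (rule continuous_antiderivative[OF qG]) blast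
    have yH: "continuous_on UNIV (\<lambda>t. m * y t + H t)" by (intro continuous_intros y_cont H)
    have "(LBINT t. (m * y t + H t) * dir_deriv 1 (dir_deriv 1 \<phi>) t) = 0" if \<phi>: "test_fun {0<..} \<phi>" for \<phi>
    proof -
      have T: "test_fun UNIV (dir_deriv 1 \<phi>)" by (rule test_fun_mono[OF test_fun_dir_deriv[OF \<phi>]]) simp
      note T' = test_fun_dir_deriv[OF T, of 1]
      have "L2_weak_deriv 1 H (\<lambda>t. q t - G t)"
        by (rule L2_weak_deriv_1I[where S="{}"]) (auto simp: H intro: loc_bdd_continuous qG)
      then have "(LBINT t. H t * dir_deriv 1 (dir_deriv 1 \<phi>) t) = - (LBINT t. (q t - G t) * dir_deriv 1 \<phi> t)"
        using T unfolding L2_weak_deriv_def weak_deriv_def by blast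
      moreover have "(LBINT t. (m * y t + H t) * dir_deriv 1 (dir_deriv 1 \<phi>) t) =
          m * (LBINT t. y t * dir_deriv 1 (dir_deriv 1 \<phi>) t) + (LBINT t. H t * dir_deriv 1 (dir_deriv 1 \<phi>) t)"
        using integrable_mult_test_fun[OF loc_bdd_continuous[OF y_cont] T'] integrable_mult_test_fun[OF loc_bdd_continuous[OF H(2)] T']
        by (simp add: distrib_right mult.assoc)
      ultimately show ?thesis using weak[OF \<phi>] by simp
    qed
    from du_Bois_Reymond_2[OF yH this] obtain b d where bd: "\<And>t. t > 0 \<Longrightarrow> m * y t + H t = b + d * t" by blast
    have "m * y t + H t - d * t = b" if "t \<ge> 0" for t
      by (rule eq_on_half_line_closure[OF _ _ that, of "\<lambda>t. m * y t + H t - d * t"])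
        (use bd in \<open>auto intro!: continuous_intros y_cont H(2)\<close>)
    then have y_eq: "y t = (b + d * t - H t) / m" if "t \<ge> 0" for t
      using that m by (simp add: field_simps)
    define v where "v t = (d - (q t - G t)) / m" for t
    have D: "(y has_real_derivative v t) (at t within {0..})" if "t \<ge> 0" for t
    proof (rule has_real_derivative_within_cong[where f="\<lambda>t. (b + d * t - H t) / m"])
      show "((\<lambda>t. (b + d * t - H t) / m) has_real_derivative v t) (at t within {0..})"
        unfolding v_def using m
        by (auto intro!: derivative_eq_intros has_field_derivative_at_within[OF H(1)])
    qed (use that y_eq in auto)
    have v0: "v 0 = 0"
    proof -
      have "(y has_vector_derivative v 0) (at 0 within {0..})" "(y has_vector_derivative 0) (at 0 within {0..})"
        using D[of 0] rest[OF m] by (simp_all add: eq_y has_real_derivative_iff_has_vector_derivative)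
      moreover have "at (0::real) within {0..} \<noteq> bot" by (simp add: at_within_Ici_at_right)
      ultimately show ?thesis using vector_derivative_unique_within by blast
    qed
    have v_cont: "continuous_on {0..} v"
      unfolding v_def[abs_def] using m by (intro continuous_intros continuous_on_subset[OF qG]) auto
    have dr: "driven_string p \<omega> p0 a y v"
      by (intro driven_string.intro driven_string_axioms.intro half_line_periodic_axioms a_pos D v_cont y_nonpos)
    have Dv: "(v has_real_derivative (1 / m * F (y t) - 2 * \<kappa> / (a * m) * v t + 2 * \<kappa> / (a * m) * a * deriv p (a * t)))
        (at t within {0..})" if "t \<ge> 0" for t
    proof -
      have q': "(q has_real_derivative \<kappa> / a * (2 * v t - 2 * (deriv p (a * t) * a))) (at t within {0..})"
        unfolding q_def[abs_def] by (rule derivative_eq_intros D[OF that] line_derivative refl)+ simp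
      have "v = (\<lambda>t. (d - (q t - G t)) / m)" by (rule ext) (rule v_def)
      moreover have "((\<lambda>t. (d - (q t - G t)) / m) has_real_derivative
          (0 - (\<kappa> / a * (2 * v t - 2 * (deriv p (a * t) * a)) - F' t)) / m) (at t within {0..})"
        by (intro DERIV_cdivide DERIV_diff DERIV_const q' has_field_derivative_at_within[OF G(1)])
      ultimately have "(v has_real_derivative
          (0 - (\<kappa> / a * (2 * v t - 2 * (deriv p (a * t) * a)) - F' t)) / m) (at t within {0..})" by (simp only:)
      then show ?thesis
        by (rule DERIV_cong) (use m a_pos in \<open>simp add: F'_def field_simps\<close>)
    qed
    show thesis
    proof (rule that[of v, unfolded eq_y, OF dr wave[OF dr]])
      show "v 0 = 0 \<and> ode_solution_on {0..} (massive_field m \<kappa> a F p) (\<lambda>t. (u (0, t), v t))"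
        unfolding massive_solution_iff using D Dv v0 by (simp add: y_def[symmetric] eq_y)
    qed (use False in auto)
  qed
qed

end

context driven_string
begin

lemma wave_initial:
  assumes "t \<le> 0"
  shows "wave (x, t) = (if x + a * t \<le> 0 then y 0 else y 0 + p (x + a * t) - p0)"
proof -
  have at: "a * t \<le> 0" using assms a_pos by (simp add: mult_nonneg_nonpos)
  have "0 \<le> \<bar>x\<bar> / a" using a_pos by simp
  then have "y (t - \<bar>x\<bar> / a) = y 0" using assms by (intro y_nonpos) linarith
  then show ?thesis using at p_const[of "a * t - x"] p_const[of "x + a * t"] by (auto simp: wave_def add.commute)
qed

lemma wave_periodic:
  assumes y: "\<And>t. t \<ge> 0 \<Longrightarrow> y (t + \<omega> / a) = y t"
    and t: "t > \<bar>x\<bar> / a \<or> t + \<omega> / a < - (\<bar>x\<bar> / a)"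
  shows "wave (x, t + \<omega> / a) = wave (x, t)"
  using t
proof
  assume t: "t > \<bar>x\<bar> / a"
  then have "\<bar>x\<bar> < a * t" using a_pos by (simp add: field_simps)
  then have x: "0 \<le> a * t + x" "0 \<le> a * t - x" by auto
  have "a * (t + \<omega> / a) = a * t + \<omega>" using a_pos by (simp add: field_simps)
  moreover have "y (t + \<omega> / a - \<bar>x\<bar> / a) = y (t - \<bar>x\<bar> / a)" using y[of "t - \<bar>x\<bar> / a"] t by (simp add: algebra_simps)
  ultimately show ?thesis
    using p_periodic[OF x(1)] p_periodic[OF x(2)] by (simp add: wave_def algebra_simps)
next
  assume t: "t + \<omega> / a < - (\<bar>x\<bar> / a)"
  have "wave (x, s) = y 0" if s: "s < - (\<bar>x\<bar> / a)" for s
  proof -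
    have "0 \<le> \<bar>x\<bar> / a" using a_pos by simp
    then have "s \<le> 0" using s by linarith
    moreover have "a * s < - \<bar>x\<bar>" using s a_pos by (simp add: field_simps)
    then have "x + a * s \<le> 0" by linarith
    ultimately show ?thesis by (simp add: wave_initial)
  qed
  moreover have "t < - (\<bar>x\<bar> / a)" using t \<omega>_pos a_pos by (smt (verit) divide_pos_pos)
  ultimately show ?thesis using t by simp
qed

end

subsection \<open>Convergence\<close>

lemma ode_solution_on_cong:
  assumes "ode_solution_on I X Y" "\<And>t. t \<in> I \<Longrightarrow> Z t = Y t"
  shows "ode_solution_on I X Z"
  using assms unfolding ode_solution_on_def has_vector_derivative_def
  by (metis has_derivative_transform)

context half_line_periodic
begin

lemma massless_convergence:
  assumes pos: "\<kappa> > 0" "a > 0"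
    and F: "F C1_differentiable_on UNIV" "filterlim F at_bot at_top" "filterlim F at_top at_bot"
    and Y: "ode_solution_on {0..} (massless_field \<kappa> a F p) Y"
  obtains y v where "driven_string p \<omega> p0 a y v" "\<And>t. t \<ge> 0 \<Longrightarrow> y (t + \<omega> / a) = y t"
    "((\<lambda>t. Y t - y t) \<longlongrightarrow> 0) at_top" "((\<lambda>t. massless_field \<kappa> a F p t (Y t) - v t) \<longlongrightarrow> 0) at_top"
    "ode_solution_on {0..} (massless_field \<kappa> a F p) y"
    "\<And>t. ((\<lambda>_. 0) has_real_derivative F (y t) + \<kappa> * (2 * deriv p (a * t) - 2 * v t / a)) (at t within {0..})"
    "(\<lambda>n. (poincare_map (massless_field \<kappa> a F p) (\<omega> / a) ^^ n) (Y 0)) \<longlonglongrightarrow> y 0"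
proof -
  interpret periodic_ode "massless_field \<kappa> a F p" "\<omega> / a" by (rule massless_periodic_ode[OF F(1) pos(2)])
  note bd = massless_solution_bounded[OF F(2,3) pos(2,1) Y]
  obtain Z where Z: "ode_solution_on {0..} (massless_field \<kappa> a F p) Z" "\<And>t. t \<ge> 0 \<Longrightarrow> Z (t + \<omega> / a) = Z t"
    "(\<lambda>n. Y (real n * (\<omega> / a))) \<longlonglongrightarrow> Z 0" "bounded (Z ` {0..})" "((\<lambda>t. Y t - Z t) \<longlongrightarrow> 0) at_top"
    by (rule converges_to_periodic[OF Y bd massless_solution_convergent[OF F pos(2,1) Y]]) blast
  define y where "y t = Z (max t 0)" for t
  have yZ: "y t = Z t" if "t \<ge> 0" for t using that by (simp add: y_def max_def)
  define v where "v t = massless_field \<kappa> a F p t (y t)" for t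
  have ode: "ode_solution_on {0..} (massless_field \<kappa> a F p) y"
    by (rule ode_solution_on_cong[OF Z(1)]) (simp add: yZ)
  have F_cont: "continuous_on UNIV F" by (rule C1_differentiable_on_UNIV_real(3)[OF F(1)])
  have v_cont: "continuous_on {0..} v"
  proof -
    have "continuous_on {0..} (\<lambda>t. F (y t))"
      by (rule continuous_on_compose2[OF F_cont ode_solution_on_continuous[OF ode]]) simp
    moreover have "continuous_on {0..} (\<lambda>t. deriv p (a * t))"
      by (rule continuous_on_compose2[OF p'_cont]) (auto intro!: continuous_intros)
    ultimately show ?thesis
      unfolding v_def[abs_def] massless_field_def by (intro continuous_on_add continuous_on_mult_left)
  qed
  show thesis
  proof (rule that)
    show "driven_string p \<omega> p0 a y v"
    proof (intro driven_string.intro driven_string_axioms.intro half_line_periodic_axioms pos v_cont)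
      show "(y has_real_derivative v t) (at t within {0..})" if "t \<ge> 0" for t
        using ode that by (simp add: ode_solution_on_def v_def has_real_derivative_iff_has_vector_derivative)
      show "y t = y 0" if "t \<le> 0" for t using that by (simp add: y_def max_def)
    qed
    show "y (t + \<omega> / a) = y t" if "t \<ge> 0" for t
      using Z(2)[OF that] that \<tau>_pos by (simp add: yZ)
    have ev: "\<forall>\<^sub>F t in at_top. (0::real) \<le> t" by (rule eventually_ge_at_top)
    show lim: "((\<lambda>t. Y t - y t) \<longlongrightarrow> 0) at_top"
      by (rule Lim_transform_eventually[OF Z(5)]) (use ev in eventually_elim, simp add: yZ)
    obtain L where L: "\<And>t z w. t \<ge> 0 \<Longrightarrow> z \<in> Y ` {0..} \<union> Z ` {0..} \<Longrightarrow> w \<in> Y ` {0..} \<union> Z ` {0..} \<Longrightarrow>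
        norm (massless_field \<kappa> a F p t z - massless_field \<kappa> a F p t w) \<le> L * norm (z - w)"
      by (rule lipschitz_on_boundedE[OF X_lip, of "Y ` {0..} \<union> Z ` {0..}"]) (use bd Z(4) in auto)
    show "((\<lambda>t. massless_field \<kappa> a F p t (Y t) - v t) \<longlongrightarrow> 0) at_top"
    proof (rule Lim_null_comparison)
      show "\<forall>\<^sub>F t in at_top. norm (massless_field \<kappa> a F p t (Y t) - v t) \<le> L * norm (Y t - y t)"
      proof (rule eventually_mono[OF ev])
        fix t :: real assume t: "0 \<le> t"
        show "norm (massless_field \<kappa> a F p t (Y t) - v t) \<le> L * norm (Y t - y t)"
          unfolding v_def yZ[OF t] by (rule L) (use t in auto)
      qed
      show "((\<lambda>t. L * norm (Y t - y t)) \<longlongrightarrow> 0) at_top"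
        by (rule tendsto_mult_right_zero[OF tendsto_norm_zero[OF lim]])
    qed
    show "((\<lambda>_. 0) has_real_derivative F (y t) + \<kappa> * (2 * deriv p (a * t) - 2 * v t / a)) (at t within {0..})" for t
      by (rule DERIV_cong[OF DERIV_const]) (use pos in \<open>simp add: v_def massless_field_def field_simps\<close>)
    show "(\<lambda>n. (poincare_map (massless_field \<kappa> a F p) (\<omega> / a) ^^ n) (Y 0)) \<longlonglongrightarrow> y 0"
      using Z(3) by (simp add: poincare_iterate[OF Y] yZ)
  qed (rule ode)
qed

lemma massive_convergence:
  assumes pos: "m > 0" "\<kappa> > 0" "a > 0" and F: "F C1_differentiable_on UNIV"
    and cond: "cond_F2 m \<kappa> a F \<or> cond_F3 m \<kappa> a F p"
    and Y: "ode_solution_on {0..} (massive_field m \<kappa> a F p) (\<lambda>t. (Y t, V t))"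
  obtains y v where "driven_string p \<omega> p0 a y v" "\<And>t. t \<ge> 0 \<Longrightarrow> y (t + \<omega> / a) = y t"
    "((\<lambda>t. Y t - y t) \<longlongrightarrow> 0) at_top" "((\<lambda>t. V t - v t) \<longlongrightarrow> 0) at_top"
    "ode_solution_on {0..} (massive_field m \<kappa> a F p) (\<lambda>t. (y t, v t))"
    "\<And>t. t \<ge> 0 \<Longrightarrow> ((\<lambda>t. m * v t) has_real_derivative F (y t) + \<kappa> * (2 * deriv p (a * t) - 2 * v t / a)) (at t within {0..})"
    "(\<lambda>n. (poincare_map (massive_field m \<kappa> a F p) (\<omega> / a) ^^ n) (Y 0, V 0)) \<longlonglongrightarrow> (y 0, v 0)"
proof -
  interpret periodic_ode "massive_field m \<kappa> a F p" "\<omega> / a" by (rule massive_periodic_ode[OF F pos(3)])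
  let ?Y = "\<lambda>t. (Y t, V t)"
  have Y1: "ode_solution_on {0..} (massive_field m \<kappa> a F p) (\<lambda>t. (Y (t + \<omega> / a), V (t + \<omega> / a)))"
    using shift[OF Y, of 1] by simp
  obtain C \<gamma> t0 where C: "\<gamma> > 0" "t0 \<ge> 0"
    "\<And>t. t \<ge> t0 \<Longrightarrow> norm ((Y (t + \<omega> / a), V (t + \<omega> / a)) - (Y t, V t)) \<le> C * exp (- \<gamma> * t)"
    by (rule massive_solutions_contract[OF F pos cond Y1 Y]) blast
  have close: "bounded (?Y ` {0..})" "convergent (\<lambda>n. ?Y (real n * (\<omega> / a)))"
    by (rule exponentially_close_shifts[OF Y C(2,1,3)]; assumption)+
  obtain Z where Z: "ode_solution_on {0..} (massive_field m \<kappa> a F p) Z" "\<And>t. t \<ge> 0 \<Longrightarrow> Z (t + \<omega> / a) = Z t"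
    "(\<lambda>n. (Y (real n * (\<omega> / a)), V (real n * (\<omega> / a)))) \<longlonglongrightarrow> Z 0" "bounded (Z ` {0..})" "((\<lambda>t. (Y t, V t) - Z t) \<longlongrightarrow> 0) at_top"
    by (rule converges_to_periodic[OF Y close]) blast
  define y where "y t = fst (Z (max t 0))" for t
  define v where "v t = snd (Z (max t 0))" for t
  have yZ: "(y t, v t) = Z t" if "t \<ge> 0" for t using that by (simp add: y_def v_def max_def)
  have ode: "ode_solution_on {0..} (massive_field m \<kappa> a F p) (\<lambda>t. (y t, v t))"
    by (rule ode_solution_on_cong[OF Z(1)]) (simp add: yZ)
  note sol = ode[unfolded massive_solution_iff, rule_format]
  have ev: "\<forall>\<^sub>F t in at_top. (0::real) \<le> t" by (rule eventually_ge_at_top)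
  have lim: "((\<lambda>t. (Y t, V t) - (y t, v t)) \<longlongrightarrow> 0) at_top"
    by (rule Lim_transform_eventually[OF Z(5)]) (use ev in eventually_elim, simp add: yZ)
  show thesis
  proof (rule that)
    show "driven_string p \<omega> p0 a y v"
    proof (intro driven_string.intro driven_string_axioms.intro half_line_periodic_axioms pos)
      show "(y has_real_derivative v t) (at t within {0..})" if "t \<ge> 0" for t using sol[of t] that by simp
      show "continuous_on {0..} v"
        using sol by (meson DERIV_continuous continuous_on_eq_continuous_within)
      show "y t = y 0" if "t \<le> 0" for t using that by (simp add: y_def max_def)
    qed
    show "y (t + \<omega> / a) = y t" if "t \<ge> 0" for t
    proof -
      have "(y (t + \<omega> / a), v (t + \<omega> / a)) = Z (t + \<omega> / a)" by (rule yZ) (use that \<tau>_pos in simp)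
      also have "\<dots> = (y t, v t)" using Z(2)[OF that] yZ[OF that] by (simp only:)
      finally show ?thesis by simp
    qed
    show "((\<lambda>t. Y t - y t) \<longlongrightarrow> 0) at_top" "((\<lambda>t. V t - v t) \<longlongrightarrow> 0) at_top"
      using tendsto_fst[OF lim] tendsto_snd[OF lim] by simp_all
    show "((\<lambda>t. m * v t) has_real_derivative F (y t) + \<kappa> * (2 * deriv p (a * t) - 2 * v t / a)) (at t within {0..})"
      if "t \<ge> 0" for t
      by (rule DERIV_cong[OF DERIV_cmult[OF sol[THEN conjunct2]]]) (use that pos in \<open>auto simp: field_simps\<close>)
    show "(\<lambda>n. (poincare_map (massive_field m \<kappa> a F p) (\<omega> / a) ^^ n) (Y 0, V 0)) \<longlonglongrightarrow> (y 0, v 0)"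
      using Z(3) by (simp add: poincare_iterate[OF Y] yZ)
  qed (rule ode)
qed

end

theorem mainTheorem4:
  fixes m \<mu> \<kappa> a \<omega> p\<^sub>0 :: real
    and F p :: "real \<Rightarrow> real"
    and u :: "real \<times> real \<Rightarrow> real"
  assumes "m \<ge> 0" and "\<mu> > 0" and "\<kappa> > 0" and "a = sqrt (\<kappa> / \<mu>)"
    and "F C1_differentiable_on UNIV"
    and "filterlim F at_bot at_top" and "filterlim F at_top at_bot"
    and "m > 0 \<Longrightarrow> cond_F2 m \<kappa> a F \<or> cond_F3 m \<kappa> a F p"
    and "p C1_differentiable_on UNIV" and "\<omega> > 0" and "F p\<^sub>0 = 0"
    and "\<And>z. z > 0 \<Longrightarrow> p (z + \<omega>) = p z"
    and "\<And>z. z \<le> 0 \<Longrightarrow> p z = p\<^sub>0"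
    and "string_solution m \<mu> \<kappa> F u"
    and "\<And>x t. t \<le> 0 \<Longrightarrow> u (x, t) = p (x + a * t)"
    and "m > 0 \<Longrightarrow> ((\<lambda>t. u (0, t)) has_real_derivative 0) (at 0 within {0..})"
  shows "\<exists>q\<^sub>0 u\<^sub>p.
    (let q = (\<lambda>x. if x \<le> 0 then q\<^sub>0 else q\<^sub>0 + p x - p\<^sub>0) in
       string_solution m \<mu> \<kappa> F u\<^sub>p \<and> (\<forall>x t. t \<le> 0 \<longrightarrow> u\<^sub>p (x, t) = q (x + a * t))) \<and>
    (\<forall>x t. t > \<bar>x\<bar> / a \<or> t + \<omega> / a < - (\<bar>x\<bar> / a) \<longrightarrow> u\<^sub>p (x, t + \<omega> / a) = u\<^sub>p (x, t)) \<and>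
    local_energy_convergent u u\<^sub>p \<and>
    (\<exists>y\<^sub>p.
       (m = 0 \<longrightarrow>
          (\<lambda>n. (poincare_map (massless_field \<kappa> a F p) (\<omega> / a) ^^ n) p\<^sub>0) \<longlonglongrightarrow> q\<^sub>0 \<and>
          ode_solution_on {0..} (massless_field \<kappa> a F p) y\<^sub>p \<and> y\<^sub>p 0 = q\<^sub>0) \<and>
       (m > 0 \<longrightarrow> (\<exists>y\<^sub>1 v\<^sub>p.
          (\<lambda>n. (poincare_map (massive_field m \<kappa> a F p) (\<omega> / a) ^^ n) (p\<^sub>0, 0)) \<longlonglongrightarrow> (q\<^sub>0, y\<^sub>1) \<and>
          ode_solution_on {0..} (massive_field m \<kappa> a F p) (\<lambda>t. (y\<^sub>p t, v\<^sub>p t)) \<and>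
          y\<^sub>p 0 = q\<^sub>0 \<and> v\<^sub>p 0 = y\<^sub>1)) \<and>
       (\<forall>t\<ge>0. y\<^sub>p (t + \<omega> / a) = y\<^sub>p t) \<and>
       (\<forall>t<0. y\<^sub>p t = q\<^sub>0) \<and>
       (\<forall>x t. t > 0 \<and> x > 0 \<longrightarrow>
          u\<^sub>p (x, t) = y\<^sub>p (t - x / a) - p (a * t - x) + p (x + a * t)) \<and>
       (\<forall>x t. t > 0 \<and> x < 0 \<longrightarrow> u\<^sub>p (x, t) = y\<^sub>p (t + x / a)))"
proof -
  interpret half_line_periodic p \<omega> p\<^sub>0 by unfold_locales (use assms(9,10,12,13) in auto)
  note pos = assms(1-3)
  have a_pos: "a > 0" using pos assms(4) by simp
  have F_cont: "continuous_on UNIV F" by (rule C1_differentiable_on_UNIV_real(3)[OF assms(5)])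
  define Y where "Y = (\<lambda>t. u (0, t))"
  have Y0: "Y 0 = p\<^sub>0" using assms(15)[of 0 0] assms(13)[of 0] by (simp add: Y_def)
  obtain V where V: "driven_string p \<omega> p\<^sub>0 a Y V" "u = driven_string.wave p a Y"
    "m = 0 \<Longrightarrow> V = (\<lambda>t. massless_field \<kappa> a F p t (Y t)) \<and> ode_solution_on {0..} (massless_field \<kappa> a F p) Y"
    "m > 0 \<Longrightarrow> V 0 = 0 \<and> ode_solution_on {0..} (massive_field m \<kappa> a F p) (\<lambda>t. (Y t, V t))"
    using string_solution_driven[OF pos assms(4) F_cont assms(14,15,16)] unfolding Y_def by blast
  obtain y v where y: "driven_string p \<omega> p\<^sub>0 a y v" "\<And>t. t \<ge> 0 \<Longrightarrow> y (t + \<omega> / a) = y t"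
      "((\<lambda>t. Y t - y t) \<longlongrightarrow> 0) at_top" "((\<lambda>t. V t - v t) \<longlongrightarrow> 0) at_top"
      "\<And>t. t \<ge> 0 \<Longrightarrow> ((\<lambda>t. m * v t) has_real_derivative F (y t) + \<kappa> * (2 * deriv p (a * t) - 2 * v t / a)) (at t within {0..})"
      "m = 0 \<longrightarrow> ode_solution_on {0..} (massless_field \<kappa> a F p) y \<and>
        (\<lambda>n. (poincare_map (massless_field \<kappa> a F p) (\<omega> / a) ^^ n) p\<^sub>0) \<longlonglongrightarrow> y 0"
      "m > 0 \<longrightarrow> ode_solution_on {0..} (massive_field m \<kappa> a F p) (\<lambda>t. (y t, v t)) \<and>
        (\<lambda>n. (poincare_map (massive_field m \<kappa> a F p) (\<omega> / a) ^^ n) (p\<^sub>0, 0)) \<longlonglongrightarrow> (y 0, v 0)"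
  proof (cases "m = 0")
    case True
    note VY = V(3)[OF True]
    show ?thesis
      by (rule massless_convergence[OF pos(3) a_pos assms(5-7) VY[THEN conjunct2]], rule that)
        (simp_all add: True VY[THEN conjunct1] Y0)
  next
    case False
    then have m: "m > 0" using pos(1) by simp
    note VY = V(4)[OF m]
    show ?thesis
      by (rule massive_convergence[OF m pos(3) a_pos assms(5) assms(8)[OF m] VY[THEN conjunct2]], rule that)
        (simp_all add: m False VY[THEN conjunct1] Y0)
  qed
  interpret W: driven_string p \<omega> p\<^sub>0 a y v by (rule y(1))
  show ?thesis
    unfolding Let_def
  proof (rule exI[of _ "y 0"], rule exI[of _ W.wave], intro conjI allI impI)
    show "string_solution m \<mu> \<kappa> F W.wave"
      by (intro W.wave_string_solution pos assms(4) F_cont y(5))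
    show "W.wave (x, t) = (if x + a * t \<le> 0 then y 0 else y 0 + p (x + a * t) - p\<^sub>0)" if "t \<le> 0" for x t
      by (rule W.wave_initial[OF that])
    show "W.wave (x, t + \<omega> / a) = W.wave (x, t)" if "t > \<bar>x\<bar> / a \<or> t + \<omega> / a < - (\<bar>x\<bar> / a)" for x t
      by (rule W.wave_periodic[OF y(2) that])
    show "local_energy_convergent u W.wave"
      unfolding V(2) by (rule driven_strings_local_energy_convergent[OF V(1) y(1,3,4)])
  qed (rule exI[of _ y], use y(2,6,7) W.y_nonpos[OF less_imp_le] in \<open>auto simp: W.wave_def add.commute\<close>)
qed

end
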